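(* Let $\theta$ be an irrational real number. Then the noncommutative torus algebra $\mathcal{O}(\mathbb{T}^2_\theta)$, with the $\mathbb{Z}_2$-grading determined by the involutive automorphism $\sigma: U\mapsto U^*,\ V\mapsto V^*$, is a strongly $\mathbb{Z}_2$-graded algebra, and its degree-zero (i.e. $\sigma$-fixed) subalgebra, the noncommutative pillow algebra $\mathcal{O}(P_\theta)$, is homologically smooth.
   Context: All algebras are associative unital complex $*$-algebras; tensor products are over $\mathbb{C}$. An algebra $B$ is homologically smooth if, as a $B$-bimodule (equivalently as a left $B\otimes B^{\rm op}$-module), it has a resolution of finite length by finitely generated projective $B$-bimodules. For a group $G$, a $G$-graded algebra $A=\bigoplus_{g\in G}A_g$ is strongly graded if $A_gA_h=A_{gh}$ for all $g,h\in G$. Let $\lambda=e^{2\pi i\theta}$. $\mathcal{O}(\mathbb{T}^2_\theta)$ is the complex $*$-algebra generated by unitaries $U,V$ (so $UU^*=U^*U=1=VV^*=V^*V$) subject to $UV=\lambda VU$. The assignment $\sigma(U)=U^*$, $\sigma(V)=V^*$ extends to an algebra automorphism $\sigma$ of $\mathcal{O}(\mathbb{T}^2_\theta)$ with $\sigma^2=\mathrm{id}$. The $\mathbb{Z}_2$-grading has degree-$0$ part $\{x:\sigma(x)=x\}$ and degree-$1$ part $\{x:\sigma(x)=-x\}$. $\mathcal{O}(P_\theta)$ denotes the fixed point subalgebra $\{x\in\mathcal{O}(\mathbb{T}^2_\theta):\sigma(x)=x\}$ (it is generated by $U+U^*$ and $V+V^*$). *)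

theory Defs
  imports Complex_Main "HOL-Algebra.Algebra" "HOL-Algebra.Algebraic_Closure_Type" "HOL-Library.Poly_Mapping"
begin

section \<open>Complex algebras and complex *-algebras\<close>

abbreviation complex_field :: "complex ring" where
  "complex_field \<equiv> ring_of_type_algebra"

text \<open>The locale \<open>algebra\<close> of the library is restricted to commutative algebras.\<close>

locale complex_algebra = module complex_field A + A?: ring A
  for A :: "(complex, 'a, 'm) module_scheme" (structure) +
  assumes smult_mult_left:
      "\<lbrakk>x \<in> carrier A; y \<in> carrier A\<rbrakk> \<Longrightarrow> (c \<odot>\<^bsub>A\<^esub> x) \<otimes>\<^bsub>A\<^esub> y = c \<odot>\<^bsub>A\<^esub> (x \<otimes>\<^bsub>A\<^esub> y)"
    and smult_mult_right:
      "\<lbrakk>x \<in> carrier A; y \<in> carrier A\<rbrakk> \<Longrightarrow> x \<otimes>\<^bsub>A\<^esub> (c \<odot>\<^bsub>A\<^esub> y) = c \<odot>\<^bsub>A\<^esub> (x \<otimes>\<^bsub>A\<^esub> y)"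

record 'a star_algebra = "(complex, 'a) module" +
  star :: "'a \<Rightarrow> 'a"

locale complex_star_algebra = complex_algebra A
  for A :: "('a, 'm) star_algebra_scheme" (structure) +
  assumes star_closed: "x \<in> carrier A \<Longrightarrow> star A x \<in> carrier A"
    and star_star: "x \<in> carrier A \<Longrightarrow> star A (star A x) = x"
    and star_add:
      "\<lbrakk>x \<in> carrier A; y \<in> carrier A\<rbrakk> \<Longrightarrow> star A (x \<oplus>\<^bsub>A\<^esub> y) = star A x \<oplus>\<^bsub>A\<^esub> star A y"
    and star_smult: "x \<in> carrier A \<Longrightarrow> star A (c \<odot>\<^bsub>A\<^esub> x) = cnj c \<odot>\<^bsub>A\<^esub> star A x"
    and star_mult:
      "\<lbrakk>x \<in> carrier A; y \<in> carrier A\<rbrakk> \<Longrightarrow> star A (x \<otimes>\<^bsub>A\<^esub> y) = star A y \<otimes>\<^bsub>A\<^esub> star A x"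

text \<open>The algebra structure on the library's quotient ring \<^term>\<open>A Quot I\<close>.\<close>

definition quotient_algebra ::
  "((complex, 'a, 'm) module_scheme) \<Rightarrow> 'a set \<Rightarrow> (complex, 'a set) module" where
  "quotient_algebra A I = ring.extend (A Quot I)
     (module.fields (\<lambda>c K. \<Union>x\<in>K. I +>\<^bsub>A\<^esub> (c \<odot>\<^bsub>A\<^esub> x)))"

definition quotient_star_algebra ::
  "('a, 'm) star_algebra_scheme \<Rightarrow> 'a set \<Rightarrow> 'a set star_algebra" where
  "quotient_star_algebra A I = module.extend (quotient_algebra A I)
     (star_algebra.fields (\<lambda>K. \<Union>x\<in>K. I +>\<^bsub>A\<^esub> star A x))"

text \<open>The smallest two-sided ideal that contains \<open>S\<close> and is closed under the involution.\<close>

definition star_ideal :: "('a, 'm) star_algebra_scheme \<Rightarrow> 'a set \<Rightarrow> 'a set" where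
  "star_ideal A S = \<Inter>{I. ideal I A \<and> (\<forall>x\<in>I. star A x \<in> I) \<and> S \<subseteq> I}"


section \<open>Monoid algebras\<close>

definition monoid_algebra ::
  "('g, 'm) monoid_scheme \<Rightarrow> (complex, 'g \<Rightarrow>\<^sub>0 complex) module" where
  "monoid_algebra G =
    \<lparr>carrier = {f. Poly_Mapping.keys f \<subseteq> carrier G},
     monoid.mult = (\<lambda>f g. \<Sum>a\<in>Poly_Mapping.keys f. \<Sum>b\<in>Poly_Mapping.keys g.
               Poly_Mapping.single (a \<otimes>\<^bsub>G\<^esub> b) (Poly_Mapping.lookup f a * Poly_Mapping.lookup g b)),
     one = Poly_Mapping.single \<one>\<^bsub>G\<^esub> 1,
     ring.zero = 0,
     add = (+),
     module.smult = (\<lambda>c. Poly_Mapping.map ((*) c))\<rparr>"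

definition push_forward :: "('g \<Rightarrow> 'h) \<Rightarrow> ('g \<Rightarrow>\<^sub>0 complex) \<Rightarrow> ('h \<Rightarrow>\<^sub>0 complex)" where
  "push_forward h f = (\<Sum>k\<in>Poly_Mapping.keys f. Poly_Mapping.single (h k) (Poly_Mapping.lookup f k))"


section \<open>The noncommutative torus and the noncommutative pillow\<close>

text \<open>The free *-algebra on two generators \<open>U\<close>, \<open>V\<close> is the algebra of noncommutative polynomials
  in the four letters \<open>U\<close>, \<open>U\<^sup>*\<close>, \<open>V\<close>, \<open>V\<^sup>*\<close>.\<close>

datatype letter = Gen_U | Adj_U | Gen_V | Adj_V

fun adj :: "letter \<Rightarrow> letter" where
  "adj Gen_U = Adj_U"
| "adj Adj_U = Gen_U"
| "adj Gen_V = Adj_V"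
| "adj Adj_V = Gen_V"

definition word_monoid :: "letter list monoid" where
  "word_monoid = \<lparr>carrier = UNIV, monoid.mult = (@), one = []\<rparr>"

definition free_star_algebra :: "(letter list \<Rightarrow>\<^sub>0 complex) star_algebra" where
  "free_star_algebra = module.extend (monoid_algebra word_monoid)
     (star_algebra.fields
       (\<lambda>f. push_forward (\<lambda>w. rev (map adj w)) (Poly_Mapping.map cnj f)))"

abbreviation word :: "letter list \<Rightarrow> (letter list \<Rightarrow>\<^sub>0 complex)" where
  "word w \<equiv> Poly_Mapping.single w 1"

definition torus_relations :: "real \<Rightarrow> (letter list \<Rightarrow>\<^sub>0 complex) set" where
  "torus_relations \<theta> =
    {word [Gen_U, Adj_U] - word [], word [Adj_U, Gen_U] - word [],
     word [Gen_V, Adj_V] - word [], word [Adj_V, Gen_V] - word [],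
     word [Gen_U, Gen_V]
       - Poly_Mapping.single [Gen_V, Gen_U] (exp (2 * of_real pi * \<i> * of_real \<theta>))}"

definition torus_ideal :: "real \<Rightarrow> (letter list \<Rightarrow>\<^sub>0 complex) set" where
  "torus_ideal \<theta> = star_ideal free_star_algebra (torus_relations \<theta>)"

definition nc_torus :: "real \<Rightarrow> (letter list \<Rightarrow>\<^sub>0 complex) set star_algebra" where
  "nc_torus \<theta> = quotient_star_algebra free_star_algebra (torus_ideal \<theta>)"

definition torus_class :: "real \<Rightarrow> (letter list \<Rightarrow>\<^sub>0 complex) \<Rightarrow> (letter list \<Rightarrow>\<^sub>0 complex) set" where
  "torus_class \<theta> f = torus_ideal \<theta> +>\<^bsub>free_star_algebra\<^esub> f"

definition torus_U :: "real \<Rightarrow> (letter list \<Rightarrow>\<^sub>0 complex) set" where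
  "torus_U \<theta> = torus_class \<theta> (word [Gen_U])"

definition torus_V :: "real \<Rightarrow> (letter list \<Rightarrow>\<^sub>0 complex) set" where
  "torus_V \<theta> = torus_class \<theta> (word [Gen_V])"

text \<open>The automorphism of the torus induced by the exchange of \<open>U\<close> with \<open>U\<^sup>*\<close> and of \<open>V\<close> with \<open>V\<^sup>*\<close>.
  It is complex linear and multiplicative, so words are not reversed.\<close>

definition torus_flip ::
  "real \<Rightarrow> (letter list \<Rightarrow>\<^sub>0 complex) set \<Rightarrow> (letter list \<Rightarrow>\<^sub>0 complex) set" where
  "torus_flip \<theta> K = (\<Union>f\<in>K. torus_class \<theta> (push_forward (map adj) f))"

definition torus_part :: "real \<Rightarrow> int \<Rightarrow> (letter list \<Rightarrow>\<^sub>0 complex) set set" where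
  "torus_part \<theta> k =
    (if k = 0 then {x \<in> carrier (nc_torus \<theta>). torus_flip \<theta> x = x}
     else {x \<in> carrier (nc_torus \<theta>). torus_flip \<theta> x = \<ominus>\<^bsub>nc_torus \<theta>\<^esub> x})"

definition nc_pillow :: "real \<Rightarrow> (letter list \<Rightarrow>\<^sub>0 complex) set star_algebra" where
  "nc_pillow \<theta> = (nc_torus \<theta>)\<lparr>carrier := {x \<in> carrier (nc_torus \<theta>). torus_flip \<theta> x = x}\<rparr>"


section \<open>Strongly graded algebras\<close>

locale strongly_graded_algebra = G?: group G + A?: complex_algebra A
  for G :: "('g, 'k) monoid_scheme" (structure)
    and A :: "(complex, 'a, 'm) module_scheme" (structure) +
  fixes part :: "'g \<Rightarrow> 'a set"
  assumes part_subspace: "g \<in> carrier G \<Longrightarrow> submodule (part g) complex_field A"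
    and direct_sum: "x \<in> carrier A \<Longrightarrow>
      \<exists>!f. f \<in> (\<Pi>\<^sub>E g\<in>carrier G. part g) \<and> finite {g \<in> carrier G. f g \<noteq> \<zero>\<^bsub>A\<^esub>} \<and>
           x = (\<Oplus>\<^bsub>A\<^esub>g\<in>{g \<in> carrier G. f g \<noteq> \<zero>\<^bsub>A\<^esub>}. f g)"
    and part_mult: "\<lbrakk>g \<in> carrier G; h \<in> carrier G\<rbrakk> \<Longrightarrow>
      generate (add_monoid A) {x \<otimes>\<^bsub>A\<^esub> y | x y. x \<in> part g \<and> y \<in> part h} = part (g \<otimes>\<^bsub>G\<^esub> h)"


section \<open>Left modules and finite resolutions\<close>

text \<open>The locale \<open>module\<close> of the library is restricted to commutative rings.\<close>

locale left_module = R?: ring R + M?: abelian_group M 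
  for R :: "('r, 'k) ring_scheme" (structure) and M :: "('r, 'a, 'm) module_scheme" (structure) +
  assumes smult_closed: "\<lbrakk>a \<in> carrier R; x \<in> carrier M\<rbrakk> \<Longrightarrow> a \<odot>\<^bsub>M\<^esub> x \<in> carrier M"
    and smult_l_distr: "\<lbrakk>a \<in> carrier R; b \<in> carrier R; x \<in> carrier M\<rbrakk> \<Longrightarrow>
      (a \<oplus>\<^bsub>R\<^esub> b) \<odot>\<^bsub>M\<^esub> x = a \<odot>\<^bsub>M\<^esub> x \<oplus>\<^bsub>M\<^esub> b \<odot>\<^bsub>M\<^esub> x"
    and smult_r_distr: "\<lbrakk>a \<in> carrier R; x \<in> carrier M; y \<in> carrier M\<rbrakk> \<Longrightarrow>
      a \<odot>\<^bsub>M\<^esub> (x \<oplus>\<^bsub>M\<^esub> y) = a \<odot>\<^bsub>M\<^esub> x \<oplus>\<^bsub>M\<^esub> a \<odot>\<^bsub>M\<^esub> y"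
    and smult_assoc: "\<lbrakk>a \<in> carrier R; b \<in> carrier R; x \<in> carrier M\<rbrakk> \<Longrightarrow>
      (a \<otimes>\<^bsub>R\<^esub> b) \<odot>\<^bsub>M\<^esub> x = a \<odot>\<^bsub>M\<^esub> (b \<odot>\<^bsub>M\<^esub> x)"
    and smult_one: "x \<in> carrier M \<Longrightarrow> \<one>\<^bsub>R\<^esub> \<odot>\<^bsub>M\<^esub> x = x"

definition left_module_hom ::
  "('r, 'k) ring_scheme \<Rightarrow> ('r, 'a, 'm) module_scheme \<Rightarrow> ('r, 'b, 'n) module_scheme \<Rightarrow> ('a \<Rightarrow> 'b) set"
  where
  "left_module_hom R M N = {f \<in> carrier M \<rightarrow> carrier N.
     (\<forall>x\<in>carrier M. \<forall>y\<in>carrier M. f (x \<oplus>\<^bsub>M\<^esub> y) = f x \<oplus>\<^bsub>N\<^esub> f y) \<and>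
     (\<forall>a\<in>carrier R. \<forall>x\<in>carrier M. f (a \<odot>\<^bsub>M\<^esub> x) = a \<odot>\<^bsub>N\<^esub> f x)}"

text \<open>The ring operations of a module record carry no information.\<close>

definition free_left_module :: "('r, 'k) ring_scheme \<Rightarrow> nat \<Rightarrow> ('r, nat \<Rightarrow> 'r) module" where
  "free_left_module R n =
    \<lparr>carrier = (\<Pi>\<^sub>E i\<in>{..<n}. carrier R),
     monoid.mult = undefined,
     one = undefined,
     ring.zero = (\<lambda>i\<in>{..<n}. \<zero>\<^bsub>R\<^esub>),
     add = (\<lambda>x y. \<lambda>i\<in>{..<n}. x i \<oplus>\<^bsub>R\<^esub> y i),
     module.smult = (\<lambda>a x. \<lambda>i\<in>{..<n}. a \<otimes>\<^bsub>R\<^esub> x i)\<rparr>"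

text \<open>A finitely generated projective module is a module isomorphic to a direct summand of a free
  module of finite rank.\<close>

definition fg_projective :: "('r, 'k) ring_scheme \<Rightarrow> ('r, 'a, 'm) module_scheme \<Rightarrow> bool" where
  "fg_projective R P \<longleftrightarrow> left_module R P \<and>
    (\<exists>n S T \<phi>. submodule S R (free_left_module R n) \<and> submodule T R (free_left_module R n) \<and>
      S <+>\<^bsub>free_left_module R n\<^esub> T = carrier (free_left_module R n) \<and>
      S \<inter> T = {\<zero>\<^bsub>free_left_module R n\<^esub>} \<and>
      \<phi> \<in> left_module_hom R P (free_left_module R n) \<and> bij_betw \<phi> (carrier P) S)"

text \<open>An exact sequence \<open>\<dots> \<rightarrow> P\<^sub>1 \<rightarrow> P\<^sub>0 \<rightarrow> M \<rightarrow> 0\<close> with finitely generated projective \<open>P\<^sub>i\<close> and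
  \<open>P\<^sub>i = 0\<close> for all large \<open>i\<close>. Every finitely generated projective module is isomorphic to one
  whose elements have the type of the elements of the free modules of finite rank.\<close>

definition has_finite_fgp_resolution ::
  "('r, 'k) ring_scheme \<Rightarrow> ('r, 'a, 'm) module_scheme \<Rightarrow> bool" where
  "has_finite_fgp_resolution R M \<longleftrightarrow>
    (\<exists>(P :: nat \<Rightarrow> ('r, nat \<Rightarrow> 'r) module) d \<epsilon>.
      (\<forall>i. fg_projective R (P i)) \<and>
      (\<exists>n. \<forall>i>n. carrier (P i) = {\<zero>\<^bsub>P i\<^esub>}) \<and>
      \<epsilon> \<in> left_module_hom R (P 0) M \<and>
      (\<forall>i. d i \<in> left_module_hom R (P (Suc i)) (P i)) \<and>
      \<epsilon> ` carrier (P 0) = carrier M \<and>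
      d 0 ` carrier (P 1) = {x \<in> carrier (P 0). \<epsilon> x = \<zero>\<^bsub>M\<^esub>} \<and>
      (\<forall>i. d (Suc i) ` carrier (P (Suc (Suc i))) = {x \<in> carrier (P (Suc i)). d i x = \<zero>\<^bsub>P i\<^esub>}))"


section \<open>Homological smoothness\<close>

definition opposite_algebra :: "('c, 'a, 'm) module_scheme \<Rightarrow> ('c, 'a, 'm) module_scheme" where
  "opposite_algebra A = A\<lparr>monoid.mult := \<lambda>x y. y \<otimes>\<^bsub>A\<^esub> x\<rparr>"

text \<open>The tensor product over the complex numbers: the free vector space on the pairs \<open>(a, b)\<close>, which
  is the monoid algebra of the product of the multiplicative monoids, modulo bilinearity. The linear
  span of the bilinearity relations is already a two-sided ideal.\<close>

definition bilinear_relations ::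
  "(complex, 'a, 'm) module_scheme \<Rightarrow> (complex, 'b, 'n) module_scheme
    \<Rightarrow> (('a \<times> 'b) \<Rightarrow>\<^sub>0 complex) set" where
  "bilinear_relations A B =
     {Poly_Mapping.single (a \<oplus>\<^bsub>A\<^esub> a', b) 1 - Poly_Mapping.single (a, b) 1
        - Poly_Mapping.single (a', b) 1 | a a' b.
        a \<in> carrier A \<and> a' \<in> carrier A \<and> b \<in> carrier B} \<union>
     {Poly_Mapping.single (a, b \<oplus>\<^bsub>B\<^esub> b') 1 - Poly_Mapping.single (a, b) 1
        - Poly_Mapping.single (a, b') 1 | a b b'.
        a \<in> carrier A \<and> b \<in> carrier B \<and> b' \<in> carrier B} \<union>
     {Poly_Mapping.single (c \<odot>\<^bsub>A\<^esub> a, b) 1 - Poly_Mapping.single (a, b) c | a b c.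
        a \<in> carrier A \<and> b \<in> carrier B} \<union>
     {Poly_Mapping.single (a, c \<odot>\<^bsub>B\<^esub> b) 1 - Poly_Mapping.single (a, b) c | a b c.
        a \<in> carrier A \<and> b \<in> carrier B}"

definition tensor_algebra ::
  "(complex, 'a, 'm) module_scheme \<Rightarrow> (complex, 'b, 'n) module_scheme
    \<Rightarrow> (complex, (('a \<times> 'b) \<Rightarrow>\<^sub>0 complex) set) module" where
  "tensor_algebra A B =
     quotient_algebra (monoid_algebra (A \<times>\<times> B))
       (genideal (monoid_algebra (A \<times>\<times> B)) (bilinear_relations A B))"

definition pure_tensor ::
  "(complex, 'a, 'm) module_scheme \<Rightarrow> (complex, 'b, 'n) module_scheme
    \<Rightarrow> 'a \<Rightarrow> 'b \<Rightarrow> (('a \<times> 'b) \<Rightarrow>\<^sub>0 complex) set" where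
  "pure_tensor A B a b =
     genideal (monoid_algebra (A \<times>\<times> B)) (bilinear_relations A B)
       +>\<^bsub>monoid_algebra (A \<times>\<times> B)\<^esub> Poly_Mapping.single (a, b) 1"

abbreviation enveloping_algebra ::
  "(complex, 'a, 'm) module_scheme \<Rightarrow> (complex, (('a \<times> 'a) \<Rightarrow>\<^sub>0 complex) set) module" where
  "enveloping_algebra B \<equiv> tensor_algebra B (opposite_algebra B)"

text \<open>The algebra \<open>B\<close> as a bimodule over itself: \<open>a \<otimes> b\<close> acts by \<open>x \<mapsto> a x b\<close>.\<close>

definition sandwich :: "(complex, 'a, 'm) module_scheme \<Rightarrow> (('a \<times> 'a) \<Rightarrow>\<^sub>0 complex) \<Rightarrow> 'a \<Rightarrow> 'a" where
  "sandwich B f x =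
    (\<Oplus>\<^bsub>B\<^esub>p\<in>Poly_Mapping.keys f. Poly_Mapping.lookup f p \<odot>\<^bsub>B\<^esub> (fst p \<otimes>\<^bsub>B\<^esub> x \<otimes>\<^bsub>B\<^esub> snd p))"

definition diagonal_bimodule ::
  "(complex, 'a, 'm) module_scheme \<Rightarrow> ((('a \<times> 'a) \<Rightarrow>\<^sub>0 complex) set, 'a) module" where
  "diagonal_bimodule B =
    \<lparr>carrier = carrier B, monoid.mult = monoid.mult B, one = \<one>\<^bsub>B\<^esub>, ring.zero = \<zero>\<^bsub>B\<^esub>, add = add B,
     module.smult = (\<lambda>K x. the_elem ((\<lambda>f. sandwich B f x) ` K))\<rparr>"

definition homologically_smooth :: "(complex, 'a, 'm) module_scheme \<Rightarrow> bool" where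
  "homologically_smooth B \<longleftrightarrow> complex_algebra B \<and>
     has_finite_fgp_resolution (enveloping_algebra B) (diagonal_bimodule B)"


section \<open>Monoid algebras and quotients are complex algebras\<close>

lemma poly_mapping_sum_single: "(\<Sum>k\<in>Poly_Mapping.keys f. Poly_Mapping.single k (Poly_Mapping.lookup f k)) = f"
  by (rule poly_mapping_eqI) (auto simp: lookup_sum lookup_single when_def in_keys_iff sum.delta)

lemma poly_mapping_single_induct [consumes 1, case_names zero single add]:
  fixes f :: "'g \<Rightarrow>\<^sub>0 complex"
  assumes "Poly_Mapping.keys f \<subseteq> S" "P 0" "\<And>k c. k \<in> S \<Longrightarrow> P (Poly_Mapping.single k c)"
    "\<And>f g. \<lbrakk>Poly_Mapping.keys f \<subseteq> S; Poly_Mapping.keys g \<subseteq> S; P f; P g\<rbrakk> \<Longrightarrow> P (f + g)"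
  shows "P f"
proof -
  have "Poly_Mapping.keys (\<Sum>k\<in>A. Poly_Mapping.single k (Poly_Mapping.lookup f k)) \<subseteq> S \<and>
        P (\<Sum>k\<in>A. Poly_Mapping.single k (Poly_Mapping.lookup f k))"
    if "finite A" "A \<subseteq> S" for A
    using that
  proof (induction A rule: finite_induct)
    case empty then show ?case using assms(2) by simp
  next
    case (insert x F)
    have "Poly_Mapping.keys (Poly_Mapping.single x (Poly_Mapping.lookup f x)
            + (\<Sum>k\<in>F. Poly_Mapping.single k (Poly_Mapping.lookup f k))) \<subseteq> S"
      using insert by (intro order_trans[OF Poly_Mapping.keys_add]) auto
    then show ?case using insert assms(3,4) by auto
  qed
  from this[OF finite_keys assms(1)] show ?thesis by (simp add: poly_mapping_sum_single)
qed

lemma push_forward_simps [simp]: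
  "push_forward h 0 = 0"
  "push_forward h (Poly_Mapping.single k c) = Poly_Mapping.single (h k) c"
  "push_forward h (f + g) = push_forward h f + push_forward h g"
proof -
  show "push_forward h (f + g) = push_forward h f + push_forward h g"
    unfolding push_forward_def
    by (rule setsum_keys_plus_distrib) (auto simp: single_add)
  show "push_forward h (Poly_Mapping.single k c) = Poly_Mapping.single (h k) c"
    by (simp add: push_forward_def)
qed (simp add: push_forward_def)

lemma lookup_scale:
  "Poly_Mapping.lookup (Poly_Mapping.map ((*) (c::complex)) f) k = c * Poly_Mapping.lookup f k"
  by (simp add: Poly_Mapping.map.rep_eq when_def)

lemma lookup_map_cnj:
  "Poly_Mapping.lookup (Poly_Mapping.map cnj f) k = cnj (Poly_Mapping.lookup f k)"
  by (simp add: Poly_Mapping.map.rep_eq when_def)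

lemma map_simps [simp]:
  fixes f g :: "'g \<Rightarrow>\<^sub>0 complex"
  shows "Poly_Mapping.map cnj (f + g) = Poly_Mapping.map cnj f + Poly_Mapping.map cnj g"
    and "Poly_Mapping.map ((*) c) (f + g) = Poly_Mapping.map ((*) c) f + Poly_Mapping.map ((*) c) g"
    and "Poly_Mapping.map cnj 0 = (0 :: 'g \<Rightarrow>\<^sub>0 complex)"
    and "Poly_Mapping.map ((*) c) 0 = (0 :: 'g \<Rightarrow>\<^sub>0 complex)"
  by (rule poly_mapping_eqI; simp add: lookup_scale lookup_map_cnj lookup_add distrib_left)+

lemma monoid_algebra_simps:
  "carrier (monoid_algebra G) = {f. Poly_Mapping.keys f \<subseteq> carrier G}"
  "\<one>\<^bsub>monoid_algebra G\<^esub> = Poly_Mapping.single \<one>\<^bsub>G\<^esub> 1"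
  "\<zero>\<^bsub>monoid_algebra G\<^esub> = 0"
  "f \<oplus>\<^bsub>monoid_algebra G\<^esub> g = f + g"
  "c \<odot>\<^bsub>monoid_algebra G\<^esub> f = Poly_Mapping.map ((*) c) f"
  by (simp_all add: monoid_algebra_def)

lemma monoid_algebra_mult:
  "Poly_Mapping.single a c \<otimes>\<^bsub>monoid_algebra G\<^esub> Poly_Mapping.single b d = Poly_Mapping.single (a \<otimes>\<^bsub>G\<^esub> b) (c * d)"
  "0 \<otimes>\<^bsub>monoid_algebra G\<^esub> f = 0"
  "f \<otimes>\<^bsub>monoid_algebra G\<^esub> 0 = 0"
  "(f + g) \<otimes>\<^bsub>monoid_algebra G\<^esub> h = f \<otimes>\<^bsub>monoid_algebra G\<^esub> h + g \<otimes>\<^bsub>monoid_algebra G\<^esub> h"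
  "h \<otimes>\<^bsub>monoid_algebra G\<^esub> (f + g) = h \<otimes>\<^bsub>monoid_algebra G\<^esub> f + h \<otimes>\<^bsub>monoid_algebra G\<^esub> g"
proof -
  show "(f + g) \<otimes>\<^bsub>monoid_algebra G\<^esub> h = f \<otimes>\<^bsub>monoid_algebra G\<^esub> h + g \<otimes>\<^bsub>monoid_algebra G\<^esub> h"
    unfolding monoid_algebra_def monoid.simps
    by (rule setsum_keys_plus_distrib[where f = "\<lambda>a x. \<Sum>b\<in>Poly_Mapping.keys h. Poly_Mapping.single (a \<otimes>\<^bsub>G\<^esub> b) (x * Poly_Mapping.lookup h b)"])
       (auto simp: single_add sum.distrib distrib_right)
  show "h \<otimes>\<^bsub>monoid_algebra G\<^esub> (f + g) = h \<otimes>\<^bsub>monoid_algebra G\<^esub> f + h \<otimes>\<^bsub>monoid_algebra G\<^esub> g"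
    unfolding monoid_algebra_def monoid.simps sum.distrib [symmetric]
    by (rule sum.cong[OF refl], rule setsum_keys_plus_distrib[where f = "\<lambda>b x. Poly_Mapping.single (a \<otimes>\<^bsub>G\<^esub> b) (Poly_Mapping.lookup h a * x)" for a])
       (auto simp: single_add sum.distrib distrib_left)
qed (auto simp: monoid_algebra_def)

lemma monoid_algebra_single_closed [simp]:
  "k \<in> carrier G \<Longrightarrow> Poly_Mapping.single k c \<in> carrier (monoid_algebra G)"
  by (simp add: monoid_algebra_simps)

lemma complex_algebra_monoid_algebra:
  assumes "monoid G"
  shows "complex_algebra (monoid_algebra G)"
proof -
  interpret monoid G by fact
  let ?A = "monoid_algebra G"
  have add_closed: "f + g \<in> carrier ?A" if "f \<in> carrier ?A" "g \<in> carrier ?A" for f g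
    using that Poly_Mapping.keys_add[of f g] by (auto simp: monoid_algebra_simps)
  have ab: "abelian_group ?A"
  proof (rule abelian_groupI)
    fix x assume x: "x \<in> carrier ?A"
    then have "- x \<in> carrier ?A" "- x \<oplus>\<^bsub>?A\<^esub> x = \<zero>\<^bsub>?A\<^esub>"
      by (simp_all add: monoid_algebra_simps)
    then show "\<exists>y\<in>carrier ?A. y \<oplus>\<^bsub>?A\<^esub> x = \<zero>\<^bsub>?A\<^esub>" by blast
  qed (use add_closed in \<open>auto simp: monoid_algebra_simps add_ac\<close>)
  have closed: "f \<otimes>\<^bsub>?A\<^esub> g \<in> carrier ?A" if "f \<in> carrier ?A" "g \<in> carrier ?A" for f g
  proof -
    have "f \<otimes>\<^bsub>?A\<^esub> g \<in> carrier ?A"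
      if "Poly_Mapping.keys f \<subseteq> carrier G" "Poly_Mapping.keys g \<subseteq> carrier G"
      using that
    proof (induction f rule: poly_mapping_single_induct)
      case (single k c)
      from \<open>Poly_Mapping.keys g \<subseteq> carrier G\<close> show ?case
        by (induction g rule: poly_mapping_single_induct)
           (use single in \<open>auto simp: monoid_algebra_mult intro!: add_closed, auto simp: monoid_algebra_simps\<close>)
    qed (auto simp: monoid_algebra_mult intro!: add_closed, auto simp: monoid_algebra_simps)
    with that show ?thesis by (simp add: monoid_algebra_simps)
  qed
  have assoc: "f \<otimes>\<^bsub>?A\<^esub> g \<otimes>\<^bsub>?A\<^esub> h = f \<otimes>\<^bsub>?A\<^esub> (g \<otimes>\<^bsub>?A\<^esub> h)"
    if "Poly_Mapping.keys f \<subseteq> carrier G" "Poly_Mapping.keys g \<subseteq> carrier G" "Poly_Mapping.keys h \<subseteq> carrier G" for f g h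
    using that
  proof (induction f rule: poly_mapping_single_induct)
    case (single k c)
    note k = single
    from \<open>Poly_Mapping.keys g \<subseteq> carrier G\<close> k show ?case
    proof (induction g rule: poly_mapping_single_induct)
      case (single l d)
      note l = single
      from \<open>Poly_Mapping.keys h \<subseteq> carrier G\<close> show ?case
        by (induction h rule: poly_mapping_single_induct)
          (use k l in \<open>auto simp: monoid_algebra_mult m_assoc mult.assoc\<close>)
    qed (auto simp: monoid_algebra_mult)
  qed (auto simp: monoid_algebra_mult)
  have one: "\<one>\<^bsub>?A\<^esub> \<otimes>\<^bsub>?A\<^esub> f = f \<and> f \<otimes>\<^bsub>?A\<^esub> \<one>\<^bsub>?A\<^esub> = f" if "Poly_Mapping.keys f \<subseteq> carrier G" for f
    using that by (induction f rule: poly_mapping_single_induct)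
      (auto simp: monoid_algebra_mult monoid_algebra_simps)
  have mon: "monoid ?A"
    by (rule monoidI) (use closed assoc one in \<open>auto simp: monoid_algebra_simps\<close>)
  have R: "ring ?A"
    by (rule ringI[OF ab mon]) (auto simp: monoid_algebra_simps monoid_algebra_mult)
  have sc: "Poly_Mapping.map ((*) c) f \<in> carrier ?A" if "f \<in> carrier ?A" for c f
    using that by (auto simp: monoid_algebra_simps in_keys_iff lookup_scale)
  have M: "module complex_field ?A"
  proof (rule moduleI)
    show "cring complex_field" by (rule cring_from_type_algebra)
  qed (simp_all add: ab sc monoid_algebra_simps(5), auto simp: ring_of_type_algebra_def monoid_algebra_simps
          lookup_scale lookup_add algebra_simps intro!: poly_mapping_eqI)
  have l: "Poly_Mapping.map ((*) c) f \<otimes>\<^bsub>?A\<^esub> g = Poly_Mapping.map ((*) c) (f \<otimes>\<^bsub>?A\<^esub> g)" for c f g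
  proof -
    have "Poly_Mapping.keys f \<subseteq> UNIV" by simp
    then show ?thesis
    proof (induction f rule: poly_mapping_single_induct)
      case (single k d)
      have "Poly_Mapping.keys g \<subseteq> UNIV" by simp
      then show ?case by (induction g rule: poly_mapping_single_induct)
          (auto simp: monoid_algebra_mult map_single mult.assoc mult.left_commute)
    qed (auto simp: monoid_algebra_mult)
  qed
  have r: "g \<otimes>\<^bsub>?A\<^esub> Poly_Mapping.map ((*) c) f = Poly_Mapping.map ((*) c) (g \<otimes>\<^bsub>?A\<^esub> f)" for c f g
  proof -
    have "Poly_Mapping.keys f \<subseteq> UNIV" by simp
    then show ?thesis
    proof (induction f rule: poly_mapping_single_induct)
      case (single k d)
      have "Poly_Mapping.keys g \<subseteq> UNIV" by simp
      then show ?case by (induction g rule: poly_mapping_single_induct)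
          (auto simp: monoid_algebra_mult map_single mult.assoc mult.left_commute)
    qed (auto simp: monoid_algebra_mult)
  qed
  show ?thesis
    by (intro complex_algebra.intro R M complex_algebra_axioms.intro)
       (simp_all add: l r monoid_algebra_simps(5))
qed

lemma ring_cong:
  assumes "ring R" "carrier S = carrier R" "monoid.mult S = monoid.mult R" "\<one>\<^bsub>S\<^esub> = \<one>\<^bsub>R\<^esub>"
    "\<zero>\<^bsub>S\<^esub> = \<zero>\<^bsub>R\<^esub>" "add S = add R"
  shows "ring S"
proof -
  interpret ring R by fact
  show ?thesis
  proof (intro ringI abelian_groupI monoidI)
    fix x assume "x \<in> carrier S"
    then show "\<exists>y\<in>carrier S. y \<oplus>\<^bsub>S\<^esub> x = \<zero>\<^bsub>S\<^esub>"
      using assms l_neg[of x] a_inv_closed[of x] by auto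
  qed (auto simp: assms(2-6) a_assoc m_assoc l_distr r_distr intro: a_comm)
qed

lemma quotient_algebra_simps:
  "carrier (quotient_algebra A I) = a_rcosets\<^bsub>A\<^esub> I"
  "monoid.mult (quotient_algebra A I) = rcoset_mult A I"
  "\<one>\<^bsub>quotient_algebra A I\<^esub> = I +>\<^bsub>A\<^esub> \<one>\<^bsub>A\<^esub>"
  "\<zero>\<^bsub>quotient_algebra A I\<^esub> = I"
  "add (quotient_algebra A I) = set_add A"
  "c \<odot>\<^bsub>quotient_algebra A I\<^esub> K = (\<Union>x\<in>K. I +>\<^bsub>A\<^esub> (c \<odot>\<^bsub>A\<^esub> x))"
  by (simp_all add: quotient_algebra_def ring.defs module.defs FactRing_def)

lemma (in ideal) coset_eq_iff:
  assumes "x \<in> carrier R" "y \<in> carrier R"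
  shows "I +> x = I +> y \<longleftrightarrow> x \<ominus> y \<in> I"
proof
  assume "I +> x = I +> y"
  then have "x \<in> I +> y" using a_rcos_self assms by auto
  then show "x \<ominus> y \<in> I" using a_rcos_module_minus[OF ring_axioms assms(2,1)] by simp
next
  assume "x \<ominus> y \<in> I"
  then have "x \<in> I +> y" using a_rcos_module_minus[OF ring_axioms assms(2,1)] by simp
  then show "I +> x = I +> y" by (rule a_repr_independence'[symmetric]) (use assms in auto)
qed

lemma (in ideal) coset_union:
  assumes "x \<in> carrier R" "\<And>x. x \<in> carrier R \<Longrightarrow> \<phi> x \<in> carrier R"
    "\<And>x y. \<lbrakk>x \<in> carrier R; y \<in> carrier R\<rbrakk> \<Longrightarrow> \<phi> (x \<oplus> y) = \<phi> x \<oplus> \<phi> y"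
    "\<And>x. x \<in> I \<Longrightarrow> \<phi> x \<in> I"
  shows "(\<Union>y\<in>I +> x. I +> \<phi> y) = I +> \<phi> x"
proof -
  have "I +> \<phi> y = I +> \<phi> x" if "y \<in> I +> x" for y
  proof -
    from that obtain h where h: "h \<in> I" "y = h \<oplus> x" by (auto simp: a_r_coset_def')
    then have "\<phi> y = \<phi> h \<oplus> \<phi> x" using assms a_Hcarr by auto
    then have "\<phi> y \<in> I +> \<phi> x" using h assms(4) by (auto simp: a_r_coset_def')
    then show ?thesis by (rule a_repr_independence'[symmetric]) (use assms in auto)
  qed
  moreover have "x \<in> I +> x" using a_rcos_self assms by blast
  ultimately show ?thesis by blast
qed

lemma carrier_complex_field [simp]: "c \<in> carrier complex_field"
  by (simp add: ring_of_type_algebra_def)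

lemma (in complex_algebra) ideal_smult:
  assumes "ideal I A" "x \<in> I" shows "c \<odot>\<^bsub>A\<^esub> x \<in> I"
proof -
  interpret I: ideal I A by fact
  have x: "x \<in> carrier A" using assms I.Icarr by blast
  have "c \<odot>\<^bsub>A\<^esub> x = (c \<odot>\<^bsub>A\<^esub> \<one>\<^bsub>A\<^esub>) \<otimes>\<^bsub>A\<^esub> x"
    using x by (simp add: smult_mult_left)
  then show ?thesis using I.I_l_closed[OF assms(2)] by simp
qed

lemma (in complex_algebra) quotient_smult:
  assumes "ideal I A" "x \<in> carrier A"
  shows "c \<odot>\<^bsub>quotient_algebra A I\<^esub> (I +>\<^bsub>A\<^esub> x) = I +>\<^bsub>A\<^esub> (c \<odot>\<^bsub>A\<^esub> x)"
proof -
  have "(\<Union>y\<in>I +>\<^bsub>A\<^esub> x. I +>\<^bsub>A\<^esub> (c \<odot>\<^bsub>A\<^esub> y)) = I +>\<^bsub>A\<^esub> (c \<odot>\<^bsub>A\<^esub> x)"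
  proof (rule ideal.coset_union[OF assms, where \<phi> = "\<lambda>y. c \<odot>\<^bsub>A\<^esub> y"])
    show "c \<odot>\<^bsub>A\<^esub> y \<in> carrier A" if "y \<in> carrier A" for y
      using that by (rule smult_closed[OF carrier_complex_field])
    show "c \<odot>\<^bsub>A\<^esub> (y \<oplus>\<^bsub>A\<^esub> z) = c \<odot>\<^bsub>A\<^esub> y \<oplus>\<^bsub>A\<^esub> c \<odot>\<^bsub>A\<^esub> z" if "y \<in> carrier A" "z \<in> carrier A" for y z
      using that by (rule smult_r_distr[OF carrier_complex_field])
    show "c \<odot>\<^bsub>A\<^esub> y \<in> I" if "y \<in> I" for y using ideal_smult[OF assms(1) that] .
  qed
  then show ?thesis by (simp only: quotient_algebra_simps)
qed

lemma (in complex_algebra) complex_algebra_quotient: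
  assumes "ideal I A"
  shows "complex_algebra (quotient_algebra A I)"
proof -
  interpret I: ideal I A by fact
  let ?Q = "quotient_algebra A I"
  have R0: "ring (A Quot I)" by (rule I.quotient_is_ring)
  have R: "ring ?Q"
    by (rule ring_cong[OF R0]) (simp_all add: quotient_algebra_simps FactRing_def)
  have carr: "\<exists>x\<in>carrier A. K = I +>\<^bsub>A\<^esub> x" if "K \<in> carrier ?Q" for K
    using that by (auto simp: quotient_algebra_simps A_RCOSETS_def')
  have carr': "I +>\<^bsub>A\<^esub> x \<in> carrier ?Q" if "x \<in> carrier A" for x
    using that by (auto simp: quotient_algebra_simps A_RCOSETS_def')
  have add: "(I +>\<^bsub>A\<^esub> x) \<oplus>\<^bsub>?Q\<^esub> (I +>\<^bsub>A\<^esub> y) = I +>\<^bsub>A\<^esub> (x \<oplus>\<^bsub>A\<^esub> y)" if "x \<in> carrier A" "y \<in> carrier A" for x y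
    using that by (simp add: quotient_algebra_simps I.a_rcos_sum)
  have mult: "(I +>\<^bsub>A\<^esub> x) \<otimes>\<^bsub>?Q\<^esub> (I +>\<^bsub>A\<^esub> y) = I +>\<^bsub>A\<^esub> (x \<otimes>\<^bsub>A\<^esub> y)" if "x \<in> carrier A" "y \<in> carrier A" for x y
    using that by (simp add: quotient_algebra_simps I.rcoset_mult_add)
  have all: "(\<forall>K\<in>carrier ?Q. P K) \<longleftrightarrow> (\<forall>x\<in>carrier A. P (I +>\<^bsub>A\<^esub> x))" for P
    using carr carr' by blast
  have m1: "\<forall>K\<in>carrier ?Q. c \<odot>\<^bsub>?Q\<^esub> K \<in> carrier ?Q" for c
    unfolding all by (simp add: quotient_smult[OF assms] carr')
  have m2: "\<forall>K\<in>carrier ?Q. (a \<oplus>\<^bsub>complex_field\<^esub> b) \<odot>\<^bsub>?Q\<^esub> K = a \<odot>\<^bsub>?Q\<^esub> K \<oplus>\<^bsub>?Q\<^esub> b \<odot>\<^bsub>?Q\<^esub> K" for a b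
    unfolding all by (simp add: quotient_smult[OF assms] add smult_l_distr)
  have m3: "\<forall>K\<in>carrier ?Q. \<forall>L\<in>carrier ?Q. a \<odot>\<^bsub>?Q\<^esub> (K \<oplus>\<^bsub>?Q\<^esub> L) = a \<odot>\<^bsub>?Q\<^esub> K \<oplus>\<^bsub>?Q\<^esub> a \<odot>\<^bsub>?Q\<^esub> L" for a
    unfolding all by (simp add: quotient_smult[OF assms] add smult_r_distr)
  have m4: "\<forall>K\<in>carrier ?Q. (a \<otimes>\<^bsub>complex_field\<^esub> b) \<odot>\<^bsub>?Q\<^esub> K = a \<odot>\<^bsub>?Q\<^esub> (b \<odot>\<^bsub>?Q\<^esub> K)" for a b
    unfolding all by (simp add: quotient_smult[OF assms] smult_assoc1)
  have m5: "\<forall>K\<in>carrier ?Q. \<one>\<^bsub>complex_field\<^esub> \<odot>\<^bsub>?Q\<^esub> K = K"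
    unfolding all by (simp add: quotient_smult[OF assms])
  have M: "module complex_field ?Q"
  proof (rule moduleI)
    show "abelian_group ?Q" using R by (simp add: ring_def)
    show "cring complex_field" by (rule cring_from_type_algebra)
  qed (use m1 m2 m3 m4 m5 in \<open>blast+\<close>)
  have n: "\<forall>K\<in>carrier ?Q. \<forall>L\<in>carrier ?Q. (c \<odot>\<^bsub>?Q\<^esub> K) \<otimes>\<^bsub>?Q\<^esub> L = c \<odot>\<^bsub>?Q\<^esub> (K \<otimes>\<^bsub>?Q\<^esub> L)"
    "\<forall>K\<in>carrier ?Q. \<forall>L\<in>carrier ?Q. K \<otimes>\<^bsub>?Q\<^esub> (c \<odot>\<^bsub>?Q\<^esub> L) = c \<odot>\<^bsub>?Q\<^esub> (K \<otimes>\<^bsub>?Q\<^esub> L)" for c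
    unfolding all by (simp_all add: quotient_smult[OF assms] mult smult_mult_left smult_mult_right)
  show ?thesis
  proof (rule complex_algebra.intro[OF M R], rule complex_algebra_axioms.intro)
  qed (use n in \<open>blast+\<close>)
qed


lemma complex_algebra_cong:
  fixes A :: "(complex, 'a, 'm) module_scheme" and B :: "(complex, 'a, 'n) module_scheme"
  assumes "complex_algebra A" "carrier B = carrier A" "monoid.mult B = monoid.mult A"
    "\<one>\<^bsub>B\<^esub> = \<one>\<^bsub>A\<^esub>" "\<zero>\<^bsub>B\<^esub> = \<zero>\<^bsub>A\<^esub>" "add B = add A" "module.smult B = module.smult A"
  shows "complex_algebra B"
proof -
  interpret A: complex_algebra A by fact
  have R: "ring B" by (rule ring_cong[OF A.ring_axioms]) (use assms in simp_all)
  have M: "module complex_field B"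
  proof (rule moduleI)
    show "abelian_group B" using R by (simp add: ring_def)
    show "cring complex_field" by (rule cring_from_type_algebra)
  qed (simp_all add: assms(2-) A.smult_l_distr A.smult_r_distr A.smult_assoc1)
  show ?thesis
    by (rule complex_algebra.intro[OF M R], rule complex_algebra_axioms.intro)
       (simp_all add: assms(2-) A.smult_mult_left A.smult_mult_right)
qed

lemma complex_algebra_subalgebra:
  fixes A :: "(complex, 'a, 'm) module_scheme"
  assumes "complex_algebra A" "subring H A" "\<And>c x. x \<in> H \<Longrightarrow> c \<odot>\<^bsub>A\<^esub> x \<in> H"
  shows "complex_algebra (A\<lparr>carrier := H\<rparr>)"
proof -
  interpret A: complex_algebra A by fact
  have H: "x \<in> carrier A" if "x \<in> H" for x using subringE(1)[OF assms(2)] that by blast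
  have R: "ring (A\<lparr>carrier := H\<rparr>)" by (rule A.subring_is_ring[OF assms(2)])
  have M: "module complex_field (A\<lparr>carrier := H\<rparr>)"
  proof (rule moduleI)
    show "abelian_group (A\<lparr>carrier := H\<rparr>)" using R by (simp add: ring_def)
    show "cring complex_field" by (rule cring_from_type_algebra)
  qed (simp_all add: assms(3) H A.smult_l_distr A.smult_r_distr A.smult_assoc1)
  show ?thesis
    by (rule complex_algebra.intro[OF M R], rule complex_algebra_axioms.intro)
       (simp_all add: H A.smult_mult_left A.smult_mult_right)
qed

lemma carrier_opposite_algebra [simp]: "carrier (opposite_algebra A) = carrier A"
  by (simp add: opposite_algebra_def)

lemma complex_algebra_opposite:
  fixes A :: "(complex, 'a, 'm) module_scheme"
  assumes "complex_algebra A"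
  shows "complex_algebra (opposite_algebra A)"
proof -
  interpret A: complex_algebra A by fact
  let ?B = "opposite_algebra A"
  note d = opposite_algebra_def
  have R: "ring ?B"
  proof (intro ringI abelian_groupI monoidI)
    fix x assume "x \<in> carrier ?B"
    then show "\<exists>y\<in>carrier ?B. y \<oplus>\<^bsub>?B\<^esub> x = \<zero>\<^bsub>?B\<^esub>"
      using A.l_neg[of x] A.a_inv_closed[of x] by (auto simp: d)
  qed (auto simp: d A.a_assoc A.m_assoc A.l_distr A.r_distr intro: A.a_comm)
  have M: "module complex_field ?B"
  proof (rule moduleI)
    show "abelian_group ?B" using R by (simp add: ring_def)
    show "cring complex_field" by (rule cring_from_type_algebra)
  qed (simp_all add: d A.smult_l_distr A.smult_r_distr A.smult_assoc1)
  show ?thesis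
    by (rule complex_algebra.intro[OF M R], rule complex_algebra_axioms.intro)
       (simp_all add: d A.smult_mult_left A.smult_mult_right)
qed

lemma bilinear_relations_carrier:
  assumes "complex_algebra A" "complex_algebra B"
  shows "bilinear_relations A B \<subseteq> carrier (monoid_algebra (A \<times>\<times> B))"
proof -
  interpret A: complex_algebra A by fact
  interpret B: complex_algebra B by fact
  show ?thesis
    unfolding bilinear_relations_def monoid_algebra_simps
    by (auto dest!: subsetD[OF keys_diff] split: if_splits)
qed

lemma complex_algebra_tensor:
  assumes "complex_algebra A" "complex_algebra B"
  shows "complex_algebra (tensor_algebra A B)"
proof -
  interpret A: complex_algebra A by fact
  interpret B: complex_algebra B by fact
  interpret M: complex_algebra "monoid_algebra (A \<times>\<times> B)"
    by (intro complex_algebra_monoid_algebra DirProd_monoid A.monoid_axioms B.monoid_axioms)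
  show ?thesis
    using bilinear_relations_carrier[OF assms]
    unfolding tensor_algebra_def by (intro M.complex_algebra_quotient M.genideal_ideal)
qed


section \<open>The torus and the pillow are complex *-algebras and the flip is an automorphism\<close>

lemma adj_adj [simp]: "adj (adj x) = x" "adj \<circ> adj = id"
proof -
  show "adj (adj x) = x" for x by (cases x) auto
  then show "adj \<circ> adj = id" by auto
qed

lemma free_star_algebra_simps:
  "carrier free_star_algebra = UNIV"
  "monoid.mult free_star_algebra = monoid.mult (monoid_algebra word_monoid)"
  "\<one>\<^bsub>free_star_algebra\<^esub> = word []"
  "\<zero>\<^bsub>free_star_algebra\<^esub> = 0"
  "f \<oplus>\<^bsub>free_star_algebra\<^esub> g = f + g"
  "c \<odot>\<^bsub>free_star_algebra\<^esub> f = Poly_Mapping.map ((*) c) f"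
  "star free_star_algebra f = push_forward (\<lambda>w. rev (map adj w)) (Poly_Mapping.map cnj f)"
  by (simp_all add: free_star_algebra_def module.defs star_algebra.defs monoid_algebra_def word_monoid_def)

lemma free_mult_single:
  "Poly_Mapping.single v c \<otimes>\<^bsub>free_star_algebra\<^esub> Poly_Mapping.single w d = Poly_Mapping.single (v @ w) (c * d)"
  "(f + g) \<otimes>\<^bsub>free_star_algebra\<^esub> h = f \<otimes>\<^bsub>free_star_algebra\<^esub> h + g \<otimes>\<^bsub>free_star_algebra\<^esub> h"
  "h \<otimes>\<^bsub>free_star_algebra\<^esub> (f + g) = h \<otimes>\<^bsub>free_star_algebra\<^esub> f + h \<otimes>\<^bsub>free_star_algebra\<^esub> g"
  "0 \<otimes>\<^bsub>free_star_algebra\<^esub> f = 0" "f \<otimes>\<^bsub>free_star_algebra\<^esub> 0 = 0"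
  by (simp_all add: free_star_algebra_simps monoid_algebra_mult) (simp add: word_monoid_def)

lemma free_star_single:
  "star free_star_algebra (Poly_Mapping.single w c) = Poly_Mapping.single (rev (map adj w)) (cnj c)"
  "star free_star_algebra (f + g) = star free_star_algebra f + star free_star_algebra g"
  "star free_star_algebra 0 = 0"
  by (simp_all add: free_star_algebra_simps map_single)

lemma free_induct [case_names zero single add]:
  fixes f :: "'g \<Rightarrow>\<^sub>0 complex"
  assumes "P 0" "\<And>k c. P (Poly_Mapping.single k c)" "\<And>f g. \<lbrakk>P f; P g\<rbrakk> \<Longrightarrow> P (f + g)"
  shows "P f"
  using subset_UNIV[of "Poly_Mapping.keys f"]
  by (induction f rule: poly_mapping_single_induct) (use assms in auto)

interpretation free: complex_star_algebra free_star_algebra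
proof -
  let ?A = free_star_algebra
  have "monoid word_monoid" by (rule monoidI) (auto simp: word_monoid_def)
  then have "complex_algebra (monoid_algebra word_monoid)" by (rule complex_algebra_monoid_algebra)
  then have A: "complex_algebra ?A"
    by (rule complex_algebra_cong) (auto simp: free_star_algebra_def module.defs star_algebra.defs)
  have mult: "star ?A (f \<otimes>\<^bsub>?A\<^esub> g) = star ?A g \<otimes>\<^bsub>?A\<^esub> star ?A f" for f g
  proof (induction f rule: free_induct)
    case (single k c)
    show ?case
      by (induction g rule: free_induct) (simp_all add: free_mult_single free_star_single mult.commute)
  qed (simp_all add: free_mult_single free_star_single)
  have star: "star ?A (star ?A f) = f" for f
    by (induction f rule: free_induct) (simp_all add: free_star_single rev_map)
  have scale: "star ?A (Poly_Mapping.map ((*) c) f) = Poly_Mapping.map ((*) (cnj c)) (star ?A f)" for c f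
    by (induction f rule: free_induct) (simp_all add: free_star_single map_single)
  show "complex_star_algebra ?A"
    by (rule complex_star_algebra.intro[OF A], rule complex_star_algebra_axioms.intro)
       (simp_all add: mult star scale free_star_single free_star_algebra_simps(1,5,6))
qed

lemma (in complex_star_algebra) star_ideal:
  assumes "S \<subseteq> carrier A"
  shows "ideal (star_ideal A S) A" "\<And>x. x \<in> star_ideal A S \<Longrightarrow> star A x \<in> star_ideal A S"
    "S \<subseteq> star_ideal A S"
proof -
  have "carrier A \<in> {I. ideal I A \<and> (\<forall>x\<in>I. star A x \<in> I) \<and> S \<subseteq> I}"
    using oneideal star_closed assms by auto
  then show "ideal (star_ideal A S) A"
    unfolding star_ideal_def by (intro i_Intersect) auto
qed (auto simp: star_ideal_def)

lemma (in complex_star_algebra) complex_star_algebra_quotient: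
  assumes I: "ideal I A" and st: "\<And>x. x \<in> I \<Longrightarrow> star A x \<in> I"
  shows "complex_star_algebra (quotient_star_algebra A I)"
    "x \<in> carrier A \<Longrightarrow> star (quotient_star_algebra A I) (I +>\<^bsub>A\<^esub> x) = I +>\<^bsub>A\<^esub> star A x"
proof -
  let ?Q = "quotient_star_algebra A I"
  interpret I: ideal I A by fact
  interpret Q: complex_algebra "quotient_algebra A I" by (rule complex_algebra_quotient[OF I])
  have fields: "carrier ?Q = carrier (quotient_algebra A I)" "monoid.mult ?Q = monoid.mult (quotient_algebra A I)"
    "\<one>\<^bsub>?Q\<^esub> = \<one>\<^bsub>quotient_algebra A I\<^esub>" "\<zero>\<^bsub>?Q\<^esub> = \<zero>\<^bsub>quotient_algebra A I\<^esub>"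
    "add ?Q = add (quotient_algebra A I)" "module.smult ?Q = module.smult (quotient_algebra A I)"
    "star ?Q = (\<lambda>K. \<Union>x\<in>K. I +>\<^bsub>A\<^esub> star A x)"
    by (simp_all add: quotient_star_algebra_def module.defs star_algebra.defs)
  have QA: "complex_algebra ?Q"
    by (rule complex_algebra_cong[OF Q.complex_algebra_axioms]) (simp_all add: fields)
  show star: "star ?Q (I +>\<^bsub>A\<^esub> x) = I +>\<^bsub>A\<^esub> star A x" if "x \<in> carrier A" for x
    unfolding fields
    by (rule I.coset_union[where \<phi> = "star A"]) (simp_all add: that star_closed star_add st)
  have carr: "\<exists>x\<in>carrier A. K = I +>\<^bsub>A\<^esub> x" if "K \<in> carrier ?Q" for K
    using that by (auto simp: fields quotient_algebra_simps A_RCOSETS_def')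
  have carr': "I +>\<^bsub>A\<^esub> x \<in> carrier ?Q" if "x \<in> carrier A" for x
    using that by (auto simp: fields quotient_algebra_simps A_RCOSETS_def')
  have all: "(\<forall>K\<in>carrier ?Q. P K) \<longleftrightarrow> (\<forall>x\<in>carrier A. P (I +>\<^bsub>A\<^esub> x))" for P
    using carr carr' by blast
  have add: "(I +>\<^bsub>A\<^esub> x) \<oplus>\<^bsub>?Q\<^esub> (I +>\<^bsub>A\<^esub> y) = I +>\<^bsub>A\<^esub> (x \<oplus>\<^bsub>A\<^esub> y)" if "x \<in> carrier A" "y \<in> carrier A" for x y
    using that by (simp add: fields quotient_algebra_simps I.a_rcos_sum)
  have mult: "(I +>\<^bsub>A\<^esub> x) \<otimes>\<^bsub>?Q\<^esub> (I +>\<^bsub>A\<^esub> y) = I +>\<^bsub>A\<^esub> (x \<otimes>\<^bsub>A\<^esub> y)" if "x \<in> carrier A" "y \<in> carrier A" for x y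
    using that by (simp add: fields quotient_algebra_simps I.rcoset_mult_add)
  have sm: "c \<odot>\<^bsub>?Q\<^esub> (I +>\<^bsub>A\<^esub> x) = I +>\<^bsub>A\<^esub> (c \<odot>\<^bsub>A\<^esub> x)" if "x \<in> carrier A" for c x
    using that by (simp add: fields quotient_smult[OF I])
  have 1: "\<forall>K\<in>carrier ?Q. star ?Q K \<in> carrier ?Q" "\<forall>K\<in>carrier ?Q. star ?Q (star ?Q K) = K"
    "\<forall>K\<in>carrier ?Q. star ?Q (c \<odot>\<^bsub>?Q\<^esub> K) = cnj c \<odot>\<^bsub>?Q\<^esub> star ?Q K"
    "\<forall>K\<in>carrier ?Q. \<forall>L\<in>carrier ?Q. star ?Q (K \<oplus>\<^bsub>?Q\<^esub> L) = star ?Q K \<oplus>\<^bsub>?Q\<^esub> star ?Q L"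
    "\<forall>K\<in>carrier ?Q. \<forall>L\<in>carrier ?Q. star ?Q (K \<otimes>\<^bsub>?Q\<^esub> L) = star ?Q L \<otimes>\<^bsub>?Q\<^esub> star ?Q K" for c
    unfolding all
    by (simp_all add: star star_closed carr' star_star sm star_smult add star_add mult star_mult)
  show "complex_star_algebra ?Q"
    by (rule complex_star_algebra.intro[OF QA], rule complex_star_algebra_axioms.intro)
       (simp_all add: 1[rule_format])
qed

lemma torus_ideal: "ideal (torus_ideal \<theta>) free_star_algebra"
  "x \<in> torus_ideal \<theta> \<Longrightarrow> star free_star_algebra x \<in> torus_ideal \<theta>"
  "torus_relations \<theta> \<subseteq> torus_ideal \<theta>"
  unfolding torus_ideal_def
  using free.star_ideal[of "torus_relations \<theta>"] by (simp_all add: free_star_algebra_simps)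

lemma complex_star_algebra_torus: "complex_star_algebra (nc_torus \<theta>)"
  unfolding nc_torus_def using free.complex_star_algebra_quotient(1) torus_ideal(1,2) by blast

lemma free_minus: "f \<ominus>\<^bsub>free_star_algebra\<^esub> g = f - g"
proof -
  have "\<ominus>\<^bsub>free_star_algebra\<^esub> g = - g"
    by (rule free.minus_equality) (simp_all add: free_star_algebra_simps)
  then show ?thesis by (simp add: a_minus_def free_star_algebra_simps)
qed

lemma torus_class_eq_iff: "torus_class \<theta> f = torus_class \<theta> g \<longleftrightarrow> f - g \<in> torus_ideal \<theta>"
  unfolding torus_class_def
  by (subst ideal.coset_eq_iff[OF torus_ideal(1)]) (simp_all add: free_star_algebra_simps(1) free_minus)

lemma carrier_torus: "carrier (nc_torus \<theta>) = Set.range (torus_class \<theta>)"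
  by (auto simp: nc_torus_def quotient_star_algebra_def module.defs star_algebra.defs
      quotient_algebra_simps A_RCOSETS_def' torus_class_def free_star_algebra_simps)

lemma torus_class_ops:
  "\<one>\<^bsub>nc_torus \<theta>\<^esub> = torus_class \<theta> (word [])"
  "\<zero>\<^bsub>nc_torus \<theta>\<^esub> = torus_class \<theta> 0"
  "torus_class \<theta> f \<oplus>\<^bsub>nc_torus \<theta>\<^esub> torus_class \<theta> g = torus_class \<theta> (f + g)"
  "torus_class \<theta> f \<otimes>\<^bsub>nc_torus \<theta>\<^esub> torus_class \<theta> g = torus_class \<theta> (f \<otimes>\<^bsub>free_star_algebra\<^esub> g)"
  "c \<odot>\<^bsub>nc_torus \<theta>\<^esub> torus_class \<theta> f = torus_class \<theta> (Poly_Mapping.map ((*) c) f)"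
  "star (nc_torus \<theta>) (torus_class \<theta> f) = torus_class \<theta> (star free_star_algebra f)"
proof -
  let ?I = "torus_ideal \<theta>"
  interpret I: ideal ?I free_star_algebra by (rule torus_ideal)
  note d = nc_torus_def quotient_star_algebra_def module.defs star_algebra.defs
      quotient_algebra_simps torus_class_def free_star_algebra_simps(1-5)
  show "\<one>\<^bsub>nc_torus \<theta>\<^esub> = torus_class \<theta> (word [])" by (simp add: d)
  show "\<zero>\<^bsub>nc_torus \<theta>\<^esub> = torus_class \<theta> 0"
    using I.a_rcos_const[OF I.zero_closed] by (simp add: d)
  show "torus_class \<theta> f \<oplus>\<^bsub>nc_torus \<theta>\<^esub> torus_class \<theta> g = torus_class \<theta> (f + g)"
    using I.a_rcos_sum[of f g] by (simp add: d)
  show "torus_class \<theta> f \<otimes>\<^bsub>nc_torus \<theta>\<^esub> torus_class \<theta> g = torus_class \<theta> (f \<otimes>\<^bsub>free_star_algebra\<^esub> g)"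
    using I.rcoset_mult_add[of f g] by (simp add: d)
  have "c \<odot>\<^bsub>quotient_algebra free_star_algebra ?I\<^esub> (?I +>\<^bsub>free_star_algebra\<^esub> f) = ?I +>\<^bsub>free_star_algebra\<^esub> (c \<odot>\<^bsub>free_star_algebra\<^esub> f)"
    by (rule free.quotient_smult[OF torus_ideal(1)]) (simp add: free_star_algebra_simps)
  then show "c \<odot>\<^bsub>nc_torus \<theta>\<^esub> torus_class \<theta> f = torus_class \<theta> (Poly_Mapping.map ((*) c) f)"
    by (simp add: nc_torus_def quotient_star_algebra_def module.defs star_algebra.defs torus_class_def free_star_algebra_simps(6))
  show "star (nc_torus \<theta>) (torus_class \<theta> f) = torus_class \<theta> (star free_star_algebra f)"
    unfolding nc_torus_def torus_class_def
    by (rule free.complex_star_algebra_quotient(2)[OF torus_ideal(1,2)]) (simp_all add: free_star_algebra_simps(1))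
qed

lemma scale_single: "Poly_Mapping.map ((*) (c::complex)) (Poly_Mapping.single k d) = Poly_Mapping.single k (c * d)"
  by (simp add: map_single)

lemma scale_diff: "Poly_Mapping.map ((*) (c::complex)) (f - g) = Poly_Mapping.map ((*) c) f - Poly_Mapping.map ((*) c) g"
  by (rule poly_mapping_eqI) (simp add: lookup_scale lookup_minus algebra_simps)

lemma torus_unitaries:
  "torus_U \<theta> \<otimes>\<^bsub>nc_torus \<theta>\<^esub> star (nc_torus \<theta>) (torus_U \<theta>) = \<one>\<^bsub>nc_torus \<theta>\<^esub>"
  "star (nc_torus \<theta>) (torus_U \<theta>) \<otimes>\<^bsub>nc_torus \<theta>\<^esub> torus_U \<theta> = \<one>\<^bsub>nc_torus \<theta>\<^esub>"
  "torus_V \<theta> \<otimes>\<^bsub>nc_torus \<theta>\<^esub> star (nc_torus \<theta>) (torus_V \<theta>) = \<one>\<^bsub>nc_torus \<theta>\<^esub>"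
  "star (nc_torus \<theta>) (torus_V \<theta>) \<otimes>\<^bsub>nc_torus \<theta>\<^esub> torus_V \<theta> = \<one>\<^bsub>nc_torus \<theta>\<^esub>"
  "torus_U \<theta> \<otimes>\<^bsub>nc_torus \<theta>\<^esub> torus_V \<theta> =
     exp (2 * of_real pi * \<i> * of_real \<theta>) \<odot>\<^bsub>nc_torus \<theta>\<^esub> (torus_V \<theta> \<otimes>\<^bsub>nc_torus \<theta>\<^esub> torus_U \<theta>)"
  using torus_ideal(3)[of \<theta>]
  by (simp_all add: torus_U_def torus_V_def torus_class_ops free_star_single free_mult_single
      scale_single torus_class_eq_iff torus_relations_def)

abbreviation letter_flip :: "(letter list \<Rightarrow>\<^sub>0 complex) \<Rightarrow> (letter list \<Rightarrow>\<^sub>0 complex)" where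
  "letter_flip \<equiv> push_forward (map adj)"

lemma letter_flip_props:
  "letter_flip (f \<otimes>\<^bsub>free_star_algebra\<^esub> g) = letter_flip f \<otimes>\<^bsub>free_star_algebra\<^esub> letter_flip g"
  "letter_flip (star free_star_algebra f) = star free_star_algebra (letter_flip f)"
  "letter_flip (Poly_Mapping.map ((*) c) f) = Poly_Mapping.map ((*) c) (letter_flip f)"
  "letter_flip (letter_flip f) = f"
  "letter_flip (f - g) = letter_flip f - letter_flip g"
proof -
  show "letter_flip (f \<otimes>\<^bsub>free_star_algebra\<^esub> g) = letter_flip f \<otimes>\<^bsub>free_star_algebra\<^esub> letter_flip g"
  proof (induction f rule: free_induct)
    case (single k c)
    show ?case by (induction g rule: free_induct) (simp_all add: free_mult_single)
  qed (simp_all add: free_mult_single)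
  show "letter_flip (star free_star_algebra f) = star free_star_algebra (letter_flip f)"
    by (induction f rule: free_induct) (simp_all add: free_star_single rev_map)
  show "letter_flip (Poly_Mapping.map ((*) c) f) = Poly_Mapping.map ((*) c) (letter_flip f)"
    by (induction f rule: free_induct) (simp_all add: scale_single)
  show "letter_flip (letter_flip f) = f"
    by (induction f rule: free_induct) simp_all
  have "letter_flip (f - g) + letter_flip g = letter_flip f"
    by (simp flip: push_forward_simps(3))
  then show "letter_flip (f - g) = letter_flip f - letter_flip g" by (simp add: eq_diff_eq)
qed

lemma letter_flip_torus_ideal:
  assumes "f \<in> torus_ideal \<theta>"
  shows "letter_flip f \<in> torus_ideal \<theta>"
proof -
  let ?F = free_star_algebra and ?I = "torus_ideal \<theta>"
  let ?l = "exp (2 * of_real pi * \<i> * of_real \<theta>) :: complex"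
  interpret I: ideal ?I ?F by (rule torus_ideal)
  define J where "J = {f. letter_flip f \<in> ?I}"
  have J: "ideal J ?F"
  proof (rule idealI)
    show "ring ?F" by (rule free.ring_axioms)
    have inv: "\<ominus>\<^bsub>?F\<^esub> x = 0 - x" for x using free_minus[of 0 x]
      by (simp add: a_minus_def free_star_algebra_simps)
    have 0: "0 \<in> ?I" using I.zero_closed by (simp add: free_star_algebra_simps)
    have neg: "- x \<in> ?I" if "x \<in> ?I" for x
      using I.a_inv_closed[OF that] inv[of x] by simp
    have add: "x + y \<in> ?I" if "x \<in> ?I" "y \<in> ?I" for x y
      using I.a_closed[OF that] by (simp add: free_star_algebra_simps)
    show "subgroup J (add_monoid ?F)"
    proof
      show "inv\<^bsub>add_monoid ?F\<^esub> x \<in> J" if "x \<in> J" for x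
        using that letter_flip_props(5)[of 0 x] neg unfolding a_inv_def[symmetric] inv
        by (simp add: J_def)
    qed (auto simp: J_def free_star_algebra_simps 0 add)
  qed (use I.I_l_closed I.I_r_closed in \<open>auto simp: J_def letter_flip_props free_star_algebra_simps(1)\<close>)
  have st: "\<forall>x\<in>J. star ?F x \<in> J"
    by (auto simp: J_def letter_flip_props torus_ideal(2))
  have rel: "word [Gen_U, Gen_V] - Poly_Mapping.single [Gen_V, Gen_U] ?l \<in> ?I"
    using torus_ideal(3)[of \<theta>] by (auto simp: torus_relations_def)
  have "star ?F (word [Gen_U, Gen_V] - Poly_Mapping.single [Gen_V, Gen_U] ?l)
        = word [Adj_V, Adj_U] - Poly_Mapping.single [Adj_U, Adj_V] (cnj ?l)"
    using free_star_single(2)[of "word [Gen_U, Gen_V] - Poly_Mapping.single [Gen_V, Gen_U] ?l"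
        "Poly_Mapping.single [Gen_V, Gen_U] ?l"]
    by (simp add: free_star_single(1) eq_diff_eq)
  then have "word [Adj_V, Adj_U] - Poly_Mapping.single [Adj_U, Adj_V] (cnj ?l) \<in> ?I"
    using torus_ideal(2)[OF rel] by simp
  from free.ideal_smult[OF torus_ideal(1) this, of "- ?l"]
  have "Poly_Mapping.single [Adj_V, Adj_U] (- ?l) - Poly_Mapping.single [Adj_U, Adj_V] (- ?l * cnj ?l) \<in> ?I"
    by (simp add: free_star_algebra_simps(6) scale_diff scale_single)
  moreover have "?l * cnj ?l = 1"
    by (simp flip: complex_norm_square)
  ultimately have "word [Adj_U, Adj_V] - Poly_Mapping.single [Adj_V, Adj_U] ?l \<in> ?I"
    by (simp add: single_uminus)
  then have "torus_relations \<theta> \<subseteq> J"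
    using torus_ideal(3)[of \<theta>] by (auto simp: torus_relations_def J_def letter_flip_props)
  then have "?I \<subseteq> J"
    unfolding torus_ideal_def star_ideal_def using J st by blast
  then show ?thesis using assms by (auto simp: J_def)
qed

lemma torus_flip_class: "torus_flip \<theta> (torus_class \<theta> f) = torus_class \<theta> (letter_flip f)"
  unfolding torus_flip_def torus_class_def
  by (rule ideal.coset_union[OF torus_ideal(1), where \<phi> = letter_flip])
     (simp_all add: free_star_algebra_simps(1,5) letter_flip_torus_ideal)

lemma torus_flip_ring_iso: "torus_flip \<theta> \<in> ring_iso (nc_torus \<theta>) (nc_torus \<theta>)"
proof (rule ring_iso_memI)
  show "bij_betw (torus_flip \<theta>) (carrier (nc_torus \<theta>)) (carrier (nc_torus \<theta>))"
    by (rule bij_betw_byWitness[where f' = "torus_flip \<theta>"])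
       (auto simp: carrier_torus torus_flip_class letter_flip_props)
qed (auto simp: carrier_torus torus_flip_class letter_flip_props torus_class_ops)

lemma torus_flip:
  "x \<in> carrier (nc_torus \<theta>) \<Longrightarrow> torus_flip \<theta> (c \<odot>\<^bsub>nc_torus \<theta>\<^esub> x) = c \<odot>\<^bsub>nc_torus \<theta>\<^esub> torus_flip \<theta> x"
  "x \<in> carrier (nc_torus \<theta>) \<Longrightarrow> torus_flip \<theta> (star (nc_torus \<theta>) x) = star (nc_torus \<theta>) (torus_flip \<theta> x)"
  "x \<in> carrier (nc_torus \<theta>) \<Longrightarrow> torus_flip \<theta> (torus_flip \<theta> x) = x"
  "torus_flip \<theta> (torus_U \<theta>) = star (nc_torus \<theta>) (torus_U \<theta>)"
  "torus_flip \<theta> (torus_V \<theta>) = star (nc_torus \<theta>) (torus_V \<theta>)"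
  by (auto simp: carrier_torus torus_flip_class letter_flip_props torus_class_ops torus_U_def torus_V_def
       free_star_single)

lemma complex_star_algebra_pillow: "complex_star_algebra (nc_pillow \<theta>)"
proof -
  let ?T = "nc_torus \<theta>"
  let ?H = "{x \<in> carrier ?T. torus_flip \<theta> x = x}"
  interpret T: complex_star_algebra ?T by (rule complex_star_algebra_torus)
  interpret f: ring_hom_ring ?T ?T "torus_flip \<theta>"
    using torus_flip_ring_iso[of \<theta>] by (intro ring_hom_ringI2 T.ring_axioms) (auto simp: ring_iso_def)
  have "subring ?H ?T"
    by (rule T.subringI) (auto simp: torus_flip)
  then have A: "complex_algebra (nc_pillow \<theta>)"
    unfolding nc_pillow_def
    by (rule complex_algebra_subalgebra[OF T.complex_algebra_axioms]) (auto simp: torus_flip)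
  show ?thesis
    by (rule complex_star_algebra.intro[OF A], rule complex_star_algebra_axioms.intro)
       (auto simp: nc_pillow_def T.star_closed T.star_star T.star_add T.star_smult T.star_mult torus_flip)
qed

lemma carrier_pillow: "carrier (nc_pillow \<theta>) = torus_part \<theta> 0"
  by (simp add: nc_pillow_def torus_part_def)


section \<open>The diagonal bimodule is a module over the enveloping algebra\<close>

context complex_algebra
begin

lemma sandwich_superset:
  assumes "finite S" "Poly_Mapping.keys f \<subseteq> S" "S \<subseteq> carrier A \<times> carrier A" "x \<in> carrier A"
  shows "sandwich A f x = (\<Oplus>\<^bsub>A\<^esub>p\<in>S. Poly_Mapping.lookup f p \<odot>\<^bsub>A\<^esub> (fst p \<otimes>\<^bsub>A\<^esub> x \<otimes>\<^bsub>A\<^esub> snd p))"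
proof -
  have cl: "fst p \<otimes>\<^bsub>A\<^esub> x \<otimes>\<^bsub>A\<^esub> snd p \<in> carrier A" if "p \<in> S" for p
    using that assms by (auto simp: mem_Times_iff)
  show ?thesis unfolding sandwich_def
  proof (rule M.add.finprod_mono_neutral_cong_left)
    show "Poly_Mapping.lookup f p \<odot>\<^bsub>A\<^esub> (fst p \<otimes>\<^bsub>A\<^esub> x \<otimes>\<^bsub>A\<^esub> snd p) = \<zero>\<^bsub>A\<^esub>"
      if "p \<in> S - Poly_Mapping.keys f" for p
      using smult_l_null[OF cl[of p]] that by (simp add: in_keys_iff ring_of_type_algebra_def)
  qed (use assms cl in auto)
qed

lemma sandwich_closed:
  assumes "Poly_Mapping.keys f \<subseteq> carrier A \<times> carrier A" "x \<in> carrier A"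
  shows "sandwich A f x \<in> carrier A"
  unfolding sandwich_def by (rule finsum_closed) (use assms in auto)

lemma sandwich_zero: "sandwich A 0 x = \<zero>\<^bsub>A\<^esub>"
  by (simp add: sandwich_def)

lemma sandwich_add:
  assumes "Poly_Mapping.keys f \<subseteq> carrier A \<times> carrier A" "Poly_Mapping.keys g \<subseteq> carrier A \<times> carrier A"
    "x \<in> carrier A"
  shows "sandwich A (f + g) x = sandwich A f x \<oplus>\<^bsub>A\<^esub> sandwich A g x"
proof -
  let ?S = "Poly_Mapping.keys f \<union> Poly_Mapping.keys g"
  have S: "finite ?S" "?S \<subseteq> carrier A \<times> carrier A" using assms by auto
  have cl: "fst p \<otimes>\<^bsub>A\<^esub> x \<otimes>\<^bsub>A\<^esub> snd p \<in> carrier A" if "p \<in> ?S" for p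
    using that assms by (auto simp: mem_Times_iff)
  have dist: "(c + d) \<odot>\<^bsub>A\<^esub> y = c \<odot>\<^bsub>A\<^esub> y \<oplus>\<^bsub>A\<^esub> d \<odot>\<^bsub>A\<^esub> y" if "y \<in> carrier A" for c d y
    using smult_l_distr[of c d y] that by (simp add: ring_of_type_algebra_def)
  have "sandwich A (f + g) x =
     (\<Oplus>\<^bsub>A\<^esub>p\<in>?S. Poly_Mapping.lookup (f + g) p \<odot>\<^bsub>A\<^esub> (fst p \<otimes>\<^bsub>A\<^esub> x \<otimes>\<^bsub>A\<^esub> snd p))"
    by (rule sandwich_superset) (use S assms keys_add[of f g] in auto)
  also have "\<dots> = (\<Oplus>\<^bsub>A\<^esub>p\<in>?S. Poly_Mapping.lookup f p \<odot>\<^bsub>A\<^esub> (fst p \<otimes>\<^bsub>A\<^esub> x \<otimes>\<^bsub>A\<^esub> snd p)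
                       \<oplus>\<^bsub>A\<^esub> Poly_Mapping.lookup g p \<odot>\<^bsub>A\<^esub> (fst p \<otimes>\<^bsub>A\<^esub> x \<otimes>\<^bsub>A\<^esub> snd p))"
    by (rule M.add.finprod_cong') (use cl dist in \<open>auto simp: lookup_add\<close>)
  also have "\<dots> = (\<Oplus>\<^bsub>A\<^esub>p\<in>?S. Poly_Mapping.lookup f p \<odot>\<^bsub>A\<^esub> (fst p \<otimes>\<^bsub>A\<^esub> x \<otimes>\<^bsub>A\<^esub> snd p))
      \<oplus>\<^bsub>A\<^esub> (\<Oplus>\<^bsub>A\<^esub>p\<in>?S. Poly_Mapping.lookup g p \<odot>\<^bsub>A\<^esub> (fst p \<otimes>\<^bsub>A\<^esub> x \<otimes>\<^bsub>A\<^esub> snd p))"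
    by (rule finsum_addf) (use cl in auto)
  also have "(\<Oplus>\<^bsub>A\<^esub>p\<in>?S. Poly_Mapping.lookup f p \<odot>\<^bsub>A\<^esub> (fst p \<otimes>\<^bsub>A\<^esub> x \<otimes>\<^bsub>A\<^esub> snd p)) = sandwich A f x"
    by (rule sandwich_superset[symmetric]) (use S assms in auto)
  also have "(\<Oplus>\<^bsub>A\<^esub>p\<in>?S. Poly_Mapping.lookup g p \<odot>\<^bsub>A\<^esub> (fst p \<otimes>\<^bsub>A\<^esub> x \<otimes>\<^bsub>A\<^esub> snd p)) = sandwich A g x"
    by (rule sandwich_superset[symmetric]) (use S assms in auto)
  finally show ?thesis .
qed

lemma sandwich_single:
  assumes "a \<in> carrier A" "b \<in> carrier A" "x \<in> carrier A"
  shows "sandwich A (Poly_Mapping.single (a, b) c) x = c \<odot>\<^bsub>A\<^esub> (a \<otimes>\<^bsub>A\<^esub> x \<otimes>\<^bsub>A\<^esub> b)"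
proof -
  have "sandwich A (Poly_Mapping.single (a, b) c) x = (\<Oplus>\<^bsub>A\<^esub>p\<in>{(a, b)}. Poly_Mapping.lookup (Poly_Mapping.single (a, b) c) p \<odot>\<^bsub>A\<^esub> (fst p \<otimes>\<^bsub>A\<^esub> x \<otimes>\<^bsub>A\<^esub> snd p))"
    by (rule sandwich_superset) (use assms in auto)
  then show ?thesis using assms by simp
qed

lemma sandwich_diff:
  assumes "Poly_Mapping.keys f \<subseteq> carrier A \<times> carrier A" "Poly_Mapping.keys g \<subseteq> carrier A \<times> carrier A"
    "x \<in> carrier A"
  shows "sandwich A (f - g) x = sandwich A f x \<ominus>\<^bsub>A\<^esub> sandwich A g x"
proof -
  have d: "Poly_Mapping.keys (f - g) \<subseteq> carrier A \<times> carrier A"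
    using keys_diff[of f g] assms by blast
  have "sandwich A f x = sandwich A (f - g) x \<oplus>\<^bsub>A\<^esub> sandwich A g x"
    using sandwich_add[OF d assms(2,3)] by simp
  then show ?thesis
    using sandwich_closed[OF d assms(3)] sandwich_closed[OF assms(2,3)]
    by (simp add: a_minus_def a_assoc r_neg)
qed

lemma sandwich_add_right:
  assumes "Poly_Mapping.keys f \<subseteq> carrier A \<times> carrier A" "x \<in> carrier A" "y \<in> carrier A"
  shows "sandwich A f (x \<oplus>\<^bsub>A\<^esub> y) = sandwich A f x \<oplus>\<^bsub>A\<^esub> sandwich A f y"
  using assms(1)
proof (induction f rule: poly_mapping_single_induct)
  case (single k c)
  then show ?case using assms(2,3) 
    by (cases k) (simp add: sandwich_single l_distr r_distr smult_r_distr)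
next
  case (add f g)
  then show ?case using assms(2,3)
    by (simp add: sandwich_add sandwich_closed M.add.m_ac)
qed (simp_all add: sandwich_zero)

lemma sandwich_smult_right:
  assumes "Poly_Mapping.keys f \<subseteq> carrier A \<times> carrier A" "x \<in> carrier A"
  shows "sandwich A f (c \<odot>\<^bsub>A\<^esub> x) = c \<odot>\<^bsub>A\<^esub> sandwich A f x"
  using assms(1)
proof (induction f rule: poly_mapping_single_induct)
  case (single k d)
  then have "fst k \<in> carrier A" "snd k \<in> carrier A" by auto
  then show ?case using assms(2) 
    by (cases k) (simp add: sandwich_single smult_mult_left smult_mult_right ring_of_type_algebra_def
         mult.commute flip: smult_assoc1[OF carrier_complex_field carrier_complex_field])
next
  case (add f g)
  then show ?case using assms(2)
    by (simp add: sandwich_add sandwich_closed smult_r_distr)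
qed (simp_all add: sandwich_zero)

abbreviation env_monoid where "env_monoid \<equiv> A \<times>\<times> opposite_algebra A"

lemma carrier_env_monoid: "carrier env_monoid = carrier A \<times> carrier A"
  by (simp add: DirProd_def opposite_algebra_def)

lemma complex_algebra_env_monoid: "complex_algebra (monoid_algebra env_monoid)"
proof -
  interpret op: complex_algebra "opposite_algebra A"
    by (rule complex_algebra_opposite[OF complex_algebra_axioms])
  show ?thesis by (intro complex_algebra_monoid_algebra DirProd_monoid monoid_axioms op.monoid_axioms)
qed

lemma sandwich_mult:
  assumes "Poly_Mapping.keys f \<subseteq> carrier A \<times> carrier A" "Poly_Mapping.keys g \<subseteq> carrier A \<times> carrier A"
    "x \<in> carrier A"
  shows "sandwich A (f \<otimes>\<^bsub>monoid_algebra env_monoid\<^esub> g) x = sandwich A f (sandwich A g x)"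
proof -
  interpret E: complex_algebra "monoid_algebra env_monoid" by (rule complex_algebra_env_monoid)
  have E: "Poly_Mapping.keys (f \<otimes>\<^bsub>monoid_algebra env_monoid\<^esub> g) \<subseteq> carrier A \<times> carrier A"
    if "Poly_Mapping.keys f \<subseteq> carrier A \<times> carrier A" "Poly_Mapping.keys g \<subseteq> carrier A \<times> carrier A" for f g
    using E.m_closed[of f g] that by (simp add: monoid_algebra_simps carrier_env_monoid)
  from assms(1) show ?thesis
  proof (induction f rule: poly_mapping_single_induct)
    case (single k c)
    then have k: "fst k \<in> carrier A" "snd k \<in> carrier A" by auto
    have kk: "Poly_Mapping.keys (Poly_Mapping.single k c) \<subseteq> carrier A \<times> carrier A" using single by auto
    from assms(2) show ?case
    proof (induction g rule: poly_mapping_single_induct)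
      case (single l d)
      then have l: "fst l \<in> carrier A" "snd l \<in> carrier A" by auto
      have kl: "k \<otimes>\<^bsub>env_monoid\<^esub> l = (fst k \<otimes>\<^bsub>A\<^esub> fst l, snd l \<otimes>\<^bsub>A\<^esub> snd k)"
        by (simp add: DirProd_def opposite_algebra_def split: prod.split)
      have "sandwich A (Poly_Mapping.single k c \<otimes>\<^bsub>monoid_algebra env_monoid\<^esub> Poly_Mapping.single l d) x
         = (c * d) \<odot>\<^bsub>A\<^esub> ((fst k \<otimes>\<^bsub>A\<^esub> fst l) \<otimes>\<^bsub>A\<^esub> x \<otimes>\<^bsub>A\<^esub> (snd l \<otimes>\<^bsub>A\<^esub> snd k))"
        using k l assms(3) by (simp add: monoid_algebra_mult kl sandwich_single)
      also have "\<dots> = c \<odot>\<^bsub>A\<^esub> (d \<odot>\<^bsub>A\<^esub> ((fst k \<otimes>\<^bsub>A\<^esub> fst l) \<otimes>\<^bsub>A\<^esub> x \<otimes>\<^bsub>A\<^esub> (snd l \<otimes>\<^bsub>A\<^esub> snd k)))"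
        using smult_assoc1[of c d] k l assms(3) by (simp add: ring_of_type_algebra_def)
      also have "\<dots> = sandwich A (Poly_Mapping.single k c) (sandwich A (Poly_Mapping.single l d) x)"
        using k l assms(3) sandwich_single[of "fst l" "snd l" x d]
          sandwich_single[of "fst k" "snd k" "d \<odot>\<^bsub>A\<^esub> (fst l \<otimes>\<^bsub>A\<^esub> x \<otimes>\<^bsub>A\<^esub> snd l)" c]
        by (simp add: smult_mult_left smult_mult_right m_assoc)
      finally show ?case .
    next
      case (add g h)
      then show ?case using assms(3) kk E[OF kk]
        by (simp add: monoid_algebra_mult sandwich_add sandwich_closed sandwich_add_right)
    next
      case zero
      have "sandwich A (Poly_Mapping.single k c) \<zero>\<^bsub>A\<^esub> = \<zero>\<^bsub>A\<^esub>"
        using sandwich_single[OF k zero_closed, of c] k by simp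
      then show ?case by (simp add: monoid_algebra_mult sandwich_zero)
    qed
  next
    case (add f h)
    then show ?case using assms(2,3) E
      by (simp add: monoid_algebra_mult sandwich_add sandwich_closed)
  qed (simp add: monoid_algebra_mult sandwich_zero)
qed

lemma sandwich_bilinear_ideal:
  assumes "f \<in> genideal (monoid_algebra env_monoid) (bilinear_relations A (opposite_algebra A))"
    and "x \<in> carrier A"
  shows "sandwich A f x = \<zero>\<^bsub>A\<^esub>"
proof -
  let ?E = "monoid_algebra env_monoid"
  interpret E: complex_algebra ?E by (rule complex_algebra_env_monoid)
  define J where "J = {f. Poly_Mapping.keys f \<subseteq> carrier A \<times> carrier A \<and> (\<forall>x\<in>carrier A. sandwich A f x = \<zero>\<^bsub>A\<^esub>)}"
  have carr: "carrier ?E = {f. Poly_Mapping.keys f \<subseteq> carrier A \<times> carrier A}"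
    by (simp only: monoid_algebra_simps carrier_env_monoid)
  have z: "sandwich A f \<zero>\<^bsub>A\<^esub> = \<zero>\<^bsub>A\<^esub>" if "Poly_Mapping.keys f \<subseteq> carrier A \<times> carrier A" for f
    using sandwich_smult_right[OF that zero_closed, of 0] sandwich_closed[OF that zero_closed]
      smult_l_null[of "sandwich A f \<zero>\<^bsub>A\<^esub>"] smult_l_null[OF zero_closed]
    by (simp add: ring_of_type_algebra_def)
  have cl: "Poly_Mapping.keys (f + g) \<subseteq> carrier A \<times> carrier A"
    if "Poly_Mapping.keys f \<subseteq> carrier A \<times> carrier A" "Poly_Mapping.keys g \<subseteq> carrier A \<times> carrier A" for f g :: "'a \<times> 'a \<Rightarrow>\<^sub>0 complex"
    using keys_add[of f g] that by blast
  have "ideal J ?E"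
  proof (rule idealI)
    show "ring ?E" by (rule E.ring_axioms)
    have neg: "\<ominus>\<^bsub>?E\<^esub> f = - f" if "f \<in> carrier ?E" for f
      by (rule E.minus_equality) (use that in \<open>auto simp: monoid_algebra_simps\<close>)
    show "subgroup J (add_monoid ?E)"
    proof
      show "inv\<^bsub>add_monoid ?E\<^esub> f \<in> J" if "f \<in> J" for f
      proof -
        have f: "f \<in> carrier ?E" using that by (simp add: J_def carr)
        show ?thesis
          unfolding a_inv_def[symmetric] neg[OF f]
          using that sandwich_diff[of 0 f] by (simp add: J_def sandwich_zero)
      qed
    qed (auto simp: J_def carr sandwich_add sandwich_zero monoid_algebra_simps(3,4) cl)
    fix f g assume fg: "f \<in> J" "g \<in> carrier ?E"
    then have "f \<otimes>\<^bsub>?E\<^esub> g \<in> carrier ?E" "g \<otimes>\<^bsub>?E\<^esub> f \<in> carrier ?E"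
      by (intro E.m_closed; simp add: J_def carr)+
    with fg show "f \<otimes>\<^bsub>?E\<^esub> g \<in> J" "g \<otimes>\<^bsub>?E\<^esub> f \<in> J"
      by (simp_all add: J_def carr sandwich_mult sandwich_closed z)
  qed
  moreover have "bilinear_relations A (opposite_algebra A) \<subseteq> J"
  proof
    fix r assume "r \<in> bilinear_relations A (opposite_algebra A)"
    then consider
      (1) a a' b where "a \<in> carrier A" "a' \<in> carrier A" "b \<in> carrier A"
        "r = Poly_Mapping.single (a \<oplus>\<^bsub>A\<^esub> a', b) 1 - Poly_Mapping.single (a, b) 1 - Poly_Mapping.single (a', b) 1"
    | (2) a b b' where "a \<in> carrier A" "b \<in> carrier A" "b' \<in> carrier A"
        "r = Poly_Mapping.single (a, b \<oplus>\<^bsub>A\<^esub> b') 1 - Poly_Mapping.single (a, b) 1 - Poly_Mapping.single (a, b') 1"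
    | (3) a b c where "a \<in> carrier A" "b \<in> carrier A"
        "r = Poly_Mapping.single (c \<odot>\<^bsub>A\<^esub> a, b) 1 - Poly_Mapping.single (a, b) c"
    | (4) a b c where "a \<in> carrier A" "b \<in> carrier A"
        "r = Poly_Mapping.single (a, c \<odot>\<^bsub>A\<^esub> b) 1 - Poly_Mapping.single (a, b) c"
      unfolding bilinear_relations_def opposite_algebra_def by auto
    then show "r \<in> J"
    proof cases
      have d: "Poly_Mapping.keys (f - g) \<subseteq> carrier A \<times> carrier A"
        if "Poly_Mapping.keys f \<subseteq> carrier A \<times> carrier A" "Poly_Mapping.keys g \<subseteq> carrier A \<times> carrier A" for f g :: "'a \<times> 'a \<Rightarrow>\<^sub>0 complex"
        using keys_diff[of f g] that by blast
      have one: "1 \<odot>\<^bsub>A\<^esub> y = y" if "y \<in> carrier A" for y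
        using smult_one[OF that] by (simp add: ring_of_type_algebra_def)
      have zz: "y \<oplus>\<^bsub>A\<^esub> z \<ominus>\<^bsub>A\<^esub> y \<ominus>\<^bsub>A\<^esub> z = \<zero>\<^bsub>A\<^esub>" "y \<ominus>\<^bsub>A\<^esub> y = \<zero>\<^bsub>A\<^esub>"
        if "y \<in> carrier A" "z \<in> carrier A" for y z
        using that M.a_comm[of y z] by (simp_all add: a_minus_def M.a_assoc M.r_neg M.r_neg2)
      {
        case 1
        then show ?thesis
          by (simp add: J_def d sandwich_diff sandwich_single one l_distr zz)
      next
        case 2
        then show ?thesis
          by (simp add: J_def d sandwich_diff sandwich_single one r_distr zz)
      next
        case 3
        then show ?thesis
          by (simp add: J_def d sandwich_diff sandwich_single one smult_mult_left zz)
      next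
        case 4
        then show ?thesis
          by (simp add: J_def d sandwich_diff sandwich_single one smult_mult_right zz)
      }
    qed
  qed
  ultimately have "genideal ?E (bilinear_relations A (opposite_algebra A)) \<subseteq> J"
    by (intro E.genideal_minimal)
  then show ?thesis using assms by (auto simp: J_def)
qed

lemma bilinear_genideal:
  "ideal (genideal (monoid_algebra env_monoid) (bilinear_relations A (opposite_algebra A))) (monoid_algebra env_monoid)"
proof -
  interpret E: complex_algebra "monoid_algebra env_monoid" by (rule complex_algebra_env_monoid)
  show ?thesis
    by (intro E.genideal_ideal bilinear_relations_carrier complex_algebra_opposite complex_algebra_axioms)
qed

definition tensor_class :: "('a \<times> 'a \<Rightarrow>\<^sub>0 complex) \<Rightarrow> ('a \<times> 'a \<Rightarrow>\<^sub>0 complex) set" where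
  "tensor_class f = genideal (monoid_algebra env_monoid) (bilinear_relations A (opposite_algebra A))
     +>\<^bsub>monoid_algebra env_monoid\<^esub> f"

lemma diagonal_smult_class:
  assumes f: "Poly_Mapping.keys f \<subseteq> carrier A \<times> carrier A" and x: "x \<in> carrier A"
  shows "tensor_class f \<odot>\<^bsub>diagonal_bimodule A\<^esub> x = sandwich A f x"
proof -
  let ?E = "monoid_algebra env_monoid"
  let ?I = "genideal ?E (bilinear_relations A (opposite_algebra A))"
  interpret I: ideal ?I ?E by (rule bilinear_genideal)
  have fE: "f \<in> carrier ?E" using f by (simp only: monoid_algebra_simps carrier_env_monoid mem_Collect_eq)
  have "sandwich A g x = sandwich A f x" if g: "g \<in> tensor_class f" for g
  proof -
    obtain h where h: "h \<in> ?I" "g = h + f"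
      using g unfolding tensor_class_def a_r_coset_def' monoid_algebra_simps by auto
    then have "Poly_Mapping.keys h \<subseteq> carrier A \<times> carrier A"
      using I.a_Hcarr[OF h(1)] by (simp only: monoid_algebra_simps carrier_env_monoid mem_Collect_eq)
    then show ?thesis
      using h f x by (simp add: sandwich_add sandwich_closed sandwich_bilinear_ideal)
  qed
  moreover have "f \<in> tensor_class f"
    unfolding tensor_class_def by (rule I.a_rcos_self[OF fE])
  ultimately have "(\<lambda>f. sandwich A f x) ` tensor_class f = {sandwich A f x}" by blast
  then show ?thesis by (simp add: diagonal_bimodule_def)
qed

lemma diagonal_pure_tensor:
  assumes "a \<in> carrier A" "b \<in> carrier A" "x \<in> carrier A"
  shows "pure_tensor A (opposite_algebra A) a b \<odot>\<^bsub>diagonal_bimodule A\<^esub> x = a \<otimes>\<^bsub>A\<^esub> x \<otimes>\<^bsub>A\<^esub> b"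
proof -
  have "pure_tensor A (opposite_algebra A) a b = tensor_class (Poly_Mapping.single (a, b) 1)"
    by (simp add: pure_tensor_def tensor_class_def)
  moreover have "1 \<odot>\<^bsub>A\<^esub> (a \<otimes>\<^bsub>A\<^esub> x \<otimes>\<^bsub>A\<^esub> b) = a \<otimes>\<^bsub>A\<^esub> x \<otimes>\<^bsub>A\<^esub> b"
    using smult_one[of "a \<otimes>\<^bsub>A\<^esub> x \<otimes>\<^bsub>A\<^esub> b"] assms by (simp add: ring_of_type_algebra_def)
  ultimately show ?thesis
    using diagonal_smult_class[of "Poly_Mapping.single (a, b) 1" x] assms by (simp add: sandwich_single)
qed

lemma left_module_diagonal: "left_module (enveloping_algebra A) (diagonal_bimodule A)"
proof -
  let ?E = "monoid_algebra env_monoid" and ?T = "enveloping_algebra A" and ?D = "diagonal_bimodule A"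
  let ?I = "genideal ?E (bilinear_relations A (opposite_algebra A))"
  interpret E: complex_algebra ?E by (rule complex_algebra_env_monoid)
  interpret I: ideal ?I ?E by (rule bilinear_genideal)
  interpret T: complex_algebra ?T
    by (intro complex_algebra_tensor complex_algebra_axioms complex_algebra_opposite)
  have carr: "carrier ?E = {f. Poly_Mapping.keys f \<subseteq> carrier A \<times> carrier A}"
    by (simp only: monoid_algebra_simps carrier_env_monoid)
  have D: "carrier ?D = carrier A" "add ?D = add A" "\<zero>\<^bsub>?D\<^esub> = \<zero>\<^bsub>A\<^esub>"
    by (simp_all add: diagonal_bimodule_def)
  have all: "(\<forall>K\<in>carrier ?T. P K) \<longleftrightarrow> (\<forall>f\<in>carrier ?E. P (tensor_class f))" for P
    by (auto simp: tensor_algebra_def quotient_algebra_simps A_RCOSETS_def' tensor_class_def)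
  have add: "tensor_class f \<oplus>\<^bsub>?T\<^esub> tensor_class g = tensor_class (f + g)"
    if "f \<in> carrier ?E" "g \<in> carrier ?E" for f g
    using I.a_rcos_sum[OF that]
    by (simp only: tensor_algebra_def quotient_algebra_simps tensor_class_def monoid_algebra_simps(4))
  have mult: "tensor_class f \<otimes>\<^bsub>?T\<^esub> tensor_class g = tensor_class (f \<otimes>\<^bsub>?E\<^esub> g)"
    if "f \<in> carrier ?E" "g \<in> carrier ?E" for f g
    using I.rcoset_mult_add[OF that]
    by (simp only: tensor_algebra_def quotient_algebra_simps tensor_class_def)
  have one: "\<one>\<^bsub>?T\<^esub> = pure_tensor A (opposite_algebra A) \<one>\<^bsub>A\<^esub> \<one>\<^bsub>A\<^esub>"
    by (simp add: tensor_algebra_def quotient_algebra_simps pure_tensor_def monoid_algebra_simps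
        DirProd_def opposite_algebra_def)
  have act: "tensor_class f \<odot>\<^bsub>?D\<^esub> x = sandwich A f x" if "f \<in> carrier ?E" "x \<in> carrier A" for f x
    using that diagonal_smult_class by (simp add: carr)
  have cl: "sandwich A f x \<in> carrier A" if "f \<in> carrier ?E" "x \<in> carrier A" for f x
    using that sandwich_closed by (simp add: carr)
  have 1: "\<forall>K\<in>carrier ?T. \<forall>x\<in>carrier A. K \<odot>\<^bsub>?D\<^esub> x \<in> carrier A"
    unfolding all by (simp add: act cl)
  have 2: "\<forall>K\<in>carrier ?T. \<forall>L\<in>carrier ?T. \<forall>x\<in>carrier A. (K \<oplus>\<^bsub>?T\<^esub> L) \<odot>\<^bsub>?D\<^esub> x = K \<odot>\<^bsub>?D\<^esub> x \<oplus>\<^bsub>A\<^esub> L \<odot>\<^bsub>?D\<^esub> x"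
    unfolding all using E.a_closed by (simp add: act add sandwich_add carr monoid_algebra_simps(4))
  have 3: "\<forall>K\<in>carrier ?T. \<forall>x\<in>carrier A. \<forall>y\<in>carrier A. K \<odot>\<^bsub>?D\<^esub> (x \<oplus>\<^bsub>A\<^esub> y) = K \<odot>\<^bsub>?D\<^esub> x \<oplus>\<^bsub>A\<^esub> K \<odot>\<^bsub>?D\<^esub> y"
    unfolding all by (simp add: act sandwich_add_right carr)
  have 4: "\<forall>K\<in>carrier ?T. \<forall>L\<in>carrier ?T. \<forall>x\<in>carrier A. (K \<otimes>\<^bsub>?T\<^esub> L) \<odot>\<^bsub>?D\<^esub> x = K \<odot>\<^bsub>?D\<^esub> (L \<odot>\<^bsub>?D\<^esub> x)"
    unfolding all using E.m_closed by (simp add: act mult cl sandwich_mult carr)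
  have ab: "abelian_group ?D"
  proof (rule abelian_groupI)
    fix x assume "x \<in> carrier ?D"
    then show "\<exists>y\<in>carrier ?D. y \<oplus>\<^bsub>?D\<^esub> x = \<zero>\<^bsub>?D\<^esub>"
      using l_neg[of x] a_inv_closed[of x] by (auto simp: D)
  qed (auto simp: D a_assoc intro: a_comm)
  show ?thesis
    by (rule left_module.intro[OF T.ring_axioms ab], rule left_module_axioms.intro)
       (simp_all add: D 1[rule_format] 2[rule_format] 3[rule_format] 4[rule_format] one diagonal_pure_tensor)
qed

end


section \<open>The module structure of free modules\<close>

lemma left_module_free:
  assumes "ring R"
  shows "left_module R (free_left_module R n)"
proof -
  interpret R: ring R by fact
  let ?F = "free_left_module R n"
  have ab: "abelian_group ?F"
  proof (rule abelian_groupI)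
    fix x assume x: "x \<in> carrier ?F"
    let ?y = "\<lambda>i\<in>{..<n}. \<ominus>\<^bsub>R\<^esub> x i"
    have "?y \<in> carrier ?F" "?y \<oplus>\<^bsub>?F\<^esub> x = \<zero>\<^bsub>?F\<^esub>"
      using x by (auto simp: free_left_module_def PiE_iff R.l_neg intro!: restrict_ext)
    then show "\<exists>y\<in>carrier ?F. y \<oplus>\<^bsub>?F\<^esub> x = \<zero>\<^bsub>?F\<^esub>" by blast
  next
    fix x assume x: "x \<in> carrier ?F"
    show "\<zero>\<^bsub>?F\<^esub> \<oplus>\<^bsub>?F\<^esub> x = x"
      using x by (intro extensionalityI[of _ "{..<n}"]) (auto simp: free_left_module_def PiE_iff)
  qed (auto simp: free_left_module_def PiE_iff R.a_assoc intro!: restrict_ext R.a_comm)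
  show ?thesis
  proof (rule left_module.intro[OF assms ab], rule left_module_axioms.intro)
    fix x assume x: "x \<in> carrier ?F"
    show "\<one>\<^bsub>R\<^esub> \<odot>\<^bsub>?F\<^esub> x = x"
      using x by (intro extensionalityI[of _ "{..<n}"]) (auto simp: free_left_module_def PiE_iff)
  qed (auto simp: free_left_module_def PiE_iff R.l_distr R.r_distr R.m_assoc intro!: restrict_ext)
qed


end

(* The torus A is the group algebra of Z^2 twisted by a bicharacter, and the flip is induced by p -> -p.
   Since lambda^4 differs from 1, the odd part contains elements with sum of products a_i b_i equal to 1;
   this gives strong grading, and it makes A a finitely generated projective module over its even part.

   For the smoothness, the enveloping algebra of the pillow is identified with the part of
   E = A (x) A^op fixed by both flips. Over E the diagonal bimodule A is resolved by the Koszul complex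
   E -> E^2 -> E of the commuting elements U (x) U^-1 - 1 and V (x) V^-1 - 1. The simultaneous flip acts
   on this complex once its action is twisted in positive degrees; in characteristic zero the
   invariants stay exact, they resolve the pillow, and they are direct summands of the modules
   E and E^2, which are finitely generated projective over the fixed part of E. *)

theory Submission
  imports Defs "HOL-Library.Product_Plus"
begin

section \<open>Resolutions from dual bases\<close>

text \<open>Two different groups of flips occur, and this shapes the argument. The multiplication
  map A \<otimes> A^op \<rightarrow> A is compatible only with the simultaneous flip, so only that
  flip can act on the whole complex. The ring that acts, however, has to be the smaller part of E
  fixed by each flip separately. The modules are therefore invariants under one involution over a
  ring of invariants under two, and finite projectivity of E over that ring becomes the crucial
  point. It rests on elements v_i, u_i of A with \<Sum> v_i u_i = 1 and \<Sum> flip(v_i) u_i = 0.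
  They turn the trace x + flip(x) into a dual basis, and the construction is applied once to each
  tensor leg. The presentation of the torus by generators and relations does not reveal that the
  monomials U^i V^j are independent, and a tensor product made of formal pairs hides its elements in
  the same way. Both are therefore replaced by concrete algebras with bases Z^2 and Z^4, in which
  kernels can be computed from degrees.\<close>

locale module_action = ring R for R :: "('r, 'k) ring_scheme" (structure) +
  fixes act :: "'r \<Rightarrow> 'v::ab_group_add \<Rightarrow> 'v"
  assumes act_add_left: "\<lbrakk>a \<in> carrier R; b \<in> carrier R\<rbrakk> \<Longrightarrow> act (a \<oplus>\<^bsub>R\<^esub> b) x = act a x + act b x"
    and act_add: "a \<in> carrier R \<Longrightarrow> act a (x + y) = act a x + act a y"
    and act_mult: "\<lbrakk>a \<in> carrier R; b \<in> carrier R\<rbrakk> \<Longrightarrow> act (a \<otimes>\<^bsub>R\<^esub> b) x = act a (act b x)"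
    and act_one: "act \<one>\<^bsub>R\<^esub> x = x"
begin

lemma act_zero: "a \<in> carrier R \<Longrightarrow> act a 0 = 0"
  using act_add[of a 0 0] by simp

lemma act_sum: "a \<in> carrier R \<Longrightarrow> act a (sum g I) = (\<Sum>i\<in>I. act a (g i))"
  by (induction I rule: infinite_finite_induct) (auto simp: act_zero act_add)

definition equivariant :: "('v \<Rightarrow> 'v) \<Rightarrow> bool" where
  "equivariant p \<longleftrightarrow> (\<forall>x y. p (x + y) = p x + p y) \<and> (\<forall>a\<in>carrier R. \<forall>x. p (act a x) = act a (p x))"

lemma equivariantD:
  assumes "equivariant p"
  shows "p (x + y) = p x + p y" "a \<in> carrier R \<Longrightarrow> p (act a x) = act a (p x)" "p 0 = 0" "p (x - y) = p x - p y"
proof -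
  show *: "p (x + y) = p x + p y" for x y using assms by (simp add: equivariant_def)
  show "p 0 = 0" using *[of 0 0] by simp
  show "p (x - y) = p x - p y" using *[of "x - y" y] by simp
qed (use assms in \<open>simp add: equivariant_def\<close>)

end

lemma left_module_submodule:
  assumes "left_module R M" "submodule S R M"
  shows "left_module R (M\<lparr>carrier := S\<rparr>)"
proof -
  interpret M: left_module R M by fact
  interpret S: submodule S R M by fact
  have S: "\<And>x y. \<lbrakk>x \<in> S; y \<in> S\<rbrakk> \<Longrightarrow> x \<oplus>\<^bsub>M\<^esub> y \<in> S" "\<zero>\<^bsub>M\<^esub> \<in> S" "\<And>x. x \<in> S \<Longrightarrow> x \<in> carrier M"
    "\<And>x. x \<in> S \<Longrightarrow> \<ominus>\<^bsub>M\<^esub> x \<in> S"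
    using S.m_closed S.one_closed S.subset S.m_inv_closed by (auto simp: a_inv_def)
  have ab: "abelian_group (M\<lparr>carrier := S\<rparr>)"
  proof (rule abelian_groupI)
    fix x assume "x \<in> carrier (M\<lparr>carrier := S\<rparr>)"
    then show "\<exists>y\<in>carrier (M\<lparr>carrier := S\<rparr>). y \<oplus>\<^bsub>M\<lparr>carrier := S\<rparr>\<^esub> x = \<zero>\<^bsub>M\<lparr>carrier := S\<rparr>\<^esub>"
      by (intro bexI[of _ "\<ominus>\<^bsub>M\<^esub> x"]) (simp_all add: S M.M.l_neg)
  qed (auto simp: S M.M.a_assoc intro: M.M.a_comm)
  show ?thesis
    by (rule left_module.intro[OF M.R.ring_axioms ab], rule left_module_axioms.intro)
       (simp_all add: S M.smult_l_distr M.smult_r_distr M.smult_assoc M.smult_one)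
qed

text \<open>The dual basis criterion: such functionals and generators make the whole type a direct
  summand of the free module of rank \<open>card K\<close>. All modules of the resolution are later
  cut out of this one module, so a single dual basis serves every degree.\<close>

locale dual_basis = module_action R act
  for R :: "('r, 'k) ring_scheme" (structure) and act :: "'r \<Rightarrow> 'v::ab_group_add \<Rightarrow> 'v" +
  fixes K :: "'i set" and f :: "'i \<Rightarrow> 'v \<Rightarrow> 'r" and u :: "'i \<Rightarrow> 'v"
  assumes finite_K: "finite K"
    and f_closed: "i \<in> K \<Longrightarrow> f i x \<in> carrier R"
    and f_add: "i \<in> K \<Longrightarrow> f i (x + y) = f i x \<oplus>\<^bsub>R\<^esub> f i y"
    and f_act: "\<lbrakk>i \<in> K; a \<in> carrier R\<rbrakk> \<Longrightarrow> f i (act a x) = a \<otimes>\<^bsub>R\<^esub> f i x"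
    and expansion: "(\<Sum>i\<in>K. act (f i x) (u i)) = x"
begin

definition enum where "enum = (SOME h. bij_betw h {..<card K} K)"

lemma enum: "bij_betw enum {..<card K} K"
  unfolding enum_def using ex_bij_betw_nat_finite[OF finite_K] by (metis atLeast0LessThan someI)

lemma enum_in: "i < card K \<Longrightarrow> enum i \<in> K"
  using enum by (auto simp: bij_betw_def)

abbreviation F where "F \<equiv> free_left_module R (card K)"

definition coord :: "'v \<Rightarrow> nat \<Rightarrow> 'r" where "coord x = (\<lambda>i\<in>{..<card K}. f (enum i) x)"

definition realize :: "(nat \<Rightarrow> 'r) \<Rightarrow> 'v" where "realize y = (\<Sum>i<card K. act (y i) (u (enum i)))"

lemma realize_coord [simp]: "realize (coord x) = x"
  unfolding realize_def coord_def using expansion[of x] sum.reindex_bij_betw[OF enum, of "\<lambda>i. act (f i x) (u i)"]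
  by simp

lemma coord_closed [simp]: "coord x \<in> carrier F"
  by (auto simp: coord_def free_left_module_def f_closed enum_in)

lemma coord_add: "coord (x + y) = coord x \<oplus>\<^bsub>F\<^esub> coord y"
  by (auto simp: coord_def free_left_module_def f_add enum_in)

lemma coord_act: "a \<in> carrier R \<Longrightarrow> coord (act a x) = a \<odot>\<^bsub>F\<^esub> coord x"
  by (auto simp: coord_def free_left_module_def f_act enum_in)

lemma coord_inj: "coord x = coord y \<longleftrightarrow> x = y"
  by (metis realize_coord)

lemma realize_add:
  "\<lbrakk>x \<in> carrier F; y \<in> carrier F\<rbrakk> \<Longrightarrow> realize (x \<oplus>\<^bsub>F\<^esub> y) = realize x + realize y"
  by (auto simp: realize_def free_left_module_def PiE_iff act_add_left simp flip: sum.distrib intro!: sum.cong)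

lemma realize_act: "\<lbrakk>a \<in> carrier R; y \<in> carrier F\<rbrakk> \<Longrightarrow> realize (a \<odot>\<^bsub>F\<^esub> y) = act a (realize y)"
  by (auto simp: realize_def free_left_module_def PiE_iff act_sum act_mult intro!: sum.cong)

lemma coord_zero: "coord 0 = \<zero>\<^bsub>F\<^esub>"
proof -
  interpret F: left_module R F by (rule left_module_free[OF ring_axioms])
  show ?thesis using F.M.add.r_cancel_one[of "coord 0" "coord 0"] by (simp flip: coord_add)
qed

text \<open>The fixed points of \<open>p\<close> are transported along \<open>coord\<close>, because
  a resolution has to consist of modules whose elements have type
  \<open>nat \<Rightarrow> 'r\<close>.\<close>

definition image_module :: "('v \<Rightarrow> 'v) \<Rightarrow> ('r, nat \<Rightarrow> 'r) module" where
  "image_module p = F\<lparr>carrier := coord ` {x. p x = x}\<rparr>"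

lemma submodule_F:
  assumes "S \<subseteq> carrier F" "\<zero>\<^bsub>F\<^esub> \<in> S" "\<And>x y. \<lbrakk>x \<in> S; y \<in> S\<rbrakk> \<Longrightarrow> x \<oplus>\<^bsub>F\<^esub> y \<in> S"
    "\<And>a x. \<lbrakk>a \<in> carrier R; x \<in> S\<rbrakk> \<Longrightarrow> a \<odot>\<^bsub>F\<^esub> x \<in> S"
  shows "submodule S R F"
proof -
  interpret F: left_module R F by (rule left_module_free[OF ring_axioms])
  have neg: "\<ominus>\<^bsub>F\<^esub> x \<in> S" if "x \<in> S" for x
  proof -
    have x: "x \<in> carrier F" using that assms(1) by auto
    have "(\<ominus>\<^bsub>R\<^esub> \<one>\<^bsub>R\<^esub>) \<odot>\<^bsub>F\<^esub> x \<oplus>\<^bsub>F\<^esub> x = (\<ominus>\<^bsub>R\<^esub> \<one>\<^bsub>R\<^esub> \<oplus>\<^bsub>R\<^esub> \<one>\<^bsub>R\<^esub>) \<odot>\<^bsub>F\<^esub> x"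
      using x by (simp add: F.smult_l_distr F.smult_one)
    also have "\<dots> = \<zero>\<^bsub>F\<^esub>"
      using x by (auto simp: l_neg free_left_module_def PiE_iff)
    finally have "\<ominus>\<^bsub>F\<^esub> x = (\<ominus>\<^bsub>R\<^esub> \<one>\<^bsub>R\<^esub>) \<odot>\<^bsub>F\<^esub> x"
      using x F.smult_closed by (intro F.M.minus_equality) auto
    then show ?thesis using assms(4)[of "\<ominus>\<^bsub>R\<^esub> \<one>\<^bsub>R\<^esub>" x] that by simp
  qed
  show ?thesis
  proof (intro submodule.intro submodule_axioms.intro)
    show "subgroup S (add_monoid F)"
      by unfold_locales (use assms neg in \<open>auto simp: a_inv_def\<close>)
  qed (use assms in auto)
qed

lemma submodule_image:
  assumes "equivariant p"
  shows "submodule (coord ` {x. p x = x}) R F"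
proof (rule submodule_F)
  show "\<zero>\<^bsub>F\<^esub> \<in> coord ` {x. p x = x}"
    using equivariantD(3)[OF assms] by (auto simp flip: coord_zero)
qed (auto simp: equivariantD[OF assms] simp flip: coord_add coord_act)

lemma submodule_kernel:
  assumes "equivariant p"
  shows "submodule {y \<in> carrier F. p (realize y) = 0} R F"
proof -
  interpret F: left_module R F by (rule left_module_free[OF ring_axioms])
  show ?thesis
    by (rule submodule_F)
      (auto simp: equivariantD[OF assms] realize_add realize_act act_zero F.smult_closed simp flip: coord_zero)
qed

lemma image_module_simps:
  "carrier (image_module p) = coord ` {x. p x = x}"
  "\<zero>\<^bsub>image_module p\<^esub> = \<zero>\<^bsub>F\<^esub>"
  "x \<oplus>\<^bsub>image_module p\<^esub> y = x \<oplus>\<^bsub>F\<^esub> y"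
  "a \<odot>\<^bsub>image_module p\<^esub> x = a \<odot>\<^bsub>F\<^esub> x"
  by (simp_all add: image_module_def)

text \<open>\<open>coord \<circ> p \<circ> realize\<close> is an idempotent endomorphism of
  \<open>F\<close>, and the free module is the direct sum of its image and its kernel.\<close>

lemma fg_projective_image:
  assumes "equivariant p" "\<And>x. p (p x) = p x"
  shows "fg_projective R (image_module p)"
proof -
  interpret F: left_module R F by (rule left_module_free[OF ring_axioms])
  let ?S = "coord ` {x. p x = x}" and ?T = "{y \<in> carrier F. p (realize y) = 0}"
  have "y \<in> ?S <+>\<^bsub>F\<^esub> ?T" if y: "y \<in> carrier F" for y
  proof -
    let ?s = "coord (p (realize y))"
    have "realize (y \<ominus>\<^bsub>F\<^esub> ?s) + realize ?s = realize y"
      using y by (subst realize_add[symmetric]) (auto simp: a_minus_def F.M.a_assoc F.M.l_neg)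
    then have "p (realize (y \<ominus>\<^bsub>F\<^esub> ?s)) + p (realize ?s) = p (realize y)"
      by (metis equivariantD(1)[OF assms(1)])
    then have "y \<ominus>\<^bsub>F\<^esub> ?s \<in> ?T" using y by (simp add: assms(2))
    moreover have "y = ?s \<oplus>\<^bsub>F\<^esub> (y \<ominus>\<^bsub>F\<^esub> ?s)"
      using y F.M.a_lcomm[of ?s y "\<ominus>\<^bsub>F\<^esub> ?s"] by (simp add: a_minus_def F.M.r_neg)
    moreover have "?s \<in> ?S" using assms(2) by auto
    ultimately show ?thesis unfolding set_add_def' by blast
  qed
  then have "?S <+>\<^bsub>F\<^esub> ?T = carrier F" by (auto simp: set_add_def')
  moreover have "?S \<inter> ?T = {\<zero>\<^bsub>F\<^esub>}"
    using equivariantD(3)[OF assms(1)] by (auto simp flip: coord_zero)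
  moreover have "(\<lambda>x. x) \<in> left_module_hom R (image_module p) F"
    by (auto simp: left_module_hom_def image_module_simps)
  moreover have "bij_betw (\<lambda>x. x) (carrier (image_module p)) ?S"
    by (simp add: image_module_simps bij_betw_def)
  moreover have "left_module R (image_module p)"
    unfolding image_module_def by (intro left_module_submodule F.left_module_axioms submodule_image assms)
  ultimately show ?thesis
    unfolding fg_projective_def using submodule_image[OF assms(1)] submodule_kernel[OF assms(1)] by blast
qed

text \<open>Degree i of the resolution is the fixed module of the idempotent \<open>p i\<close>.
  Exactness is thereby reduced to statements about fixed points inside the one type
  \<open>'v\<close>.\<close>

lemma has_finite_fgp_resolution:
  fixes p \<delta> :: "nat \<Rightarrow> 'v \<Rightarrow> 'v" and e :: "'v \<Rightarrow> 'm" and M :: "('r, 'm, 'n) module_scheme"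
  assumes p: "\<And>i. equivariant (p i)" "\<And>i x. p i (p i x) = p i x"
    and bounded: "\<And>i x. i > N \<Longrightarrow> p i x = 0"
    and \<delta>: "\<And>i. equivariant (\<delta> i)"
    and e: "\<And>x. p 0 x = x \<Longrightarrow> e x \<in> carrier M"
      "\<And>x y. \<lbrakk>p 0 x = x; p 0 y = y\<rbrakk> \<Longrightarrow> e (x + y) = e x \<oplus>\<^bsub>M\<^esub> e y"
      "\<And>a x. \<lbrakk>a \<in> carrier R; p 0 x = x\<rbrakk> \<Longrightarrow> e (act a x) = a \<odot>\<^bsub>M\<^esub> e x"
    and exact_M: "\<And>m. m \<in> carrier M \<Longrightarrow> \<exists>x. p 0 x = x \<and> e x = m"
    and exact_0: "\<delta> 0 ` {x. p 1 x = x} = {x. p 0 x = x \<and> e x = \<zero>\<^bsub>M\<^esub>}"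
    and exact: "\<And>i. \<delta> (Suc i) ` {x. p (Suc (Suc i)) x = x} = {x. p (Suc i) x = x \<and> \<delta> i x = 0}"
  shows "has_finite_fgp_resolution R M"
proof -
  let ?P = "\<lambda>i. image_module (p i)" and ?d = "\<lambda>i y. coord (\<delta> i (realize y))" and ?e = "\<lambda>y. e (realize y)"
  \<comment> \<open>That \<open>\<delta> i\<close> maps fixed points to fixed points can be read off
    from exactness, whose right-hand sides consist of fixed points.\<close>
  have P: "p i (\<delta> i x) = \<delta> i x" if "p (Suc i) x = x" for i x
  proof (cases i)
    case 0
    then have "\<delta> i x \<in> \<delta> 0 ` {x. p 1 x = x}" using that by auto
    then show ?thesis unfolding exact_0 using 0 by simp
  next
    case (Suc j)
    then have "\<delta> i x \<in> \<delta> (Suc j) ` {x. p (Suc (Suc j)) x = x}" using that by auto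
    then show ?thesis unfolding exact using Suc by simp
  qed
  have 1: "?e \<in> left_module_hom R (?P 0) M"
    by (auto simp: left_module_hom_def image_module_simps e realize_add realize_act)
  have 2: "?d i \<in> left_module_hom R (?P (Suc i)) (?P i)" for i
    by (auto simp: left_module_hom_def image_module_simps P realize_add realize_act
        equivariantD[OF \<delta>] coord_add coord_act)
  have 3: "?e ` carrier (?P 0) = carrier M"
    using e(1) exact_M by (force simp: image_module_simps image_iff)
  have im: "?d i ` carrier (?P (Suc i)) = coord ` \<delta> i ` {x. p (Suc i) x = x}" for i
    by (simp add: image_module_simps image_image)
  have 4: "?d 0 ` carrier (?P 1) = {x \<in> carrier (?P 0). ?e x = \<zero>\<^bsub>M\<^esub>}"
    unfolding One_nat_def im using exact_0 by (auto simp: image_module_simps)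
  have 5: "?d (Suc i) ` carrier (?P (Suc (Suc i))) = {x \<in> carrier (?P (Suc i)). ?d i x = \<zero>\<^bsub>?P i\<^esub>}" for i
    unfolding im exact by (auto simp: image_module_simps coord_inj simp flip: coord_zero)
  have 6: "carrier (?P i) = {\<zero>\<^bsub>?P i\<^esub>}" if "i > N" for i
    using bounded[OF that] by (auto simp: image_module_simps coord_zero)
  show ?thesis
    unfolding has_finite_fgp_resolution_def
    by (rule exI[of _ ?P], rule exI[of _ ?d], rule exI[of _ ?e])
      (intro conjI allI exI[of _ N] impI fg_projective_image[OF p] 1 2 3 4 5 6)
qed

end

section \<open>Twisted group algebras\<close>

text \<open>A monomial linear map: basis elements go to multiples of basis elements. The passage
  from words to the model, the Koszul retractions and the multiplication map are all of this
  kind.\<close>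

definition weighted_push :: "('g \<Rightarrow> 'h) \<Rightarrow> ('g \<Rightarrow> complex) \<Rightarrow> ('g \<Rightarrow>\<^sub>0 complex) \<Rightarrow> ('h \<Rightarrow>\<^sub>0 complex)" where
  "weighted_push h c f = (\<Sum>k\<in>Poly_Mapping.keys f. Poly_Mapping.single (h k) (c k * Poly_Mapping.lookup f k))"

lemma weighted_push_simps [simp]:
  "weighted_push h c 0 = 0"
  "weighted_push h c (Poly_Mapping.single k d) = Poly_Mapping.single (h k) (c k * d)"
  "weighted_push h c (f + g) = weighted_push h c f + weighted_push h c g"
proof -
  show "weighted_push h c (f + g) = weighted_push h c f + weighted_push h c g"
    unfolding weighted_push_def
    by (rule setsum_keys_plus_distrib) (auto simp: distrib_left single_add)
qed (simp_all add: weighted_push_def)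

lemma additive_push: "additive (weighted_push h c)" "additive (push_forward h)"
  by (simp_all add: additive_def)

lemmas weighted_push_diff [simp] = additive.diff[OF additive_push(1)]
lemmas weighted_push_minus [simp] = additive.minus[OF additive_push(1)]
lemmas push_forward_diff [simp] = additive.diff[OF additive_push(2)]
lemmas push_forward_minus [simp] = additive.minus[OF additive_push(2)]
lemmas push_forward_sum = additive.sum[OF additive_push(2)]

lemma push_forward_comp: "push_forward h (push_forward k f) = push_forward (h \<circ> k) f"
  by (induction f rule: free_induct) auto

lemma push_forward_id: "push_forward (\<lambda>x. x) f = f"
  by (induction f rule: free_induct) auto

text \<open>The product of a twisted group algebra, with e_a e_b = w(a, b) e_(a+b).\<close>

definition tmult :: "('g::ab_group_add \<Rightarrow> 'g \<Rightarrow> complex) \<Rightarrow> ('g \<Rightarrow>\<^sub>0 complex) \<Rightarrow> ('g \<Rightarrow>\<^sub>0 complex) \<Rightarrow> ('g \<Rightarrow>\<^sub>0 complex)" where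
  "tmult w f g = (\<Sum>a\<in>Poly_Mapping.keys f. \<Sum>b\<in>Poly_Mapping.keys g.
     Poly_Mapping.single (a + b) (w a b * Poly_Mapping.lookup f a * Poly_Mapping.lookup g b))"

lemma tmult_single [simp]:
  "tmult w (Poly_Mapping.single a c) (Poly_Mapping.single b d) = Poly_Mapping.single (a + b) (w a b * c * d)"
  by (simp add: tmult_def)

lemma tmult_add:
  "tmult w (f + g) h = tmult w f h + tmult w g h" "tmult w h (f + g) = tmult w h f + tmult w h g"
proof -
  show "tmult w (f + g) h = tmult w f h + tmult w g h"
    unfolding tmult_def
    by (rule setsum_keys_plus_distrib[where f = "\<lambda>a x. \<Sum>b\<in>Poly_Mapping.keys h. Poly_Mapping.single (a + b) (w a b * x * Poly_Mapping.lookup h b)"])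
       (auto simp: single_add sum.distrib distrib_right distrib_left)
  show "tmult w h (f + g) = tmult w h f + tmult w h g"
    unfolding tmult_def sum.distrib [symmetric]
    by (rule sum.cong[OF refl], rule setsum_keys_plus_distrib[where f = "\<lambda>b x. Poly_Mapping.single (a + b) (w a b * Poly_Mapping.lookup h a * x)" for a])
       (auto simp: single_add sum.distrib distrib_left)
qed

lemma additive_tmult: "additive (tmult w f)" "additive (\<lambda>f. tmult w f g)"
  by (simp_all add: additive_def tmult_add)

lemmas tmult_zero [simp] = additive.zero[OF additive_tmult(1)] additive.zero[OF additive_tmult(2)]
lemmas tmult_minus = additive.minus[OF additive_tmult(1)] additive.minus[OF additive_tmult(2)]
lemmas tmult_diff = additive.diff[OF additive_tmult(1)] additive.diff[OF additive_tmult(2)]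
lemmas tmult_sum = additive.sum[OF additive_tmult(1)] additive.sum[OF additive_tmult(2)]
lemmas tmult_distribs = tmult_add tmult_minus tmult_diff

lemma push_forward_tmult:
  assumes "\<And>a b. h (a + b) = h a + h b" "\<And>a b. w' (h a) (h b) = w a b"
  shows "push_forward h (tmult w f g) = tmult w' (push_forward h f) (push_forward h g)"
proof (induction f rule: free_induct)
  case (single a c)
  show ?case by (induction g rule: free_induct) (simp_all add: assms tmult_add)
qed (simp_all add: tmult_add)

lemma push_forward_tmult_anti:
  assumes "\<And>a b. h (a + b) = h a + h b" "\<And>a b. w' (h b) (h a) = w a b"
  shows "push_forward h (tmult w f g) = tmult w' (push_forward h g) (push_forward h f)"
proof (induction f rule: free_induct)
  case (single a c)
  show ?case by (induction g rule: free_induct) (simp_all add: assms tmult_add ac_simps)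
qed (simp_all add: tmult_add)

text \<open>Every bicharacter is a 2-cocycle, hence gives an associative product. It also satisfies
  w(-a, -b) = w(a, b), hence inversion of the group extends to an automorphism of the twisted
  algebra.\<close>

locale bicharacter =
  fixes w :: "'g::ab_group_add \<Rightarrow> 'g \<Rightarrow> complex"
  assumes w_add_left: "w (a + b) c = w a c * w b c"
    and w_add_right: "w a (b + c) = w a b * w a c"
    and w_nonzero: "w a b \<noteq> 0"
begin

lemma w_zero [simp]: "w 0 a = 1" "w a 0 = 1"
  using w_add_left[of 0 0 a] w_add_right[of a 0 0] w_nonzero[of 0 a] w_nonzero[of a 0] by auto

lemma w_minus: "w (- a) b = inverse (w a b)" "w a (- b) = inverse (w a b)"
proof -
  show "w (- a) b = inverse (w a b)"
    using w_add_left[of "- a" a b] w_nonzero[of a b] by (simp add: field_simps)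
  show "w a (- b) = inverse (w a b)"
    using w_add_right[of a "- b" b] w_nonzero[of a b] by (simp add: field_simps)
qed

lemma w_minus_minus [simp]: "w (- a) (- b) = w a b"
  by (simp add: w_minus)

lemma tmult_assoc: "tmult w (tmult w f g) h = tmult w f (tmult w g h)"
proof (induction f rule: free_induct)
  case (single a c)
  show ?case
  proof (induction g rule: free_induct)
    case (single b d)
    show ?case
      by (induction h rule: free_induct) (simp_all add: tmult_add add.assoc w_add_left w_add_right mult_ac)
  qed (simp_all add: tmult_add)
qed (simp_all add: tmult_add)

lemma tmult_scalar:
  "tmult w (Poly_Mapping.single 0 c) f = Poly_Mapping.map ((*) c) f"
  "tmult w f (Poly_Mapping.single 0 c) = Poly_Mapping.map ((*) c) f"
  by (induction f rule: free_induct; simp add: tmult_add scale_single mult.commute[of _ c])+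

lemma tmult_one [simp]: "tmult w (Poly_Mapping.single 0 1) f = f" "tmult w f (Poly_Mapping.single 0 1) = f"
  by (induction f rule: free_induct; simp add: tmult_add del: single_one)+

lemma scale_tmult:
  "tmult w (Poly_Mapping.map ((*) c) f) g = Poly_Mapping.map ((*) c) (tmult w f g)"
  "tmult w f (Poly_Mapping.map ((*) c) g) = Poly_Mapping.map ((*) c) (tmult w f g)"
  by (metis tmult_scalar tmult_assoc)+

lemma flip_tmult: "push_forward uminus (tmult w f g) = tmult w (push_forward uminus f) (push_forward uminus g)"
  by (rule push_forward_tmult) auto

text \<open>The condition on \<open>v\<close>, \<open>u\<close> says that the extension of the fixed algebra of \<open>\<tau>\<close> by the twisted
  algebra is Galois; the functionals \<open>x \<mapsto> x v\<^sub>i + \<tau> (x v\<^sub>i)\<close> are then dual to the generators \<open>u\<^sub>i\<close>.\<close>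

lemma trace_expansion:
  assumes "\<And>x y. \<tau> (tmult w x y) = tmult w (\<tau> x) (\<tau> y)"
    and "(\<Sum>i\<in>I. tmult w (v i) (u i)) = Poly_Mapping.single 0 1"
    and "(\<Sum>i\<in>I. tmult w (\<tau> (v i)) (u i)) = 0"
  shows "(\<Sum>i\<in>I. tmult w (tmult w x (v i) + \<tau> (tmult w x (v i))) (u i)) = x"
proof -
  have "(\<Sum>i\<in>I. tmult w (tmult w x (v i) + \<tau> (tmult w x (v i))) (u i)) =
      tmult w x (\<Sum>i\<in>I. tmult w (v i) (u i)) + tmult w (\<tau> x) (\<Sum>i\<in>I. tmult w (\<tau> (v i)) (u i))"
    by (simp add: assms(1) tmult_add tmult_assoc tmult_sum sum.distrib)
  then show ?thesis unfolding assms(2,3) by (simp del: single_one)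
qed

end

lemma scale_one [simp]: "Poly_Mapping.map ((*) (1::complex)) f = f"
  by (rule poly_mapping_eqI) (simp add: lookup_scale)

lemma scale_scale: "Poly_Mapping.map ((*) (c::complex)) (Poly_Mapping.map ((*) d) f) = Poly_Mapping.map ((*) (c * d)) f"
  by (rule poly_mapping_eqI) (simp add: lookup_scale)

lemma push_forward_scale: "push_forward h (Poly_Mapping.map ((*) c) f) = Poly_Mapping.map ((*) c) (push_forward h f)"
  by (induction f rule: free_induct) (auto simp: scale_single)

lemma weighted_push_scale: "weighted_push h d (Poly_Mapping.map ((*) c) f) = Poly_Mapping.map ((*) c) (weighted_push h d f)"
  by (induction f rule: free_induct) (simp_all add: scale_single mult.left_commute)

lemma scale_half_double: "Poly_Mapping.map ((*) (1/2::complex)) (f + f) = f"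
  by (rule poly_mapping_eqI) (simp add: lookup_scale lookup_add)

section \<open>The noncommutative torus as a twisted group algebra\<close>

text \<open>The basis element of degree \<open>(i, j)\<close> stands for \<open>U\<^sup>i V\<^sup>j\<close>, and \<open>V\<^sup>j U\<^sup>k = \<lambda>\<^sup>-\<^sup>j\<^sup>k U\<^sup>k V\<^sup>j\<close>.\<close>

definition torus_weight :: "complex \<Rightarrow> int \<times> int \<Rightarrow> int \<times> int \<Rightarrow> complex" where
  "torus_weight l p q = l powi (- (snd p * fst q))"

lemma bicharacter_torus_weight: "l \<noteq> 0 \<Longrightarrow> bicharacter (torus_weight l)"
  by unfold_locales (simp_all add: torus_weight_def algebra_simps flip: power_int_add)

definition lam :: "real \<Rightarrow> complex" where "lam \<theta> = exp (2 * of_real pi * \<i> * of_real \<theta>)"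

lemma lam_nonzero [simp]: "lam \<theta> \<noteq> 0"
  by (simp add: lam_def)

definition tw :: "real \<Rightarrow> int \<times> int \<Rightarrow> int \<times> int \<Rightarrow> complex" where "tw \<theta> = torus_weight (lam \<theta>)"

lemma tw_eq: "tw \<theta> p q = lam \<theta> powi (- (snd p * fst q))"
  by (simp add: tw_def torus_weight_def)

interpretation torus: bicharacter "tw \<theta>" for \<theta>
  unfolding tw_def by (rule bicharacter_torus_weight) simp

section \<open>Words, their degrees and the homomorphism to the model\<close>

fun letter_degree :: "letter \<Rightarrow> int \<times> int" where
  "letter_degree Gen_U = (1, 0)"
| "letter_degree Adj_U = (-1, 0)"
| "letter_degree Gen_V = (0, 1)"
| "letter_degree Adj_V = (0, -1)"

primrec word_degree :: "letter list \<Rightarrow> int \<times> int" where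
  "word_degree [] = 0"
| "word_degree (x # v) = letter_degree x + word_degree v"

text \<open>The scalar c for which the word equals c U^i V^j in the torus, (i, j) being its degree;
  \<open>reduces_word\<close> confirms this.\<close>

primrec word_coeff :: "real \<Rightarrow> letter list \<Rightarrow> complex" where
  "word_coeff \<theta> [] = 1"
| "word_coeff \<theta> (x # v) = tw \<theta> (letter_degree x) (word_degree v) * word_coeff \<theta> v"

lemma word_degree_append [simp]: "word_degree (v @ v') = word_degree v + word_degree v'"
  by (induction v) (auto simp: add.assoc)

lemma word_coeff_append:
  "word_coeff \<theta> (v @ v') = word_coeff \<theta> v * word_coeff \<theta> v' * tw \<theta> (word_degree v) (word_degree v')"
  by (induction v) (simp_all add: torus.w_add_left torus.w_add_right mult_ac)

definition model_hom :: "real \<Rightarrow> (letter list \<Rightarrow>\<^sub>0 complex) \<Rightarrow> (int \<times> int \<Rightarrow>\<^sub>0 complex)" where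
  "model_hom \<theta> = weighted_push word_degree (word_coeff \<theta>)"

lemma model_hom_simps [simp]:
  "model_hom \<theta> (Poly_Mapping.single v c) = Poly_Mapping.single (word_degree v) (word_coeff \<theta> v * c)"
  "model_hom \<theta> 0 = 0"
  "model_hom \<theta> (f + g) = model_hom \<theta> f + model_hom \<theta> g"
  "model_hom \<theta> (f - g) = model_hom \<theta> f - model_hom \<theta> g"
  "model_hom \<theta> (- f) = - model_hom \<theta> f"
  "model_hom \<theta> (Poly_Mapping.map ((*) c) f) = Poly_Mapping.map ((*) c) (model_hom \<theta> f)"
  by (simp_all add: model_hom_def weighted_push_scale)

lemma model_hom_mult:
  "model_hom \<theta> (f \<otimes>\<^bsub>free_star_algebra\<^esub> g) = tmult (tw \<theta>) (model_hom \<theta> f) (model_hom \<theta> g)"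
proof (induction f rule: free_induct)
  case (single v c)
  show ?case
    by (induction g rule: free_induct)
      (simp_all add: free_mult_single tmult_add word_coeff_append mult_ac)
qed (simp_all add: free_mult_single tmult_add)

lemma word_degree_flip [simp]: "word_degree (map adj v) = - word_degree v"
proof (induction v)
  case (Cons x v)
  then show ?case by (cases x) auto
qed (simp add: zero_prod_def)

text \<open>All degrees change sign, and a bicharacter takes the same value at (-a, -b) as at (a,
  b). This is why the flip becomes p \<mapsto> -p in the model without any scalar.\<close>

lemma word_coeff_flip [simp]: "word_coeff \<theta> (map adj v) = word_coeff \<theta> v"
proof (induction v)
  case (Cons x v)
  have "letter_degree (adj x) = - letter_degree x" by (cases x) auto
  with Cons show ?case by simp
qed simp

lemma model_hom_flip: "model_hom \<theta> (letter_flip f) = push_forward uminus (model_hom \<theta> f)"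
  by (induction f rule: free_induct) auto

lemma lam_cnj: "lam \<theta> * cnj (lam \<theta>) = 1"
  by (simp add: lam_def flip: complex_norm_square)

lemma model_hom_torus_ideal:
  assumes "f \<in> torus_ideal \<theta>"
  shows "model_hom \<theta> f = 0"
proof -
  let ?F = free_star_algebra
  \<comment> \<open>The model carries no involution, so its kernel is not visibly closed under the
    star. Asking that f and its adjoint both vanish builds this closure in, and \<open>J\<close>
    then competes in the intersection that defines \<open>star_ideal\<close>.\<close>
  define J where "J = {f. model_hom \<theta> f = 0 \<and> model_hom \<theta> (star ?F f) = 0}"
  have "ideal J ?F"
  proof (rule idealI)
    show "ring ?F" by (rule free.ring_axioms)
    have inv: "\<ominus>\<^bsub>?F\<^esub> x = - x" for x using free_minus[of 0 x]
      by (simp add: a_minus_def free_star_algebra_simps)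
    have "star ?F (- x) = - star ?F x" for x
      using free_star_single(2,3) by (metis add_eq_0_iff)
    then have neg: "inv\<^bsub>add_monoid ?F\<^esub> x \<in> J" if "x \<in> J" for x
      using that by (simp add: J_def inv flip: a_inv_def)
    show "subgroup J (add_monoid ?F)"
      by unfold_locales (use neg in \<open>auto simp: J_def free_star_algebra_simps(1,4,5) free_star_single\<close>)
  qed (auto simp: J_def model_hom_mult free.star_mult free_star_algebra_simps(1))
  moreover have "\<forall>x\<in>J. star ?F x \<in> J"
    by (auto simp: J_def free.star_star free_star_algebra_simps(1))
  moreover have "torus_relations \<theta> \<subseteq> J"
  proof -
    have star_diff: "star ?F (f - g) = star ?F f - star ?F g" for f g
      using free_star_single(2)[of "f - g" g] by simp
    have "inverse (lam \<theta>) = cnj (lam \<theta>)"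
      using lam_cnj[of \<theta>] by (metis inverse_unique)
    then show ?thesis
      by (auto simp: torus_relations_def J_def star_diff free_star_single(1) tw_eq lam_def[symmetric]
          power_int_minus zero_prod_def lam_cnj lam_cnj[unfolded mult.commute[of "lam _"]])
  qed
  ultimately have "torus_ideal \<theta> \<subseteq> J"
    unfolding torus_ideal_def star_ideal_def by blast
  then show ?thesis using assms by (auto simp: J_def)
qed

section \<open>Normal forms of words modulo the torus relations\<close>

definition generator_power :: "letter \<Rightarrow> int \<Rightarrow> letter list" where
  "generator_power x i = (if i \<ge> 0 then replicate (nat i) x else replicate (nat (- i)) (adj x))"

definition normal_word :: "int \<times> int \<Rightarrow> letter list" where
  "normal_word p = generator_power Gen_U (fst p) @ generator_power Gen_V (snd p)"

text \<open>The congruence v = c v' modulo the torus ideal. It is equality up to a scalar,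
  reversible for nonzero c, and not an oriented rewriting step: uniqueness of normal forms will come
  from \<open>model_hom\<close>, not from confluence.\<close>

definition reduces :: "real \<Rightarrow> letter list \<Rightarrow> complex \<Rightarrow> letter list \<Rightarrow> bool" where
  "reduces \<theta> v c v' \<longleftrightarrow> torus_class \<theta> (word v) = torus_class \<theta> (Poly_Mapping.single v' c)"

lemma reduces_refl: "reduces \<theta> v 1 v"
  by (simp add: reduces_def)

lemma reduces_trans: "reduces \<theta> v c v' \<Longrightarrow> reduces \<theta> v' d v'' \<Longrightarrow> reduces \<theta> v (c * d) v''"
  using torus_class_ops(5)[of \<theta> c "word v'"] torus_class_ops(5)[of \<theta> c "Poly_Mapping.single v'' d"]
  by (simp add: reduces_def scale_single)

lemma reduces_append:
  assumes "reduces \<theta> v c v'"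
  shows "reduces \<theta> (a @ v @ b) c (a @ v' @ b)"
proof -
  have "torus_class \<theta> (word a) \<otimes>\<^bsub>nc_torus \<theta>\<^esub> torus_class \<theta> (word v) \<otimes>\<^bsub>nc_torus \<theta>\<^esub> torus_class \<theta> (word b) =
    torus_class \<theta> (word a) \<otimes>\<^bsub>nc_torus \<theta>\<^esub> torus_class \<theta> (Poly_Mapping.single v' c) \<otimes>\<^bsub>nc_torus \<theta>\<^esub> torus_class \<theta> (word b)"
    using assms by (simp add: reduces_def)
  then show ?thesis by (simp add: reduces_def torus_class_ops free_mult_single)
qed

lemmas reduces_Cons = reduces_append[where b = "[]" and a = "[x]" for x, simplified]
lemmas reduces_prefix = reduces_append[where a = "[]", simplified]

lemma reduces_sym: "reduces \<theta> v c v' \<Longrightarrow> c \<noteq> 0 \<Longrightarrow> reduces \<theta> v' (inverse c) v"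
  using torus_class_ops(5)[of \<theta> "inverse c" "word v"] torus_class_ops(5)[of \<theta> "inverse c" "Poly_Mapping.single v' c"]
  by (simp add: reduces_def scale_single)

lemma reduces_cancel: "reduces \<theta> [x, adj x] 1 []"
  using torus_ideal(3)[of \<theta>]
  by (cases x) (simp_all add: reduces_def torus_class_eq_iff torus_relations_def)

lemma reduces_cancel': "reduces \<theta> [adj x, x] 1 []"
  using reduces_cancel[of \<theta> "adj x"] by simp

text \<open>In \<open>z\<^sup>* x = z\<^sup>* x z z\<^sup>*\<close> the third letter is moved to the left across \<open>x\<close> and cancels the first.\<close>

lemma reduces_swap_adj:
  assumes "reduces \<theta> [x, z] c [z, x]"
  shows "reduces \<theta> [adj z, x] c [x, adj z]"
proof -
  have "reduces \<theta> [adj z, x] 1 [adj z, x, z, adj z]"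
    using reduces_sym[OF reduces_append[OF reduces_cancel[of \<theta> z], of "[adj z, x]" "[]"]] by simp
  moreover have "reduces \<theta> [adj z, x, z, adj z] c [adj z, z, x, adj z]"
    using reduces_append[OF assms, of "[adj z]" "[adj z]"] by simp
  moreover have "reduces \<theta> [adj z, z, x, adj z] 1 [x, adj z]"
    using reduces_append[OF reduces_cancel'[of \<theta> z], of "[]" "[x, adj z]"] by simp
  ultimately show ?thesis by (metis reduces_trans mult_1 mult.right_neutral)
qed

text \<open>All four rules come from UV = \<lambda>VU. \<open>reduces_swap_adj\<close> replaces one
  letter at a time by its inverse, and each replacement inverts the scalar.\<close>

lemma reduces_swap:
  assumes "y \<in> {Gen_V, Adj_V}" "x \<in> {Gen_U, Adj_U}"
  shows "reduces \<theta> [y, x] (tw \<theta> (letter_degree y) (letter_degree x)) [x, y]"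
proof -
  let ?l = "lam \<theta>"
  have UV: "reduces \<theta> [Gen_U, Gen_V] ?l [Gen_V, Gen_U]"
    using torus_ideal(3)[of \<theta>] by (simp add: reduces_def torus_class_eq_iff torus_relations_def lam_def)
  have 1: "reduces \<theta> [Gen_V, Gen_U] (inverse ?l) [Gen_U, Gen_V]"
    by (rule reduces_sym[OF UV]) simp
  have 2: "reduces \<theta> [Adj_V, Gen_U] ?l [Gen_U, Adj_V]"
    using reduces_swap_adj[OF UV] by simp
  \<comment> \<open>An auxiliary orientation: its inverse is the third rule, and inverting V in it
    yields the fourth.\<close>
  have 0: "reduces \<theta> [Adj_U, Gen_V] (inverse ?l) [Gen_V, Adj_U]"
    using reduces_swap_adj[OF 1] by simp
  from reduces_sym[OF this] have 3: "reduces \<theta> [Gen_V, Adj_U] ?l [Adj_U, Gen_V]"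
    by simp
  from reduces_swap_adj[OF 0] have 4: "reduces \<theta> [Adj_V, Adj_U] (inverse ?l) [Adj_U, Adj_V]"
    by simp
  show ?thesis
    using assms 1 2 3 4 by (auto simp: tw_eq power_int_minus)
qed

lemma reduces_swap_replicate:
  assumes "reduces \<theta> [y, x] c [x, y]"
  shows "reduces \<theta> (y # replicate n x) (c ^ n) (replicate n x @ [y])"
proof (induction n)
  case (Suc n)
  have "reduces \<theta> (y # x # replicate n x) c (x # y # replicate n x)"
    using reduces_prefix[OF assms, of "replicate n x"] by simp
  from reduces_trans[OF this reduces_Cons[OF Suc, of x]] show ?case by simp
qed (simp add: reduces_refl)

lemma reduces_generator_power:
  "reduces \<theta> (x # generator_power x i) 1 (generator_power x (i + 1))"
  "reduces \<theta> (adj x # generator_power x i) 1 (generator_power x (i - 1))"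
proof -
  have *: "reduces \<theta> (y # adj y # v) 1 v" for y v
    using reduces_prefix[OF reduces_cancel[of \<theta> y], of v] by simp
  show "reduces \<theta> (x # generator_power x i) 1 (generator_power x (i + 1))"
  proof (cases "i \<ge> 0")
    case True
    then have "nat (i + 1) = Suc (nat i)" by simp
    with True show ?thesis by (simp add: generator_power_def reduces_refl)
  next
    case False
    then have "nat (- i) = Suc (nat (- (i + 1)))" by simp
    then have "generator_power x i = adj x # generator_power x (i + 1)"
      using False by (auto simp: generator_power_def)
    then show ?thesis using *[of x] by simp
  qed
  show "reduces \<theta> (adj x # generator_power x i) 1 (generator_power x (i - 1))"
  proof (cases "i > 0")
    case True
    then have "nat i = Suc (nat (i - 1))" by simp
    then have "generator_power x i = x # generator_power x (i - 1)"
      using True by (auto simp: generator_power_def)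
    then show ?thesis using *[of "adj x" "generator_power x (i - 1)"] by simp
  next
    case False
    then have "nat (1 - i) = Suc (nat (- i))" by simp
    with False show ?thesis by (cases "i = 0") (simp_all add: generator_power_def reduces_refl)
  qed
qed

text \<open>A letter U or U* merges with the leading power of U at no cost. A letter V or V* has to
  cross U^i first and collects one weight for every factor that it passes.\<close>

lemma reduces_normal_word:
  "reduces \<theta> (x # normal_word p) (tw \<theta> (letter_degree x) p) (normal_word (letter_degree x + p))"
proof -
  obtain i j where p: "p = (i, j)" by (cases p)
  have V: ?thesis
    if y: "x \<in> {Gen_V, Adj_V}" and r: "reduces \<theta> (x # generator_power Gen_V j) 1 (generator_power Gen_V (j + snd (letter_degree x)))"
  proof -
    define x' n where "x' = (if i \<ge> 0 then Gen_U else Adj_U)" and "n = nat \<bar>i\<bar>"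
    have gp: "generator_power Gen_U i = replicate n x'"
      by (simp add: generator_power_def x'_def n_def)
    \<comment> \<open>The weight depends on \<open>p\<close> only through its U-exponent, which is n
      times that of \<open>x'\<close>.\<close>
    have tw: "tw \<theta> (letter_degree x) p = tw \<theta> (letter_degree x) (letter_degree x') ^ n"
      using y by (auto simp: p tw_eq x'_def n_def power_int_def power_inverse)
    have "reduces \<theta> ([] @ (x # replicate n x') @ generator_power Gen_V j) (tw \<theta> (letter_degree x) p)
        ([] @ (replicate n x' @ [x]) @ generator_power Gen_V j)"
      unfolding tw by (intro reduces_append reduces_swap_replicate reduces_swap) (use y in \<open>auto simp: x'_def\<close>)
    moreover have "reduces \<theta> (replicate n x' @ (x # generator_power Gen_V j) @ []) 1
        (replicate n x' @ generator_power Gen_V (j + snd (letter_degree x)) @ [])"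
      by (intro reduces_append r)
    ultimately have "reduces \<theta> (x # replicate n x' @ generator_power Gen_V j) (tw \<theta> (letter_degree x) p * 1)
        (replicate n x' @ generator_power Gen_V (j + snd (letter_degree x)))"
      by (intro reduces_trans[where v' = "replicate n x' @ [x] @ generator_power Gen_V j"]) auto
    then show ?thesis
      using y by (auto simp: normal_word_def p gp add.commute)
  qed
  have U: ?thesis
    if y: "x \<in> {Gen_U, Adj_U}" and r: "reduces \<theta> (x # generator_power Gen_U i) 1 (generator_power Gen_U (i + fst (letter_degree x)))"
    using reduces_append[OF r, of "[]" "generator_power Gen_V j"] y
    by (auto simp: normal_word_def p tw_eq add.commute)
  show ?thesis
    using U V reduces_generator_power[of \<theta> Gen_U i] reduces_generator_power[of \<theta> Gen_V j]
    by (cases x) auto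
qed

lemma reduces_word: "reduces \<theta> v (word_coeff \<theta> v) (normal_word (word_degree v))"
proof (induction v)
  case Nil
  then show ?case by (simp add: normal_word_def generator_power_def reduces_refl zero_prod_def)
next
  case (Cons x v)
  from reduces_trans[OF reduces_Cons[OF Cons, of x] reduces_normal_word]
  show ?case by (simp add: mult.commute)
qed

lemma torus_class_normal:
  "torus_class \<theta> f = torus_class \<theta> (push_forward normal_word (model_hom \<theta> f))"
proof (induction f rule: free_induct)
  case (single v c)
  have "torus_class \<theta> (Poly_Mapping.single v c) = c \<odot>\<^bsub>nc_torus \<theta>\<^esub> torus_class \<theta> (word v)"
    by (simp add: torus_class_ops scale_single)
  also have "\<dots> = c \<odot>\<^bsub>nc_torus \<theta>\<^esub> torus_class \<theta> (Poly_Mapping.single (normal_word (word_degree v)) (word_coeff \<theta> v))"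
    using reduces_word[of \<theta> v] by (simp add: reduces_def)
  finally show ?case by (simp add: torus_class_ops scale_single mult.commute)
next
  case (add f g)
  have "torus_class \<theta> (f + g) = torus_class \<theta> f \<oplus>\<^bsub>nc_torus \<theta>\<^esub> torus_class \<theta> g"
    by (simp add: torus_class_ops)
  then show ?case using add by (simp add: torus_class_ops)
qed simp

text \<open>The kernel of \<open>model_hom\<close> is exactly the torus ideal. It contains the ideal
  by \<open>model_hom_torus_ideal\<close>; conversely, equal images yield the same combination of
  normal words by \<open>torus_class_normal\<close>.\<close>

lemma torus_class_eq_model: "torus_class \<theta> f = torus_class \<theta> g \<longleftrightarrow> model_hom \<theta> f = model_hom \<theta> g"
  by (metis torus_class_normal model_hom_torus_ideal torus_class_eq_iff model_hom_simps(4) eq_iff_diff_eq_0)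

section \<open>The isomorphism between the torus and its model\<close>

definition torus_model :: "real \<Rightarrow> (letter list \<Rightarrow>\<^sub>0 complex) set \<Rightarrow> (int \<times> int \<Rightarrow>\<^sub>0 complex)" where
  "torus_model \<theta> K = model_hom \<theta> (SOME f. torus_class \<theta> f = K)"

lemma torus_model_class: "torus_model \<theta> (torus_class \<theta> f) = model_hom \<theta> f"
proof -
  have "torus_class \<theta> (SOME g. torus_class \<theta> g = torus_class \<theta> f) = torus_class \<theta> f"
    by (rule someI) simp
  then show ?thesis by (simp add: torus_model_def torus_class_eq_model)
qed

definition of_model :: "real \<Rightarrow> (int \<times> int \<Rightarrow>\<^sub>0 complex) \<Rightarrow> (letter list \<Rightarrow>\<^sub>0 complex) set" where
  "of_model \<theta> x = torus_class \<theta> (push_forward normal_word x)"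

lemma of_model_closed [simp]: "of_model \<theta> x \<in> carrier (nc_torus \<theta>)"
  by (simp add: of_model_def carrier_torus)

lemma of_model_torus_model [simp]: "K \<in> carrier (nc_torus \<theta>) \<Longrightarrow> of_model \<theta> (torus_model \<theta> K) = K"
  using torus_class_normal by (auto simp: carrier_torus of_model_def torus_model_class)

lemma word_degree_replicate: "word_degree (replicate n x) = (int n * fst (letter_degree x), int n * snd (letter_degree x))"
  by (induction n) (auto simp: zero_prod_def algebra_simps plus_prod_def)

lemma word_coeff_replicate: "word_coeff \<theta> (replicate n x) = 1"
  by (induction n) (cases x; simp add: tw_eq word_degree_replicate)+

lemma torus_model_of_model [simp]: "torus_model \<theta> (of_model \<theta> x) = x"
proof -
  have d: "word_degree (normal_word p) = p" for p
    by (cases p) (auto simp: normal_word_def generator_power_def word_degree_replicate)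
  have c: "word_coeff \<theta> (normal_word p) = 1" for p
    by (simp add: normal_word_def generator_power_def word_coeff_append word_coeff_replicate word_degree_replicate
        tw_eq)
  have "model_hom \<theta> (push_forward normal_word x) = x"
    by (induction x rule: free_induct) (simp_all add: d c)
  then show ?thesis by (simp add: of_model_def torus_model_class)
qed

lemma torus_model_inj:
  "\<lbrakk>K \<in> carrier (nc_torus \<theta>); L \<in> carrier (nc_torus \<theta>)\<rbrakk> \<Longrightarrow> torus_model \<theta> K = torus_model \<theta> L \<longleftrightarrow> K = L"
  by (metis of_model_torus_model)

lemma torus_model_simps:
  "torus_model \<theta> \<one>\<^bsub>nc_torus \<theta>\<^esub> = Poly_Mapping.single 0 1"
  "torus_model \<theta> \<zero>\<^bsub>nc_torus \<theta>\<^esub> = 0"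
  "K \<in> carrier (nc_torus \<theta>) \<Longrightarrow> L \<in> carrier (nc_torus \<theta>) \<Longrightarrow>
    torus_model \<theta> (K \<oplus>\<^bsub>nc_torus \<theta>\<^esub> L) = torus_model \<theta> K + torus_model \<theta> L"
  "K \<in> carrier (nc_torus \<theta>) \<Longrightarrow> L \<in> carrier (nc_torus \<theta>) \<Longrightarrow>
    torus_model \<theta> (K \<otimes>\<^bsub>nc_torus \<theta>\<^esub> L) = tmult (tw \<theta>) (torus_model \<theta> K) (torus_model \<theta> L)"
  "K \<in> carrier (nc_torus \<theta>) \<Longrightarrow> torus_model \<theta> (c \<odot>\<^bsub>nc_torus \<theta>\<^esub> K) = Poly_Mapping.map ((*) c) (torus_model \<theta> K)"
  "K \<in> carrier (nc_torus \<theta>) \<Longrightarrow> torus_model \<theta> (torus_flip \<theta> K) = push_forward uminus (torus_model \<theta> K)"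
  by (auto simp: carrier_torus torus_class_ops torus_model_class model_hom_mult torus_flip_class model_hom_flip)

lemma of_model_simps:
  "of_model \<theta> (x + y) = of_model \<theta> x \<oplus>\<^bsub>nc_torus \<theta>\<^esub> of_model \<theta> y"
  "of_model \<theta> (Poly_Mapping.map ((*) c) x) = c \<odot>\<^bsub>nc_torus \<theta>\<^esub> of_model \<theta> x"
  "of_model \<theta> 0 = \<zero>\<^bsub>nc_torus \<theta>\<^esub>"
  by (simp_all add: of_model_def torus_class_ops push_forward_scale)

section \<open>The flip grading\<close>

text \<open>\<lambda>^n is the point of the unit circle with angle 2 \<pi> n \<theta>, and its real
  part is 1 only if n \<theta> is an integer.\<close>

lemma lam_power:
  assumes "\<theta> \<notin> \<rat>" "n \<noteq> 0"
  shows "lam \<theta> powi n \<noteq> 1"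
proof
  assume "lam \<theta> powi n = 1"
  then have "cis (2 * pi * (\<theta> * of_int n)) = 1"
    by (simp add: lam_def exp_power_int cis_conv_exp mult_ac)
  then have "cos (2 * pi * (\<theta> * of_int n)) = 1" by (simp add: complex_eq_iff)
  then obtain m :: int where "2 * pi * (\<theta> * of_int n) = of_int m * 2 * pi"
    using cos_one_2pi_int by blast
  then have "\<theta> = of_int m / of_int n" using assms(2) by (simp add: field_simps)
  then show False using assms(1) by simp
qed

abbreviation flip :: "('g::ab_group_add \<Rightarrow>\<^sub>0 complex) \<Rightarrow> ('g \<Rightarrow>\<^sub>0 complex)" where
  "flip \<equiv> push_forward uminus"

section \<open>Odd elements that generate the unit\<close>

definition antisym :: "complex \<Rightarrow> 'g::ab_group_add \<Rightarrow> ('g \<Rightarrow>\<^sub>0 complex)" where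
  "antisym c p = Poly_Mapping.single p c - Poly_Mapping.single (- p) c"

lemma flip_antisym [simp]: "flip (antisym c p) = - antisym c p"
  by (simp add: antisym_def)

text \<open>For \<open>g = (1, 1)\<close>, \<open>h = (1, -1)\<close>, \<open>s\<^sub>p = e\<^sub>p - e\<^sub>-\<^sub>p\<close> one has
  \<open>\<lambda>\<inverse> s\<^sub>g s\<^sub>h - \<lambda> s\<^sub>h s\<^sub>g = (\<lambda>\<^sup>-\<^sup>2 - \<lambda>\<^sup>2) (U\<^sup>2 + U\<^sup>-\<^sup>2)\<close>, and \<open>s\<^sub>1\<^sub>0\<^sup>2 = U\<^sup>2 + U\<^sup>-\<^sup>2 - 2\<close>:
  this is where \<open>\<lambda>\<^sup>4 \<noteq> 1\<close> enters.\<close>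

definition galois_v :: "real \<Rightarrow> nat \<Rightarrow> (int \<times> int \<Rightarrow>\<^sub>0 complex)" where
  "galois_v \<theta> i = (let l = lam \<theta>; k = 1 / (4 * (inverse l ^ 2 - l ^ 2)) in
     if i = 0 then Poly_Mapping.single 0 (1/2)
     else if i = 1 then antisym (k * inverse l) (1, 1)
     else if i = 2 then antisym (- k * l) (1, -1)
     else antisym (-1/4) (1, 0))"

text \<open>Index 0 is even, the indices 1 to 3 are odd. Indices 1 and 2 carry the degrees (1, 1)
  and (1, -1) in the order opposite to \<open>galois_v\<close>; this produces a twisted commutator
  in which the terms in V^2 and V^-2 cancel.\<close>

definition galois_u :: "nat \<Rightarrow> (int \<times> int \<Rightarrow>\<^sub>0 complex)" where
  "galois_u i =
     (if i = 0 then Poly_Mapping.single 0 1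
      else if i = 1 then antisym 1 (1, -1)
      else if i = 2 then antisym 1 (1, 1)
      else antisym 1 (1, 0))"

lemma flip_galois:
  "i \<noteq> 0 \<Longrightarrow> flip (galois_v \<theta> i) = - galois_v \<theta> i"
  "i \<noteq> 0 \<Longrightarrow> flip (galois_u i) = - galois_u i"
  by (auto simp: galois_v_def galois_u_def Let_def)

text \<open>The constant \<open>k\<close> is chosen so that the twisted commutator from indices 1
  and 2 equals (U^2 + U^-2)/4. Index 3 contributes -(U^2 + U^-2 - 2)/4, and only the scalar 1/2
  survives.\<close>

lemma galois_odd:
  assumes "\<theta> \<notin> \<rat>"
  shows "(\<Sum>i\<in>{1,2,3}. tmult (tw \<theta>) (galois_v \<theta> i) (galois_u i)) = Poly_Mapping.single 0 (1/2)"
proof -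
  define l where "l = lam \<theta>"
  define m where "m = inverse l"
  have m: "l * m = 1" using lam_nonzero[of \<theta>] by (simp add: m_def l_def)
  define k where "k = 1 / (4 * (m ^ 2 - l ^ 2))"
  have "m ^ 2 \<noteq> l ^ 2"
  proof
    assume "m ^ 2 = l ^ 2"
    then have "l ^ 4 = (l * m) ^ 2"
      by (simp add: power_mult_distrib flip: power_add)
    then have "l powi 4 = 1" unfolding m by (simp add: power_int_def)
    then show False using lam_power[OF assms, of 4] by (simp add: l_def)
  qed
  then have k: "k * m ^ 2 - k * l ^ 2 = 1/4"
    by (simp add: k_def divide_simps)
  let ?e = "Poly_Mapping.single :: int \<times> int \<Rightarrow> complex \<Rightarrow> _"
  have tw: "tw \<theta> (1,1) (1,-1) = m" "tw \<theta> (1,1) (-1,1) = l" "tw \<theta> (-1,-1) (1,-1) = l" "tw \<theta> (-1,-1) (-1,1) = m"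
    "tw \<theta> (1,-1) (1,1) = l" "tw \<theta> (1,-1) (-1,-1) = m" "tw \<theta> (-1,1) (1,1) = m" "tw \<theta> (-1,1) (-1,-1) = l"
    "tw \<theta> (1,0) q = 1" "tw \<theta> (-1,0) q = 1" for q
    by (simp_all add: tw_eq m_def l_def power_int_minus)
  have lm: "m * (k * m) = k * m ^ 2" "l * (k * m) = k" "m * (k * l) = k" "l * (k * l) = k * l ^ 2"
    using m by (simp_all add: power2_eq_square mult_ac)
  have v: "galois_v \<theta> 1 = antisym (k * m) (1,1)" "galois_v \<theta> 2 = antisym (- (k * l)) (1,-1)"
    "galois_v \<theta> 3 = antisym (-1/4) (1,0)"
    by (simp_all add: galois_v_def Let_def k_def m_def l_def)
  have u: "galois_u 1 = antisym 1 (1,-1)" "galois_u 2 = antisym 1 (1,1)" "galois_u 3 = antisym 1 (1,0)"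
    by (simp_all add: galois_u_def)
  have 1: "tmult (tw \<theta>) (galois_v \<theta> 1) (galois_u 1) =
      ?e (2,0) (k * m ^ 2) - ?e (0,2) k - ?e (0,-2) k + ?e (-2,0) (k * m ^ 2)"
    unfolding v u by (simp add: antisym_def tmult_distribs tw lm)
  have 2: "tmult (tw \<theta>) (galois_v \<theta> 2) (galois_u 2) =
      - ?e (2,0) (k * l ^ 2) + ?e (0,-2) k + ?e (0,2) k - ?e (-2,0) (k * l ^ 2)"
    unfolding v u by (simp add: antisym_def tmult_distribs tw lm single_uminus)
  have "?e p (1/4) + ?e p (1/4) = ?e p (1/2)" for p
    by (simp flip: single_add)
  then have 3: "tmult (tw \<theta>) (galois_v \<theta> 3) (galois_u 3) = ?e 0 (1/2) - ?e (2,0) (1/4) - ?e (-2,0) (1/4)"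
    unfolding v u by (simp add: antisym_def tmult_distribs tw zero_prod_def single_uminus algebra_simps)
  have 4: "?e p (k * m ^ 2) = ?e p (1/4) + ?e p (k * l ^ 2)" for p
    unfolding k[symmetric] by (simp flip: single_add)
  show ?thesis
    by (simp add: 1[simplified] 2 3 4)
qed

lemma sum_lessThan_4: "(\<Sum>i<4. F i) = F 0 + (\<Sum>i\<in>{1,2,3::nat}. F i)" for F :: "nat \<Rightarrow> 'a::comm_monoid_add"
proof -
  have "{..<4::nat} = insert 0 {1,2,3}" by auto
  then show ?thesis by simp
qed

text \<open>The odd indices sum to 1/2 and change sign under the flip, while index 0 contributes 1/2
  both times.\<close>

lemma galois:
  assumes "\<theta> \<notin> \<rat>"
  shows "(\<Sum>i<4. tmult (tw \<theta>) (galois_v \<theta> i) (galois_u i)) = Poly_Mapping.single 0 1"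
    and "(\<Sum>i<4. tmult (tw \<theta>) (flip (galois_v \<theta> i)) (galois_u i)) = 0"
proof -
  have 0: "galois_v \<theta> 0 = Poly_Mapping.single 0 (1/2)" "galois_u 0 = Poly_Mapping.single 0 1"
    by (simp_all add: galois_v_def galois_u_def)
  have "(\<Sum>i\<in>{1,2,3}. tmult (tw \<theta>) (flip (galois_v \<theta> i)) (galois_u i)) =
      - (\<Sum>i\<in>{1,2,3}. tmult (tw \<theta>) (galois_v \<theta> i) (galois_u i))"
    unfolding sum_negf[symmetric] by (rule sum.cong) (auto simp: flip_galois tmult_minus)
  then show "(\<Sum>i<4. tmult (tw \<theta>) (flip (galois_v \<theta> i)) (galois_u i)) = 0"
    unfolding sum_lessThan_4 galois_odd[OF assms] by (simp add: 0 del: single_one)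
  show "(\<Sum>i<4. tmult (tw \<theta>) (galois_v \<theta> i) (galois_u i)) = Poly_Mapping.single 0 1"
    unfolding sum_lessThan_4 galois_odd[OF assms] by (simp add: 0 flip: single_add del: single_one)
qed

section \<open>The homogeneous parts and the strong grading\<close>

lemma torus_part_model:
  "x \<in> torus_part \<theta> k \<longleftrightarrow> x \<in> carrier (nc_torus \<theta>) \<and>
    flip (torus_model \<theta> x) = (if k = 0 then torus_model \<theta> x else - torus_model \<theta> x)"
proof (cases "x \<in> carrier (nc_torus \<theta>)")
  case True
  interpret T: complex_star_algebra "nc_torus \<theta>" by (rule complex_star_algebra_torus)
  have "torus_model \<theta> (\<ominus>\<^bsub>nc_torus \<theta>\<^esub> x) = - torus_model \<theta> x"
    using torus_model_simps(3)[OF True T.a_inv_closed[OF True]] True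
    by (simp add: T.M.r_neg torus_model_simps add_eq_0_iff2)
  moreover have "torus_flip \<theta> x \<in> carrier (nc_torus \<theta>)"
    using True by (auto simp: carrier_torus torus_flip_class)
  ultimately show ?thesis
    using True by (simp add: torus_part_def torus_model_simps flip: torus_model_inj)
qed (auto simp: torus_part_def)

lemma subgroup_torus_part: "subgroup (torus_part \<theta> k) (add_monoid (nc_torus \<theta>))"
proof -
  interpret T: complex_star_algebra "nc_torus \<theta>" by (rule complex_star_algebra_torus)
  have neg: "torus_model \<theta> (\<ominus>\<^bsub>nc_torus \<theta>\<^esub> x) = - torus_model \<theta> x" if "x \<in> carrier (nc_torus \<theta>)" for x
    using torus_model_simps(3)[OF that T.a_inv_closed[OF that]] that
    by (simp add: T.M.r_neg torus_model_simps add_eq_0_iff2)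
  show ?thesis
    by unfold_locales (auto simp: torus_part_model torus_model_simps neg simp flip: a_inv_def)
qed

lemma torus_decompose:
  assumes "x \<in> carrier (nc_torus \<theta>)"
  obtains a b where "a \<in> torus_part \<theta> 0" "b \<in> torus_part \<theta> 1" "x = a \<oplus>\<^bsub>nc_torus \<theta>\<^esub> b"
proof
  let ?y = "torus_model \<theta> x"
  have ff: "flip (flip z) = z" for z :: "int \<times> int \<Rightarrow>\<^sub>0 complex"
    by (simp add: push_forward_comp o_def push_forward_id)
  show "of_model \<theta> (Poly_Mapping.map ((*) (1/2)) (?y + flip ?y)) \<in> torus_part \<theta> 0"
    by (simp add: torus_part_model push_forward_scale ff add.commute del: map_simps)
  have "flip (Poly_Mapping.map ((*) (1/2)) (?y - flip ?y)) = - Poly_Mapping.map ((*) (1/2)) (?y - flip ?y)"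
    by (simp add: push_forward_scale ff scale_diff)
  then show "of_model \<theta> (Poly_Mapping.map ((*) (1/2)) (?y - flip ?y)) \<in> torus_part \<theta> 1"
    by (simp add: torus_part_model)
  have "Poly_Mapping.map ((*) (1/2)) (?y + flip ?y) + Poly_Mapping.map ((*) (1/2)) (?y - flip ?y) = ?y"
    using scale_half_double[of ?y] unfolding map_simps(2) by (simp add: scale_diff)
  then show "x = of_model \<theta> (Poly_Mapping.map ((*) (1/2)) (?y + flip ?y)) \<oplus>\<^bsub>nc_torus \<theta>\<^esub>
      of_model \<theta> (Poly_Mapping.map ((*) (1/2)) (?y - flip ?y))"
    using assms by (simp flip: of_model_simps(1))
qed

text \<open>The flip turns the sum of the components into their difference; adding the two gives
  twice the even component.\<close>

lemma torus_decompose_unique: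
  assumes "a \<in> torus_part \<theta> 0" "b \<in> torus_part \<theta> 1" "a' \<in> torus_part \<theta> 0" "b' \<in> torus_part \<theta> 1"
    and "a \<oplus>\<^bsub>nc_torus \<theta>\<^esub> b = a' \<oplus>\<^bsub>nc_torus \<theta>\<^esub> b'"
  shows "a = a' \<and> b = b'"
proof -
  note [simp] = assms(1-4)[unfolded torus_part_model, simplified]
  let ?M = "torus_model \<theta>"
  have 1: "?M a + ?M b = ?M a' + ?M b'"
    using arg_cong[OF assms(5), of ?M] by (simp add: torus_model_simps)
  have "flip (?M a + ?M b) = flip (?M a' + ?M b')" using 1 by simp
  then have 2: "?M a - ?M b = ?M a' - ?M b'" by simp
  have "x + x = (x + y) + (x - y)" for x y :: "int \<times> int \<Rightarrow>\<^sub>0 complex"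
    by (simp add: algebra_simps)
  then have "?M a + ?M a = ?M a' + ?M a'"
    using 1 2 by metis
  then have "?M a = ?M a'"
    by (metis scale_half_double)
  with 1 show ?thesis by (simp add: torus_model_inj)
qed

lemma torus_part_mult:
  assumes "x \<in> torus_part \<theta> a" "y \<in> torus_part \<theta> b" "a \<in> {0,1}" "b \<in> {0,1}"
  shows "x \<otimes>\<^bsub>nc_torus \<theta>\<^esub> y \<in> torus_part \<theta> ((a + b) mod 2)"
proof -
  interpret T: complex_star_algebra "nc_torus \<theta>" by (rule complex_star_algebra_torus)
  show ?thesis
    using assms by (auto simp: torus_part_model torus_model_simps torus.flip_tmult tmult_minus)
qed

text \<open>If one degree is 0, the unit serves as the factor of that degree. For two odd degrees, 1
  must be a sum of products of odd elements, which \<open>galois_odd\<close> provides up to a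
  scalar.\<close>

lemma torus_part_generate:
  assumes "\<theta> \<notin> \<rat>" "a \<in> {0,1}" "b \<in> {0,1}"
  shows "generate (add_monoid (nc_torus \<theta>)) {x \<otimes>\<^bsub>nc_torus \<theta>\<^esub> y |x y. x \<in> torus_part \<theta> a \<and> y \<in> torus_part \<theta> b}
    = torus_part \<theta> ((a + b) mod 2)" (is "generate ?T ?S = ?P")
proof
  interpret T: complex_star_algebra "nc_torus \<theta>" by (rule complex_star_algebra_torus)
  have "?S \<subseteq> ?P" using torus_part_mult assms(2,3) by blast
  then show "generate ?T ?S \<subseteq> ?P"
    by (intro T.add.generate_subgroup_incl subgroup_torus_part)
  show "?P \<subseteq> generate ?T ?S"
  proof
    fix x assume x: "x \<in> ?P"
    have one: "\<one>\<^bsub>nc_torus \<theta>\<^esub> \<in> torus_part \<theta> 0"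
      by (simp add: torus_part_model torus_model_simps del: single_one)
    have xc: "x \<in> carrier (nc_torus \<theta>)" using x by (simp add: torus_part_model)
    consider "a = 0" "x \<in> torus_part \<theta> b" | "b = 0" "x \<in> torus_part \<theta> a" | "a = 1" "b = 1" "x \<in> torus_part \<theta> 0"
      using x assms(2,3) by auto
    then show "x \<in> generate ?T ?S"
    proof cases
      case 1
      then have "\<one>\<^bsub>nc_torus \<theta>\<^esub> \<otimes>\<^bsub>nc_torus \<theta>\<^esub> x \<in> ?S" using one by blast
      then show ?thesis using xc generate.incl[of x ?S ?T] by simp
    next
      case 2
      then have "x \<otimes>\<^bsub>nc_torus \<theta>\<^esub> \<one>\<^bsub>nc_torus \<theta>\<^esub> \<in> ?S" using one by blast
      then show ?thesis using xc generate.incl[of x ?S ?T] by simp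
    next
      case 3
      \<comment> \<open>The factor 2 cancels the 1/2 of \<open>galois_odd\<close>. It is placed
        inside one of the odd factors because \<open>generate\<close> yields only an additive
        subgroup.\<close>
      let ?c = "\<lambda>i. x \<otimes>\<^bsub>nc_torus \<theta>\<^esub> of_model \<theta> (Poly_Mapping.map ((*) 2) (galois_v \<theta> i))"
        and ?d = "\<lambda>i. of_model \<theta> (galois_u i)"
      have m2: "Poly_Mapping.map ((*) (2::complex)) (- z) = - Poly_Mapping.map ((*) 2) z" for z :: "int \<times> int \<Rightarrow>\<^sub>0 complex"
        using scale_diff[of 2 0 z] by simp
      have "?c i \<in> torus_part \<theta> 1" "?d i \<in> torus_part \<theta> 1" if "i \<noteq> 0" for i
        using 3(3) that
        by (auto simp: torus_part_model torus_model_simps torus.flip_tmult push_forward_scale flip_galois m2 tmult_minus)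
      then have S: "?c i \<otimes>\<^bsub>nc_torus \<theta>\<^esub> ?d i \<in> ?S" if "i \<noteq> 0" for i
        using 3(1,2) that by blast
      have gen: "?c 1 \<otimes>\<^bsub>nc_torus \<theta>\<^esub> ?d 1 \<oplus>\<^bsub>nc_torus \<theta>\<^esub> (?c 2 \<otimes>\<^bsub>nc_torus \<theta>\<^esub> ?d 2 \<oplus>\<^bsub>nc_torus \<theta>\<^esub> ?c 3 \<otimes>\<^bsub>nc_torus \<theta>\<^esub> ?d 3)
          \<in> generate ?T ?S"
        using generate.eng[of _ ?T ?S] generate.incl[of _ ?S ?T] S[of 1] S[of 2] S[of 3] by simp
      have "tmult (tw \<theta>) (tmult (tw \<theta>) (torus_model \<theta> x) (Poly_Mapping.map ((*) 2) (galois_v \<theta> i))) (galois_u i) =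
          tmult (tw \<theta>) (Poly_Mapping.map ((*) 2) (torus_model \<theta> x)) (tmult (tw \<theta>) (galois_v \<theta> i) (galois_u i))" for i
        by (simp add: torus.tmult_assoc torus.scale_tmult)
      then have "torus_model \<theta> (?c 1 \<otimes>\<^bsub>nc_torus \<theta>\<^esub> ?d 1 \<oplus>\<^bsub>nc_torus \<theta>\<^esub> (?c 2 \<otimes>\<^bsub>nc_torus \<theta>\<^esub> ?d 2 \<oplus>\<^bsub>nc_torus \<theta>\<^esub> ?c 3 \<otimes>\<^bsub>nc_torus \<theta>\<^esub> ?d 3)) =
        tmult (tw \<theta>) (Poly_Mapping.map ((*) 2) (torus_model \<theta> x)) (\<Sum>i\<in>{1,2,3}. tmult (tw \<theta>) (galois_v \<theta> i) (galois_u i))"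
        using xc by (simp add: torus_model_simps tmult_add)
      also have "\<dots> = torus_model \<theta> x"
        unfolding galois_odd[OF assms(1)] torus.tmult_scalar scale_scale by simp
      finally have "?c 1 \<otimes>\<^bsub>nc_torus \<theta>\<^esub> ?d 1 \<oplus>\<^bsub>nc_torus \<theta>\<^esub> (?c 2 \<otimes>\<^bsub>nc_torus \<theta>\<^esub> ?d 2 \<oplus>\<^bsub>nc_torus \<theta>\<^esub> ?c 3 \<otimes>\<^bsub>nc_torus \<theta>\<^esub> ?d 3) = x"
        using xc by (subst (asm) torus_model_inj) auto
      then show ?thesis using gen by simp
    qed
  qed
qed

lemma strongly_graded_torus:
  assumes "\<theta> \<notin> \<rat>"
  shows "strongly_graded_algebra (integer_mod_group 2) (nc_torus \<theta>) (torus_part \<theta>)"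
proof -
  let ?T = "nc_torus \<theta>" and ?Z = "integer_mod_group 2"
  interpret T: complex_star_algebra ?T by (rule complex_star_algebra_torus)
  have Z: "carrier ?Z = {0, 1}" "g \<otimes>\<^bsub>?Z\<^esub> h = (g + h) mod 2" for g h
    by (auto simp: integer_mod_group_def)
  have part: "torus_part \<theta> k \<subseteq> carrier ?T" for k by (auto simp: torus_part_model)
  \<comment> \<open>The direct sum condition ranges over nonzero components; adding the zero ones
    back gives a sum over both degrees.\<close>
  have sum: "(\<Oplus>\<^bsub>?T\<^esub>g\<in>{g \<in> {0, 1}. f g \<noteq> \<zero>\<^bsub>?T\<^esub>}. f g) = f 0 \<oplus>\<^bsub>?T\<^esub> f 1"
    if "f 0 \<in> carrier ?T" "f 1 \<in> carrier ?T" for f :: "int \<Rightarrow> _"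
  proof -
    have "(\<Oplus>\<^bsub>?T\<^esub>g\<in>{g \<in> {0, 1}. f g \<noteq> \<zero>\<^bsub>?T\<^esub>}. f g) = (\<Oplus>\<^bsub>?T\<^esub>g\<in>{0, 1}. f g)"
      using that by (intro T.add.finprod_mono_neutral_cong_left) auto
    then show ?thesis using that by simp
  qed
  show ?thesis
  proof (intro strongly_graded_algebra.intro strongly_graded_algebra_axioms.intro)
    fix g assume "g \<in> carrier ?Z"
    show "submodule (torus_part \<theta> g) complex_field ?T"
      by (intro submodule.intro submodule_axioms.intro subgroup_torus_part)
        (auto simp: torus_part_model torus_model_simps push_forward_scale scale_diff[of _ 0, simplified])
  next
    fix g h assume "g \<in> carrier ?Z" "h \<in> carrier ?Z"
    then show "generate (add_monoid ?T) {x \<otimes>\<^bsub>?T\<^esub> y |x y. x \<in> torus_part \<theta> g \<and> y \<in> torus_part \<theta> h} =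
        torus_part \<theta> (g \<otimes>\<^bsub>?Z\<^esub> h)"
      unfolding Z by (rule torus_part_generate[OF assms])
  next
    fix x assume "x \<in> carrier ?T"
    then obtain a b where ab: "a \<in> torus_part \<theta> 0" "b \<in> torus_part \<theta> 1" "x = a \<oplus>\<^bsub>?T\<^esub> b"
      by (rule torus_decompose)
    show "\<exists>!f. f \<in> (\<Pi>\<^sub>E g\<in>carrier ?Z. torus_part \<theta> g) \<and> finite {g \<in> carrier ?Z. f g \<noteq> \<zero>\<^bsub>?T\<^esub>} \<and>
           x = (\<Oplus>\<^bsub>?T\<^esub>g\<in>{g \<in> carrier ?Z. f g \<noteq> \<zero>\<^bsub>?T\<^esub>}. f g)"
      unfolding Z
    proof (rule ex1I[of _ "\<lambda>g\<in>{0,1}. if g = 0 then a else b"], intro conjI)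
      show "x = (\<Oplus>\<^bsub>?T\<^esub>g\<in>{g \<in> {0, 1}. (\<lambda>g\<in>{0,1::int}. if g = 0 then a else b) g \<noteq> \<zero>\<^bsub>?T\<^esub>}. (\<lambda>g\<in>{0,1}. if g = 0 then a else b) g)"
        using ab part by (subst sum) auto
    next
      fix f assume f: "f \<in> (\<Pi>\<^sub>E g\<in>{0, 1}. torus_part \<theta> g) \<and> finite {g \<in> {0, 1}. f g \<noteq> \<zero>\<^bsub>?T\<^esub>} \<and>
           x = (\<Oplus>\<^bsub>?T\<^esub>g\<in>{g \<in> {0, 1}. f g \<noteq> \<zero>\<^bsub>?T\<^esub>}. f g)"
      then have f': "f 0 \<in> torus_part \<theta> 0" "f 1 \<in> torus_part \<theta> 1" by auto
      then have "x = f 0 \<oplus>\<^bsub>?T\<^esub> f 1" using f part sum[of f] by auto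
      then have "f 0 = a \<and> f 1 = b"
        unfolding ab(3) by (intro torus_decompose_unique[OF f' ab(1,2)]) (rule sym)
      then have "f 0 = a" "f 1 = b" by auto
      moreover have "f \<in> extensional {0,1}" using f by (simp add: PiE_iff)
      ultimately show "f = (\<lambda>g\<in>{0,1}. if g = 0 then a else b)"
        by (intro extensionalityI[of _ "{0,1}"]) auto
    qed (use ab in auto)
  qed (rule group_integer_mod_group, rule T.complex_algebra_axioms)
qed

section \<open>The enveloping algebra of the pillow\<close>

text \<open>The weight of A \<otimes> A^op. The arguments are exchanged in the second coordinate
  because multiplication is reversed there.\<close>

definition env_weight :: "('g \<Rightarrow> 'g \<Rightarrow> complex) \<Rightarrow> 'g \<times> 'g \<Rightarrow> 'g \<times> 'g \<Rightarrow> complex" where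
  "env_weight w a b = w (fst a) (fst b) * w (snd b) (snd a)"

lemma bicharacter_env_weight: "bicharacter w \<Longrightarrow> bicharacter (env_weight w)"
  by (simp add: bicharacter_def env_weight_def)

abbreviation ew :: "real \<Rightarrow> (int \<times> int) \<times> (int \<times> int) \<Rightarrow> (int \<times> int) \<times> (int \<times> int) \<Rightarrow> complex" where
  "ew \<theta> \<equiv> env_weight (tw \<theta>)"

interpretation env: bicharacter "ew \<theta>" for \<theta>
  by (rule bicharacter_env_weight) unfold_locales

abbreviation left_emb :: "('g::ab_group_add \<Rightarrow>\<^sub>0 complex) \<Rightarrow> ('g \<times> 'g \<Rightarrow>\<^sub>0 complex)" where
  "left_emb \<equiv> push_forward (\<lambda>p. (p, 0))"

abbreviation right_emb :: "('g::ab_group_add \<Rightarrow>\<^sub>0 complex) \<Rightarrow> ('g \<times> 'g \<Rightarrow>\<^sub>0 complex)" where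
  "right_emb \<equiv> push_forward (\<lambda>q. (0, q))"

lemma left_emb_mult: "left_emb (tmult (tw \<theta>) x y) = tmult (ew \<theta>) (left_emb x) (left_emb y)"
  by (rule push_forward_tmult) (simp_all add: env_weight_def)

lemma right_emb_mult: "right_emb (tmult (tw \<theta>) x y) = tmult (ew \<theta>) (right_emb y) (right_emb x)"
  by (rule push_forward_tmult_anti) (simp_all add: env_weight_def)

lemma emb_commute: "tmult (ew \<theta>) (right_emb y) (left_emb x) = tmult (ew \<theta>) (left_emb x) (right_emb y)"
proof (induction x rule: free_induct)
  case (single p c)
  show ?case by (induction y rule: free_induct) (simp_all add: tmult_add env_weight_def mult.commute)
qed (simp_all add: tmult_add)

definition tens :: "real \<Rightarrow> (int \<times> int \<Rightarrow>\<^sub>0 complex) \<Rightarrow> (int \<times> int \<Rightarrow>\<^sub>0 complex) \<Rightarrow> ((int \<times> int) \<times> (int \<times> int) \<Rightarrow>\<^sub>0 complex)" where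
  "tens \<theta> x y = tmult (ew \<theta>) (left_emb x) (right_emb y)"

lemma tens_mult: "tmult (ew \<theta>) (tens \<theta> x y) (tens \<theta> x' y') = tens \<theta> (tmult (tw \<theta>) x x') (tmult (tw \<theta>) y' y)"
  unfolding tens_def left_emb_mult right_emb_mult
  by (metis env.tmult_assoc emb_commute)

lemma tens_simps:
  "tens \<theta> (Poly_Mapping.single p c) (Poly_Mapping.single q d) = Poly_Mapping.single (p, q) (c * d)"
  "tens \<theta> (x + x') y = tens \<theta> x y + tens \<theta> x' y"
  "tens \<theta> x (y + y') = tens \<theta> x y + tens \<theta> x y'"
  "tens \<theta> 0 y = 0" "tens \<theta> x 0 = 0"
  "tens \<theta> (Poly_Mapping.map ((*) c) x) y = Poly_Mapping.map ((*) c) (tens \<theta> x y)"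
  "tens \<theta> x (Poly_Mapping.map ((*) c) y) = Poly_Mapping.map ((*) c) (tens \<theta> x y)"
  by (simp_all add: tens_def env_weight_def tmult_add push_forward_scale env.scale_tmult)

abbreviation flip1 :: "('g::ab_group_add \<times> 'g \<Rightarrow>\<^sub>0 complex) \<Rightarrow> ('g \<times> 'g \<Rightarrow>\<^sub>0 complex)" where
  "flip1 \<equiv> push_forward (\<lambda>k. (- fst k, snd k))"

abbreviation flip2 :: "('g::ab_group_add \<times> 'g \<Rightarrow>\<^sub>0 complex) \<Rightarrow> ('g \<times> 'g \<Rightarrow>\<^sub>0 complex)" where
  "flip2 \<equiv> push_forward (\<lambda>k. (fst k, - snd k))"

lemma flip1_mult: "flip1 (tmult (ew \<theta>) x y) = tmult (ew \<theta>) (flip1 x) (flip1 y)"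
  and flip2_mult: "flip2 (tmult (ew \<theta>) x y) = tmult (ew \<theta>) (flip2 x) (flip2 y)"
  by (rule push_forward_tmult; simp add: env_weight_def)+

lemma flip1_flip2: "flip1 (flip2 x) = flip x" "flip2 (flip1 x) = flip x"
proof -
  have "uminus = (\<lambda>k :: 'a \<times> 'a. (- fst k, - snd k))"
    by (simp add: fun_eq_iff uminus_prod_def)
  then show "flip1 (flip2 x) = flip x" "flip2 (flip1 x) = flip x"
    by (simp_all add: push_forward_comp o_def)
qed

lemma flip_flip: "flip (flip x) = x" "flip1 (flip1 y) = y" "flip2 (flip2 y) = y"
  by (simp_all add: push_forward_comp o_def push_forward_id)

lemma flip_emb:
  "flip1 (left_emb x) = left_emb (flip x)" "flip2 (left_emb x) = left_emb x"
  "flip1 (right_emb x) = right_emb x" "flip2 (right_emb x) = right_emb (flip x)"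
  by (simp_all add: push_forward_comp o_def)

lemma flip_tens: "flip1 (tens \<theta> x y) = tens \<theta> (flip x) y" "flip2 (tens \<theta> x y) = tens \<theta> x (flip y)"
  by (simp_all add: tens_def flip1_mult flip2_mult flip_emb)

section \<open>Tensor classes in the enveloping algebra of an arbitrary algebra\<close>

context complex_algebra
begin

abbreviation pair_combinations :: "('a \<times> 'a \<Rightarrow>\<^sub>0 complex) set" where
  "pair_combinations \<equiv> {f. Poly_Mapping.keys f \<subseteq> carrier A \<times> carrier A}"

lemma pair_carrier: "carrier (monoid_algebra env_monoid) = pair_combinations"
  by (simp only: monoid_algebra_simps carrier_env_monoid)

lemma tensor_class_simps:
  "carrier (enveloping_algebra A) = tensor_class ` pair_combinations"
  "\<lbrakk>f \<in> pair_combinations; g \<in> pair_combinations\<rbrakk> \<Longrightarrow>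
    tensor_class f \<oplus>\<^bsub>enveloping_algebra A\<^esub> tensor_class g = tensor_class (f + g)"
  "\<lbrakk>f \<in> pair_combinations; g \<in> pair_combinations\<rbrakk> \<Longrightarrow>
    tensor_class f \<otimes>\<^bsub>enveloping_algebra A\<^esub> tensor_class g = tensor_class (f \<otimes>\<^bsub>monoid_algebra env_monoid\<^esub> g)"
  "\<one>\<^bsub>enveloping_algebra A\<^esub> = tensor_class (Poly_Mapping.single (\<one>\<^bsub>A\<^esub>, \<one>\<^bsub>A\<^esub>) 1)"
proof -
  let ?E = "monoid_algebra env_monoid"
  let ?I = "genideal ?E (bilinear_relations A (opposite_algebra A))"
  interpret E: complex_algebra ?E by (rule complex_algebra_env_monoid)
  interpret I: ideal ?I ?E by (rule bilinear_genideal)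
  show "carrier (enveloping_algebra A) = tensor_class ` pair_combinations"
    unfolding pair_carrier[symmetric]
    by (auto simp: tensor_algebra_def quotient_algebra_simps A_RCOSETS_def' tensor_class_def)
  show "tensor_class f \<oplus>\<^bsub>enveloping_algebra A\<^esub> tensor_class g = tensor_class (f + g)"
    if "f \<in> pair_combinations" "g \<in> pair_combinations" for f g
    using I.a_rcos_sum[of f g] that unfolding pair_carrier[symmetric]
    by (simp only: tensor_algebra_def quotient_algebra_simps tensor_class_def monoid_algebra_simps(4))
  show "tensor_class f \<otimes>\<^bsub>enveloping_algebra A\<^esub> tensor_class g = tensor_class (f \<otimes>\<^bsub>?E\<^esub> g)"
    if "f \<in> pair_combinations" "g \<in> pair_combinations" for f g
    using I.rcoset_mult_add[of f g] that unfolding pair_carrier[symmetric]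
    by (simp only: tensor_algebra_def quotient_algebra_simps tensor_class_def)
  show "\<one>\<^bsub>enveloping_algebra A\<^esub> = tensor_class (Poly_Mapping.single (\<one>\<^bsub>A\<^esub>, \<one>\<^bsub>A\<^esub>) 1)"
    by (simp add: tensor_algebra_def quotient_algebra_simps tensor_class_def monoid_algebra_simps
        DirProd_def opposite_algebra_def)
qed

lemma tensor_class_eq_iff:
  assumes "f \<in> pair_combinations" "g \<in> pair_combinations"
  shows "tensor_class f = tensor_class g \<longleftrightarrow>
    f - g \<in> genideal (monoid_algebra env_monoid) (bilinear_relations A (opposite_algebra A))"
proof -
  let ?E = "monoid_algebra env_monoid"
  interpret E: complex_algebra ?E by (rule complex_algebra_env_monoid)
  have "\<ominus>\<^bsub>?E\<^esub> g = - g"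
    by (rule E.minus_equality) (use assms in \<open>auto simp: pair_carrier monoid_algebra_simps(3,4)\<close>)
  then show ?thesis
    unfolding tensor_class_def
    by (subst ideal.coset_eq_iff[OF bilinear_genideal])
      (use assms in \<open>simp_all add: pair_carrier a_minus_def monoid_algebra_simps(4)\<close>)
qed

lemma pair_single [simp]: "a \<in> carrier A \<Longrightarrow> b \<in> carrier A \<Longrightarrow> Poly_Mapping.single (a, b) c \<in> pair_combinations"
  by simp

lemma pair_add: "f \<in> pair_combinations \<Longrightarrow> g \<in> pair_combinations \<Longrightarrow> f + g \<in> pair_combinations"
  using Poly_Mapping.keys_add[of f g] by auto

lemma tensor_class_bilinear:
  assumes "a \<in> carrier A" "a' \<in> carrier A" "b \<in> carrier A" "b' \<in> carrier A"
  shows "tensor_class (Poly_Mapping.single (a \<oplus>\<^bsub>A\<^esub> a', b) 1) =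
      tensor_class (Poly_Mapping.single (a, b) 1 + Poly_Mapping.single (a', b) 1)"
    and "tensor_class (Poly_Mapping.single (a, b \<oplus>\<^bsub>A\<^esub> b') 1) =
      tensor_class (Poly_Mapping.single (a, b) 1 + Poly_Mapping.single (a, b') 1)"
    and "tensor_class (Poly_Mapping.single (c \<odot>\<^bsub>A\<^esub> a, b) 1) = tensor_class (Poly_Mapping.single (a, b) c)"
    and "tensor_class (Poly_Mapping.single (a, c \<odot>\<^bsub>A\<^esub> b) 1) = tensor_class (Poly_Mapping.single (a, b) c)"
proof -
  let ?E = "monoid_algebra env_monoid"
  interpret E: complex_algebra ?E by (rule complex_algebra_env_monoid)
  have sub: "bilinear_relations A (opposite_algebra A) \<subseteq>
      genideal ?E (bilinear_relations A (opposite_algebra A))"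
    by (intro E.genideal_self bilinear_relations_carrier complex_algebra_opposite complex_algebra_axioms)
  have eqI: "tensor_class f = tensor_class g"
    if "f \<in> pair_combinations" "g \<in> pair_combinations" "f - g \<in> bilinear_relations A (opposite_algebra A)" for f g
    using that sub by (auto simp: tensor_class_eq_iff)
  show "tensor_class (Poly_Mapping.single (a \<oplus>\<^bsub>A\<^esub> a', b) 1) =
      tensor_class (Poly_Mapping.single (a, b) 1 + Poly_Mapping.single (a', b) 1)"
  proof (intro eqI pair_add pair_single)
    have "Poly_Mapping.single (a \<oplus>\<^bsub>A\<^esub> a', b) 1 - Poly_Mapping.single (a, b) 1 - Poly_Mapping.single (a', b) 1
        \<in> bilinear_relations A (opposite_algebra A)"
      unfolding bilinear_relations_def opposite_algebra_def using assms by auto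
    then show "Poly_Mapping.single (a \<oplus>\<^bsub>A\<^esub> a', b) 1 - (Poly_Mapping.single (a, b) 1 + Poly_Mapping.single (a', b) 1)
        \<in> bilinear_relations A (opposite_algebra A)"
      by (simp only: diff_diff_add)
  qed (use assms in auto)
  show "tensor_class (Poly_Mapping.single (a, b \<oplus>\<^bsub>A\<^esub> b') 1) =
      tensor_class (Poly_Mapping.single (a, b) 1 + Poly_Mapping.single (a, b') 1)"
  proof (intro eqI pair_add pair_single)
    have "Poly_Mapping.single (a, b \<oplus>\<^bsub>A\<^esub> b') 1 - Poly_Mapping.single (a, b) 1 - Poly_Mapping.single (a, b') 1
        \<in> bilinear_relations A (opposite_algebra A)"
      unfolding bilinear_relations_def opposite_algebra_def using assms by auto
    then show "Poly_Mapping.single (a, b \<oplus>\<^bsub>A\<^esub> b') 1 - (Poly_Mapping.single (a, b) 1 + Poly_Mapping.single (a, b') 1)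
        \<in> bilinear_relations A (opposite_algebra A)"
      by (simp only: diff_diff_add)
  qed (use assms in auto)
  show "tensor_class (Poly_Mapping.single (c \<odot>\<^bsub>A\<^esub> a, b) 1) = tensor_class (Poly_Mapping.single (a, b) c)"
    using assms by (intro eqI pair_single) (auto simp: bilinear_relations_def opposite_algebra_def)
  show "tensor_class (Poly_Mapping.single (a, c \<odot>\<^bsub>A\<^esub> b) 1) = tensor_class (Poly_Mapping.single (a, b) c)"
    using assms by (intro eqI pair_single) (auto simp: bilinear_relations_def opposite_algebra_def)
qed

end

type_synonym torus_elem = "(letter list \<Rightarrow>\<^sub>0 complex) set"

interpretation pillow: complex_star_algebra "nc_pillow \<theta>" for \<theta>
  by (rule complex_star_algebra_pillow)

lemma pillow_simps:
  "carrier (nc_pillow \<theta>) = {x \<in> carrier (nc_torus \<theta>). flip (torus_model \<theta> x) = torus_model \<theta> x}"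
  "x \<otimes>\<^bsub>nc_pillow \<theta>\<^esub> y = x \<otimes>\<^bsub>nc_torus \<theta>\<^esub> y"
  "x \<oplus>\<^bsub>nc_pillow \<theta>\<^esub> y = x \<oplus>\<^bsub>nc_torus \<theta>\<^esub> y"
  "c \<odot>\<^bsub>nc_pillow \<theta>\<^esub> x = c \<odot>\<^bsub>nc_torus \<theta>\<^esub> x"
  "\<one>\<^bsub>nc_pillow \<theta>\<^esub> = \<one>\<^bsub>nc_torus \<theta>\<^esub>"
  "\<zero>\<^bsub>nc_pillow \<theta>\<^esub> = \<zero>\<^bsub>nc_torus \<theta>\<^esub>"
  unfolding carrier_pillow using torus_part_model[of _ \<theta> 0] by (auto simp: nc_pillow_def)

lemma torus_model_pillow:
  "torus_model \<theta> \<one>\<^bsub>nc_pillow \<theta>\<^esub> = Poly_Mapping.single 0 1"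
  "torus_model \<theta> \<zero>\<^bsub>nc_pillow \<theta>\<^esub> = 0"
  "\<lbrakk>x \<in> carrier (nc_pillow \<theta>); y \<in> carrier (nc_pillow \<theta>)\<rbrakk> \<Longrightarrow>
    torus_model \<theta> (x \<oplus>\<^bsub>nc_pillow \<theta>\<^esub> y) = torus_model \<theta> x + torus_model \<theta> y"
  "\<lbrakk>x \<in> carrier (nc_pillow \<theta>); y \<in> carrier (nc_pillow \<theta>)\<rbrakk> \<Longrightarrow>
    torus_model \<theta> (x \<otimes>\<^bsub>nc_pillow \<theta>\<^esub> y) = tmult (tw \<theta>) (torus_model \<theta> x) (torus_model \<theta> y)"
  "x \<in> carrier (nc_pillow \<theta>) \<Longrightarrow> torus_model \<theta> (c \<odot>\<^bsub>nc_pillow \<theta>\<^esub> x) = Poly_Mapping.map ((*) c) (torus_model \<theta> x)"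
  "x \<in> carrier (nc_pillow \<theta>) \<Longrightarrow> flip (torus_model \<theta> x) = torus_model \<theta> x"
  by (simp_all add: pillow_simps torus_model_simps)

abbreviation pairs :: "real \<Rightarrow> (torus_elem \<times> torus_elem \<Rightarrow>\<^sub>0 complex) set" where
  "pairs \<theta> \<equiv> {f. Poly_Mapping.keys f \<subseteq> carrier (nc_pillow \<theta>) \<times> carrier (nc_pillow \<theta>)}"

abbreviation env_ring where "env_ring \<theta> \<equiv> enveloping_algebra (nc_pillow \<theta>)"

section \<open>From formal pairs over the pillow to the model of the enveloping algebra\<close>

definition env_hom :: "real \<Rightarrow> (torus_elem \<times> torus_elem \<Rightarrow>\<^sub>0 complex) \<Rightarrow> ((int \<times> int) \<times> (int \<times> int) \<Rightarrow>\<^sub>0 complex)" where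
  "env_hom \<theta> f = (\<Sum>k\<in>Poly_Mapping.keys f.
     Poly_Mapping.map ((*) (Poly_Mapping.lookup f k)) (tens \<theta> (torus_model \<theta> (fst k)) (torus_model \<theta> (snd k))))"

lemma scale_zero_left [simp]: "Poly_Mapping.map ((*) (0::complex)) f = 0"
  by (rule poly_mapping_eqI) (simp add: lookup_scale)

lemma scale_add_left: "Poly_Mapping.map ((*) (c + d::complex)) f = Poly_Mapping.map ((*) c) f + Poly_Mapping.map ((*) d) f"
  by (rule poly_mapping_eqI) (simp add: lookup_scale lookup_add distrib_right)

lemma env_hom_simps [simp]:
  "env_hom \<theta> 0 = 0"
  "env_hom \<theta> (Poly_Mapping.single k c) = Poly_Mapping.map ((*) c) (tens \<theta> (torus_model \<theta> (fst k)) (torus_model \<theta> (snd k)))"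
  "env_hom \<theta> (f + g) = env_hom \<theta> f + env_hom \<theta> g"
proof -
  show "env_hom \<theta> (f + g) = env_hom \<theta> f + env_hom \<theta> g"
    unfolding env_hom_def
    by (rule setsum_keys_plus_distrib[where f = "\<lambda>k c. Poly_Mapping.map ((*) c) (tens \<theta> (torus_model \<theta> (fst k)) (torus_model \<theta> (snd k)))"])
       (auto simp: scale_add_left)
qed (simp_all add: env_hom_def)

lemma additive_env_hom: "additive (env_hom \<theta>)"
  by (simp add: additive_def)

lemmas env_hom_diff = additive.diff[OF additive_env_hom]
lemmas env_hom_minus = additive.minus[OF additive_env_hom]

lemma env_hom_mult:
  assumes "f \<in> pairs \<theta>" "g \<in> pairs \<theta>"
  shows "env_hom \<theta> (f \<otimes>\<^bsub>monoid_algebra (nc_pillow \<theta> \<times>\<times> opposite_algebra (nc_pillow \<theta>))\<^esub> g) = tmult (ew \<theta>) (env_hom \<theta> f) (env_hom \<theta> g)"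
proof -
  from assms have "Poly_Mapping.keys f \<subseteq> carrier (nc_pillow \<theta>) \<times> carrier (nc_pillow \<theta>)" by simp
  then show ?thesis
  proof (induction f rule: poly_mapping_single_induct)
    case (single k c)
    note k = single
    from assms have "Poly_Mapping.keys g \<subseteq> carrier (nc_pillow \<theta>) \<times> carrier (nc_pillow \<theta>)" by simp
    then show ?case
    proof (induction g rule: poly_mapping_single_induct)
      case (single k' d)
      show ?case
        using k single by (auto simp: monoid_algebra_mult DirProd_def opposite_algebra_def torus_model_pillow
            env.scale_tmult tens_mult scale_scale mult.commute[of c])
    qed (simp_all add: monoid_algebra_mult tmult_add)
  qed (simp_all add: monoid_algebra_mult tmult_add)
qed

lemma env_hom_flip:
  assumes "f \<in> pairs \<theta>"
  shows "flip1 (env_hom \<theta> f) = env_hom \<theta> f" "flip2 (env_hom \<theta> f) = env_hom \<theta> f"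
proof -
  from assms have "Poly_Mapping.keys f \<subseteq> carrier (nc_pillow \<theta>) \<times> carrier (nc_pillow \<theta>)" by simp
  then show "flip1 (env_hom \<theta> f) = env_hom \<theta> f" "flip2 (env_hom \<theta> f) = env_hom \<theta> f"
    by (induction f rule: poly_mapping_single_induct)
      (auto simp: push_forward_scale flip_tens torus_model_pillow)
qed

text \<open>The kernel is an ideal because \<open>env_hom\<close> is multiplicative, and it contains
  the bilinearity relations because \<open>tens\<close> is bilinear. So \<open>env_hom\<close>
  descends to the enveloping algebra.\<close>

lemma env_hom_ideal:
  assumes "f \<in> genideal (monoid_algebra (nc_pillow \<theta> \<times>\<times> opposite_algebra (nc_pillow \<theta>)))
      (bilinear_relations (nc_pillow \<theta>) (opposite_algebra (nc_pillow \<theta>)))"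
  shows "env_hom \<theta> f = 0"
proof -
  let ?B = "nc_pillow \<theta>"
  let ?E = "monoid_algebra (nc_pillow \<theta> \<times>\<times> opposite_algebra (nc_pillow \<theta>))"
  interpret E: complex_algebra ?E by (rule pillow.complex_algebra_env_monoid)
  define J where "J = {f \<in> carrier ?E. env_hom \<theta> f = 0}"
  have mult: "env_hom \<theta> (f \<otimes>\<^bsub>?E\<^esub> g) = tmult (ew \<theta>) (env_hom \<theta> f) (env_hom \<theta> g)"
    if "f \<in> carrier ?E" "g \<in> carrier ?E" for f g
    using that env_hom_mult unfolding pillow.pair_carrier by blast
  have neg: "\<ominus>\<^bsub>?E\<^esub> f = - f" if "f \<in> carrier ?E" for f
    by (rule E.minus_equality) (use that in \<open>auto simp: pillow.pair_carrier monoid_algebra_simps(3,4)\<close>)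
  have "ideal J ?E"
  proof (rule idealI)
    have "inv\<^bsub>add_monoid ?E\<^esub> f \<in> J" if "f \<in> J" for f
      using that neg[of f] E.a_inv_closed[of f] by (auto simp: J_def env_hom_minus simp flip: a_inv_def)
    moreover have "\<zero>\<^bsub>?E\<^esub> \<in> J" using E.zero_closed by (simp add: J_def monoid_algebra_simps(3))
    moreover have "f \<oplus>\<^bsub>?E\<^esub> g \<in> J" if "f \<in> J" "g \<in> J" for f g
      using that E.a_closed[of f g] by (simp add: J_def monoid_algebra_simps(4))
    ultimately show "subgroup J (add_monoid ?E)"
      by unfold_locales (auto simp: J_def)
  qed (auto simp: J_def mult intro: E.ring_axioms)
  moreover have "bilinear_relations ?B (opposite_algebra ?B) \<subseteq> J"
  proof
    fix r assume r: "r \<in> bilinear_relations ?B (opposite_algebra ?B)"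
    then have "r \<in> carrier ?E"
      using bilinear_relations_carrier[OF pillow.complex_algebra_axioms complex_algebra_opposite[OF pillow.complex_algebra_axioms]]
      by blast
    moreover have "env_hom \<theta> r = 0"
      using r unfolding bilinear_relations_def opposite_algebra_def
      by (auto simp: env_hom_diff torus_model_pillow tens_simps)
    ultimately show "r \<in> J" by (simp add: J_def)
  qed
  ultimately have "genideal ?E (bilinear_relations ?B (opposite_algebra ?B)) \<subseteq> J"
    by (intro E.genideal_minimal)
  with assms show ?thesis by (auto simp: J_def)
qed

definition env_model :: "real \<Rightarrow> (torus_elem \<times> torus_elem \<Rightarrow>\<^sub>0 complex) set \<Rightarrow> ((int \<times> int) \<times> (int \<times> int) \<Rightarrow>\<^sub>0 complex)" where
  "env_model \<theta> K = env_hom \<theta> (SOME f. f \<in> pairs \<theta> \<and> pillow.tensor_class \<theta> f = K)"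

lemma env_model_class:
  assumes "f \<in> pairs \<theta>"
  shows "env_model \<theta> (pillow.tensor_class \<theta> f) = env_hom \<theta> f"
proof -
  define g where "g = (SOME g. g \<in> pairs \<theta> \<and> pillow.tensor_class \<theta> g = pillow.tensor_class \<theta> f)"
  have g: "g \<in> pairs \<theta> \<and> pillow.tensor_class \<theta> g = pillow.tensor_class \<theta> f"
    unfolding g_def by (rule someI[of _ f]) (use assms in simp)
  then have "env_hom \<theta> (g - f) = 0"
    using assms pillow.tensor_class_eq_iff[of g \<theta> f] by (intro env_hom_ideal) blast
  then show ?thesis by (simp only: env_model_def env_hom_diff right_minus_eq flip: g_def)
qed

lemma env_model_simps:
  assumes "K \<in> carrier (env_ring \<theta>)" "L \<in> carrier (env_ring \<theta>)"
  shows "env_model \<theta> (K \<oplus>\<^bsub>env_ring \<theta>\<^esub> L) = env_model \<theta> K + env_model \<theta> L"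
    and "env_model \<theta> (K \<otimes>\<^bsub>env_ring \<theta>\<^esub> L) = tmult (ew \<theta>) (env_model \<theta> K) (env_model \<theta> L)"
    and "flip1 (env_model \<theta> K) = env_model \<theta> K" "flip2 (env_model \<theta> K) = env_model \<theta> K"
proof -
  obtain f g where f: "f \<in> pairs \<theta>" "K = pillow.tensor_class \<theta> f" and g: "g \<in> pairs \<theta>" "L = pillow.tensor_class \<theta> g"
    using assms unfolding pillow.tensor_class_simps(1) by blast
  show "env_model \<theta> (K \<oplus>\<^bsub>env_ring \<theta>\<^esub> L) = env_model \<theta> K + env_model \<theta> L"
    unfolding f(2) g(2) pillow.tensor_class_simps(2)[OF f(1) g(1)]
    using pillow.pair_add[OF f(1) g(1)] f(1) g(1) by (simp only: env_model_class env_hom_simps)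
  interpret E: complex_algebra "monoid_algebra (nc_pillow \<theta> \<times>\<times> opposite_algebra (nc_pillow \<theta>))"
    by (rule pillow.complex_algebra_env_monoid)
  show "env_model \<theta> (K \<otimes>\<^bsub>env_ring \<theta>\<^esub> L) = tmult (ew \<theta>) (env_model \<theta> K) (env_model \<theta> L)"
    unfolding f(2) g(2) pillow.tensor_class_simps(3)[OF f(1) g(1)]
    using E.m_closed[of f g, unfolded pillow.pair_carrier, OF f(1) g(1)] f(1) g(1)
    by (simp only: env_model_class env_hom_mult)
  show "flip1 (env_model \<theta> K) = env_model \<theta> K" "flip2 (env_model \<theta> K) = env_model \<theta> K"
    unfolding f(2) env_model_class[OF f(1)] by (rule env_hom_flip[OF f(1)])+
qed

lemma env_model_one: "env_model \<theta> \<one>\<^bsub>env_ring \<theta>\<^esub> = Poly_Mapping.single 0 1"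
proof -
  have "env_model \<theta> \<one>\<^bsub>env_ring \<theta>\<^esub> = env_hom \<theta> (Poly_Mapping.single (\<one>\<^bsub>nc_pillow \<theta>\<^esub>, \<one>\<^bsub>nc_pillow \<theta>\<^esub>) 1)"
    unfolding pillow.tensor_class_simps(4) by (rule env_model_class) simp
  then show ?thesis by (simp add: torus_model_pillow tens_simps zero_prod_def del: single_one)
qed

section \<open>The inverse map, by averaging over the flips\<close>

definition average :: "('g::ab_group_add \<Rightarrow>\<^sub>0 complex) \<Rightarrow> ('g \<Rightarrow>\<^sub>0 complex)" where
  "average x = Poly_Mapping.map ((*) (1/2)) (x + flip x)"

lemma average_add: "average (x + y) = average x + average y"
  by (simp add: average_def add_ac)

lemma average_scale: "average (Poly_Mapping.map ((*) c) x) = Poly_Mapping.map ((*) c) (average x)"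
  by (simp add: average_def push_forward_scale scale_scale mult.commute)

lemma flip_average: "flip (average x) = average x"
  by (simp add: average_def push_forward_scale flip_flip add.commute)

lemma average_fixed: "flip x = x \<Longrightarrow> average x = x"
  using scale_half_double[of x] by (simp add: average_def)

definition pillow_average :: "real \<Rightarrow> (int \<times> int \<Rightarrow>\<^sub>0 complex) \<Rightarrow> torus_elem" where
  "pillow_average \<theta> x = of_model \<theta> (average x)"

lemma pillow_average_closed [simp]: "pillow_average \<theta> x \<in> carrier (nc_pillow \<theta>)"
  by (simp add: pillow_average_def pillow_simps flip_average)

lemma pillow_average_simps:
  "pillow_average \<theta> (x + y) = pillow_average \<theta> x \<oplus>\<^bsub>nc_pillow \<theta>\<^esub> pillow_average \<theta> y"
  "pillow_average \<theta> (Poly_Mapping.map ((*) c) x) = c \<odot>\<^bsub>nc_pillow \<theta>\<^esub> pillow_average \<theta> x"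
  "K \<in> carrier (nc_pillow \<theta>) \<Longrightarrow> pillow_average \<theta> (torus_model \<theta> K) = K"
  by (simp_all add: pillow_average_def pillow_simps average_add average_scale of_model_simps average_fixed)

text \<open>Values are prescribed on basis elements, since a formal pair does not depend linearly on
  its entries. The formula for general tensors becomes true only after passage to tensor classes, in
  \<open>of_env_model_tens\<close>.\<close>

definition basis_lift :: "real \<Rightarrow> ((int \<times> int) \<times> (int \<times> int) \<Rightarrow>\<^sub>0 complex) \<Rightarrow> (torus_elem \<times> torus_elem \<Rightarrow>\<^sub>0 complex)" where
  "basis_lift \<theta> = push_forward (\<lambda>k. (pillow_average \<theta> (Poly_Mapping.single (fst k) 1), pillow_average \<theta> (Poly_Mapping.single (snd k) 1)))"

lemma basis_lift_simps [simp]: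
  "basis_lift \<theta> 0 = 0" "basis_lift \<theta> (x + y) = basis_lift \<theta> x + basis_lift \<theta> y"
  "basis_lift \<theta> (Poly_Mapping.single (p, q) c) =
    Poly_Mapping.single (pillow_average \<theta> (Poly_Mapping.single p 1), pillow_average \<theta> (Poly_Mapping.single q 1)) c"
  "basis_lift \<theta> (Poly_Mapping.map ((*) c) x) = Poly_Mapping.map ((*) c) (basis_lift \<theta> x)"
  by (simp_all add: basis_lift_def push_forward_scale)

lemma basis_lift_pairs: "basis_lift \<theta> x \<in> pairs \<theta>"
proof (induction x rule: free_induct)
  case (single k c)
  then show ?case by (cases k) auto
next
  case (add x y)
  then show ?case unfolding basis_lift_simps by (rule pillow.pair_add)
qed simp

definition of_env_model :: "real \<Rightarrow> ((int \<times> int) \<times> (int \<times> int) \<Rightarrow>\<^sub>0 complex) \<Rightarrow> (torus_elem \<times> torus_elem \<Rightarrow>\<^sub>0 complex) set" where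
  "of_env_model \<theta> x = pillow.tensor_class \<theta> (basis_lift \<theta> x)"

lemma of_env_model_closed: "of_env_model \<theta> x \<in> carrier (env_ring \<theta>)"
  unfolding of_env_model_def pillow.tensor_class_simps(1) using basis_lift_pairs by blast

lemma of_env_model_add: "of_env_model \<theta> (x + y) = of_env_model \<theta> x \<oplus>\<^bsub>env_ring \<theta>\<^esub> of_env_model \<theta> y"
  unfolding of_env_model_def basis_lift_simps
  by (rule pillow.tensor_class_simps(2)[symmetric]) (rule basis_lift_pairs)+

text \<open>The composite is the average over the group of order four generated by both flips,
  whence the constant 1/4; doubly invariant elements are fixed by it.\<close>

lemma env_model_of_env_model:
  assumes "flip1 x = x" "flip2 x = x"
  shows "env_model \<theta> (of_env_model \<theta> x) = x"
proof -
  have a: "torus_model \<theta> (pillow_average \<theta> y) = average y" for y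
    by (simp add: pillow_average_def)
  define q :: complex where "q = 1/4"
  have q: "q * c = c / 4" for c by (simp add: q_def)
  have "env_hom \<theta> (basis_lift \<theta> x) = Poly_Mapping.map ((*) q) (x + flip1 x + (flip2 x + flip2 (flip1 x)))"
  proof (induction x rule: free_induct)
    case (single k c)
    show ?case by (cases k) (simp add: a average_def tens_simps scale_single q[of c] add_ac)
  qed (simp_all add: add_ac)
  also have "\<dots> = x"
    unfolding assms by (rule poly_mapping_eqI) (simp only: lookup_scale lookup_add q, simp)
  finally show ?thesis
    unfolding of_env_model_def env_model_class[OF basis_lift_pairs] .
qed

text \<open>As tensor classes both sides are bilinear in x and y, so basis elements suffice. There
  the scalars have to be moved from the entries of a pair into its coefficient.\<close>

lemma of_env_model_tens:
  "of_env_model \<theta> (tens \<theta> x y) = pillow.tensor_class \<theta> (Poly_Mapping.single (pillow_average \<theta> x, pillow_average \<theta> y) 1)"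
proof -
  let ?c = "pillow.tensor_class \<theta>" and ?a = "pillow_average \<theta>" and ?s = "Poly_Mapping.single :: torus_elem \<times> torus_elem \<Rightarrow> complex \<Rightarrow> _"
  have add: "?c (f + g) = ?c f \<oplus>\<^bsub>env_ring \<theta>\<^esub> ?c g" if "f \<in> pairs \<theta>" "g \<in> pairs \<theta>" for f g
    using pillow.tensor_class_simps(2)[OF that] by simp
  have left: "?c (?s (?a (x + x'), y) 1) = ?c (?s (?a x, y) 1) \<oplus>\<^bsub>env_ring \<theta>\<^esub> ?c (?s (?a x', y) 1)"
    if "y \<in> carrier (nc_pillow \<theta>)" for x x' y
    using that unfolding pillow_average_simps
    by (subst pillow.tensor_class_bilinear(1)) (auto intro!: add)
  have right: "?c (?s (x, ?a (y + y')) 1) = ?c (?s (x, ?a y) 1) \<oplus>\<^bsub>env_ring \<theta>\<^esub> ?c (?s (x, ?a y') 1)"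
    if "x \<in> carrier (nc_pillow \<theta>)" for x y y'
    using that unfolding pillow_average_simps
    by (subst pillow.tensor_class_bilinear(2)) (auto intro!: add)
  have e: "d \<odot>\<^bsub>nc_pillow \<theta>\<^esub> ?a (Poly_Mapping.single p c) = ?a (Poly_Mapping.single p (d * c))" for p c d
    by (simp add: scale_single flip: pillow_average_simps(2))
  have sl: "?c (?s (?a (Poly_Mapping.single p c), y) d) = ?c (?s (?a (Poly_Mapping.single p 1), y) (c * d))"
    if y: "y \<in> carrier (nc_pillow \<theta>)" for p c d y
  proof -
    have *: "?c (?s (?a (Poly_Mapping.single p c), y) d) = ?c (?s (d \<odot>\<^bsub>nc_pillow \<theta>\<^esub> ?a (Poly_Mapping.single p c), y) 1)" for p c d
      by (rule pillow.tensor_class_bilinear(3)[OF pillow_average_closed pillow_average_closed y y, symmetric])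
    have "?c (?s (?a (Poly_Mapping.single p c), y) d) = ?c (?s (d \<odot>\<^bsub>nc_pillow \<theta>\<^esub> ?a (Poly_Mapping.single p c), y) 1)" by (rule *)
    also have "\<dots> = ?c (?s ((c * d) \<odot>\<^bsub>nc_pillow \<theta>\<^esub> ?a (Poly_Mapping.single p 1), y) 1)"
      by (simp only: e mult_1_left mult_1_right mult.commute)
    also have "\<dots> = ?c (?s (?a (Poly_Mapping.single p 1), y) (c * d))" by (rule *[symmetric])
    finally show ?thesis .
  qed
  have sr: "?c (?s (x, ?a (Poly_Mapping.single p c)) d) = ?c (?s (x, ?a (Poly_Mapping.single p 1)) (c * d))"
    if x: "x \<in> carrier (nc_pillow \<theta>)" for p c d x
  proof -
    have *: "?c (?s (x, ?a (Poly_Mapping.single p c)) d) = ?c (?s (x, d \<odot>\<^bsub>nc_pillow \<theta>\<^esub> ?a (Poly_Mapping.single p c)) 1)" for p c d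
      by (rule pillow.tensor_class_bilinear(4)[OF x x pillow_average_closed pillow_average_closed, symmetric])
    have "?c (?s (x, ?a (Poly_Mapping.single p c)) d) = ?c (?s (x, d \<odot>\<^bsub>nc_pillow \<theta>\<^esub> ?a (Poly_Mapping.single p c)) 1)" by (rule *)
    also have "\<dots> = ?c (?s (x, (c * d) \<odot>\<^bsub>nc_pillow \<theta>\<^esub> ?a (Poly_Mapping.single p 1)) 1)"
      by (simp only: e mult_1_left mult_1_right mult.commute)
    also have "\<dots> = ?c (?s (x, ?a (Poly_Mapping.single p 1)) (c * d))" by (rule *[symmetric])
    finally show ?thesis .
  qed
  have basis: "?c (basis_lift \<theta> (tens \<theta> (Poly_Mapping.single p c) (Poly_Mapping.single q d))) =
      ?c (?s (?a (Poly_Mapping.single p c), ?a (Poly_Mapping.single q d)) 1)" for p c q d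
  proof -
    have "?c (?s (?a (Poly_Mapping.single p c), ?a (Poly_Mapping.single q d)) 1) =
        ?c (?s (?a (Poly_Mapping.single p 1), ?a (Poly_Mapping.single q d)) (c * 1))"
      by (rule sl[OF pillow_average_closed])
    also have "\<dots> = ?c (?s (?a (Poly_Mapping.single p 1), ?a (Poly_Mapping.single q 1)) (d * (c * 1)))"
      by (rule sr[OF pillow_average_closed])
    also have "d * (c * 1) = c * d" by (simp only: mult_1_left mult_1_right mult.commute)
    finally show ?thesis unfolding tens_simps(1) basis_lift_simps(3) by (rule sym)
  qed
  have 1: "of_env_model \<theta> (tens \<theta> (Poly_Mapping.single p c) y) =
      ?c (?s (?a (Poly_Mapping.single p c), ?a y) 1)" for p c y
  proof (induction y rule: free_induct)
    case zero
    \<comment> \<open>With coefficient 0 the formula for basis elements becomes the formula for y =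
      0.\<close>
    then show ?case using basis[of p c 0 0] unfolding of_env_model_def single_zero .
  next
    case (single q d)
    show ?case unfolding of_env_model_def by (rule basis)
  next
    case (add y y')
    then show ?case by (simp only: tens_simps(3) of_env_model_add right pillow_average_closed)
  qed
  show ?thesis
  proof (induction x rule: free_induct)
    case zero
    then show ?case using 1[of 0 0 y] by simp
  next
    case (single p c)
    show ?case by (rule 1)
  next
    case (add x x')
    then show ?case by (simp only: tens_simps(2) of_env_model_add left pillow_average_closed)
  qed
qed

text \<open>A pair of pillow elements is recovered because averaging fixes its entries. This is the
  injectivity of the map from the enveloping algebra to its model.\<close>

lemma of_env_model_env_hom:
  assumes "f \<in> pairs \<theta>"
  shows "of_env_model \<theta> (env_hom \<theta> f) = pillow.tensor_class \<theta> f"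
proof -
  from assms have "Poly_Mapping.keys f \<subseteq> carrier (nc_pillow \<theta>) \<times> carrier (nc_pillow \<theta>)" by simp
  then show ?thesis
  proof (induction f rule: poly_mapping_single_induct)
    case zero
    show ?case by (simp add: of_env_model_def)
  next
    case (single k c)
    then obtain a b where k: "k = (a, b)" "a \<in> carrier (nc_pillow \<theta>)" "b \<in> carrier (nc_pillow \<theta>)" by auto
    have "of_env_model \<theta> (env_hom \<theta> (Poly_Mapping.single k c)) =
        pillow.tensor_class \<theta> (Poly_Mapping.single (pillow_average \<theta> (Poly_Mapping.map ((*) c) (torus_model \<theta> a)), pillow_average \<theta> (torus_model \<theta> b)) 1)"
      unfolding of_env_model_tens[symmetric] by (simp add: k tens_simps)
    also have "\<dots> = pillow.tensor_class \<theta> (Poly_Mapping.single k c)"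
      using k by (simp add: pillow_average_simps pillow.tensor_class_bilinear(3))
    finally show ?case .
  next
    case (add f g)
    then show ?case by (simp add: of_env_model_add pillow.tensor_class_simps(2))
  qed
qed

lemma of_env_model_env_model: "K \<in> carrier (env_ring \<theta>) \<Longrightarrow> of_env_model \<theta> (env_model \<theta> K) = K"
  unfolding pillow.tensor_class_simps(1) by (auto simp: env_model_class of_env_model_env_hom)

text \<open>Both sides have the same model. The lemma makes coordinates that are computed in the
  model linear over the enveloping ring.\<close>

lemma of_env_model_mult:
  assumes "K \<in> carrier (env_ring \<theta>)" "flip1 x = x" "flip2 x = x"
  shows "of_env_model \<theta> (tmult (ew \<theta>) (env_model \<theta> K) x) = K \<otimes>\<^bsub>env_ring \<theta>\<^esub> of_env_model \<theta> x"
proof -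
  interpret T: complex_algebra "env_ring \<theta>"
    by (intro complex_algebra_tensor pillow.complex_algebra_axioms complex_algebra_opposite)
  have "K \<otimes>\<^bsub>env_ring \<theta>\<^esub> of_env_model \<theta> x = of_env_model \<theta> (env_model \<theta> (K \<otimes>\<^bsub>env_ring \<theta>\<^esub> of_env_model \<theta> x))"
    using assms(1) by (intro of_env_model_env_model[symmetric] T.m_closed of_env_model_closed)
  then show ?thesis
    by (simp add: env_model_simps(2)[OF assms(1) of_env_model_closed] env_model_of_env_model assms)
qed

section \<open>The Koszul complex of the torus\<close>

type_synonym env_elem = "(int \<times> int) \<times> (int \<times> int) \<Rightarrow>\<^sub>0 complex"

text \<open>\<open>al m = U\<^sup>m \<otimes> U\<^sup>-\<^sup>m\<close> and \<open>be n = V\<^sup>n \<otimes> V\<^sup>-\<^sup>n\<close>.\<close>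

definition al :: "int \<Rightarrow> env_elem" where "al m = Poly_Mapping.single ((m, 0), (- m, 0)) 1"

definition be :: "int \<Rightarrow> env_elem" where "be n = Poly_Mapping.single ((0, n), (0, - n)) 1"

lemma al_be:
  "tmult (ew \<theta>) (al m) (al m') = al (m + m')"
  "tmult (ew \<theta>) (be n) (be n') = be (n + n')"
  "tmult (ew \<theta>) (be n) (al m) = tmult (ew \<theta>) (al m) (be n)"
  "flip (al m) = al (- m)" "flip (be n) = be (- n)"
  by (simp_all add: al_def be_def env_weight_def tw_eq mult.commute)

lemma al_0: "al 0 = Poly_Mapping.single 0 1" and be_0: "be 0 = Poly_Mapping.single 0 1"
  by (simp_all add: al_def be_def zero_prod_def del: single_one)

lemma al_be_assoc:
  "tmult (ew \<theta>) (tmult (ew \<theta>) x (al m)) (al m') = tmult (ew \<theta>) x (al (m + m'))"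
  "tmult (ew \<theta>) (tmult (ew \<theta>) x (be n)) (be n') = tmult (ew \<theta>) x (be (n + n'))"
  "tmult (ew \<theta>) (tmult (ew \<theta>) x (be n)) (al m) = tmult (ew \<theta>) (tmult (ew \<theta>) x (al m)) (be n)"
  by (simp_all add: env.tmult_assoc al_be)

lemma tmult_al_0 [simp]: "tmult (ew \<theta>) x (al 0) = x" "tmult (ew \<theta>) x (be 0) = x"
  by (simp_all add: al_0 be_0 del: single_one)

text \<open>Multiplication by U \<otimes> U^-1 - 1 is taken from the right, so that the
  differentials are linear for multiplication from the left.\<close>

definition mult_al :: "real \<Rightarrow> env_elem \<Rightarrow> env_elem" where
  "mult_al \<theta> x = tmult (ew \<theta>) x (al 1) - x"

definition mult_be :: "real \<Rightarrow> env_elem \<Rightarrow> env_elem" where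
  "mult_be \<theta> x = tmult (ew \<theta>) x (be 1) - x"

lemma mult_al_be:
  "mult_al \<theta> (x + y) = mult_al \<theta> x + mult_al \<theta> y" "mult_al \<theta> (- x) = - mult_al \<theta> x"
  "mult_be \<theta> (x + y) = mult_be \<theta> x + mult_be \<theta> y" "mult_be \<theta> (- x) = - mult_be \<theta> x"
  "mult_al \<theta> (Poly_Mapping.map ((*) c) x) = Poly_Mapping.map ((*) c) (mult_al \<theta> x)"
  "mult_be \<theta> (Poly_Mapping.map ((*) c) x) = Poly_Mapping.map ((*) c) (mult_be \<theta> x)"
  "mult_al \<theta> (tmult (ew \<theta>) y x) = tmult (ew \<theta>) y (mult_al \<theta> x)"
  "mult_be \<theta> (tmult (ew \<theta>) y x) = tmult (ew \<theta>) y (mult_be \<theta> x)"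
  "mult_be \<theta> (mult_al \<theta> x) = mult_al \<theta> (mult_be \<theta> x)"
  "mult_al \<theta> 0 = 0" "mult_be \<theta> 0 = 0"
  by (simp_all add: mult_al_def mult_be_def tmult_distribs env.scale_tmult scale_diff env.tmult_assoc al_be)

text \<open>Right multiplication by e_h shifts the support by \<open>h\<close> and thereby raises
  the height \<open>ht\<close>. A nonempty finite support equal to its shift would contain an
  element above its highest one.\<close>

lemma tmult_shift_eq_0:
  fixes x :: "'g::ab_group_add \<Rightarrow>\<^sub>0 complex" and ht :: "'g \<Rightarrow> int"
  assumes "bicharacter w" "\<And>k. ht (k + h) > ht k" "tmult w x (Poly_Mapping.single h 1) = x"
  shows "x = 0"
proof (rule ccontr)
  interpret bicharacter w by fact
  have l: "Poly_Mapping.lookup (tmult w x (Poly_Mapping.single h 1)) (k + h) = w k h * Poly_Mapping.lookup x k" for k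
    by (induction x rule: free_induct) (auto simp: tmult_add lookup_add lookup_single when_def distrib_left)
  assume "x \<noteq> 0"
  then have ne: "Poly_Mapping.keys x \<noteq> {}" by simp
  have "Max (ht ` Poly_Mapping.keys x) \<in> ht ` Poly_Mapping.keys x" using ne by simp
  then obtain k where k: "k \<in> Poly_Mapping.keys x" "ht k = Max (ht ` Poly_Mapping.keys x)" by auto
  have "k + h \<in> Poly_Mapping.keys x"
    using l[of k] k(1) w_nonzero[of k h] unfolding assms(3) by (simp add: in_keys_iff)
  then have "ht (k + h) \<le> ht k" unfolding k(2) by simp
  then show False using assms(2)[of k] by simp
qed

lemma mult_al_eq_0: "mult_al \<theta> x = 0 \<Longrightarrow> x = 0"
  using tmult_shift_eq_0[OF env.bicharacter_axioms, of "\<lambda>k. fst (fst k)" "((1, 0), (- 1, 0))" \<theta> x]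
  by (simp add: mult_al_def al_def)

lemma mult_be_eq_0: "mult_be \<theta> x = 0 \<Longrightarrow> x = 0"
  using tmult_shift_eq_0[OF env.bicharacter_axioms, of "\<lambda>k. snd (fst k)" "((0, 1), (0, - 1))" \<theta> x]
  by (simp add: mult_be_def be_def)

text \<open>The retraction onto the span of the basis elements with trivial \<open>V\<close>-degree in the second factor;
  its kernel is the left ideal generated by \<open>V \<otimes> V\<^sup>-\<^sup>1 - 1\<close>. Likewise for \<open>U\<close>.\<close>

definition retract_be :: "real \<Rightarrow> env_elem \<Rightarrow> env_elem" where
  "retract_be \<theta> = weighted_push (\<lambda>g. g + ((0, snd (snd g)), (0, - snd (snd g))))
     (\<lambda>g. ew \<theta> g ((0, snd (snd g)), (0, - snd (snd g))))"

definition retract_al :: "real \<Rightarrow> env_elem \<Rightarrow> env_elem" where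
  "retract_al \<theta> = weighted_push (\<lambda>g. g + ((fst (snd g), 0), (- fst (snd g), 0)))
     (\<lambda>g. ew \<theta> g ((fst (snd g), 0), (- fst (snd g), 0)))"

lemma retract_single:
  "retract_be \<theta> (Poly_Mapping.single g c) = tmult (ew \<theta>) (Poly_Mapping.single g c) (be (snd (snd g)))"
  "retract_al \<theta> (Poly_Mapping.single g c) = tmult (ew \<theta>) (Poly_Mapping.single g c) (al (fst (snd g)))"
  by (simp_all add: retract_be_def retract_al_def be_def al_def)

lemma retract_add:
  "retract_be \<theta> (x + y) = retract_be \<theta> x + retract_be \<theta> y" "retract_be \<theta> 0 = 0" "retract_be \<theta> (x - y) = retract_be \<theta> x - retract_be \<theta> y"
  "retract_be \<theta> (- x) = - retract_be \<theta> x"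
  "retract_al \<theta> (x + y) = retract_al \<theta> x + retract_al \<theta> y" "retract_al \<theta> 0 = 0" "retract_al \<theta> (x - y) = retract_al \<theta> x - retract_al \<theta> y"
  by (simp_all add: retract_be_def retract_al_def)

lemma retract_be_al: "retract_be \<theta> (tmult (ew \<theta>) x (al m)) = tmult (ew \<theta>) (retract_be \<theta> x) (al m)"
proof (induction x rule: free_induct)
  case (single g c)
  have s: "tmult (ew \<theta>) (Poly_Mapping.single g c) (al m) =
      Poly_Mapping.single (g + ((m, 0), (- m, 0))) (ew \<theta> g ((m, 0), (- m, 0)) * c)"
    by (simp add: al_def)
  have "retract_be \<theta> (tmult (ew \<theta>) (Poly_Mapping.single g c) (al m)) =
      tmult (ew \<theta>) (tmult (ew \<theta>) (Poly_Mapping.single g c) (al m)) (be (snd (snd g)))"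
    unfolding s retract_single by simp
  then show ?case by (simp only: retract_single al_be_assoc(3))
qed (simp_all add: retract_add tmult_add)

text \<open>The factor \<open>be n\<close> lowers the exponent chosen by the retraction by n, which
  compensates for it exactly. So \<open>retract_be\<close> kills the image of
  \<open>mult_be\<close>.\<close>

lemma retract_be_be: "retract_be \<theta> (tmult (ew \<theta>) x (be n)) = retract_be \<theta> x"
proof (induction x rule: free_induct)
  case (single g c)
  have s: "tmult (ew \<theta>) (Poly_Mapping.single g c) (be n) =
      Poly_Mapping.single (g + ((0, n), (0, - n))) (ew \<theta> g ((0, n), (0, - n)) * c)"
    by (simp add: be_def)
  have "retract_be \<theta> (tmult (ew \<theta>) (Poly_Mapping.single g c) (be n)) =
      tmult (ew \<theta>) (tmult (ew \<theta>) (Poly_Mapping.single g c) (be n)) (be (snd (snd g) - n))"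
    unfolding s retract_single by simp
  then show ?case by (simp add: retract_single al_be_assoc)
qed (simp_all add: retract_add tmult_add)

text \<open>\<open>be 1\<close> - 1 divides \<open>be n\<close> - 1 for every integer n, by a
  telescoping sum in either direction from 0.\<close>

lemma mult_be_power: "\<exists>z. tmult (ew \<theta>) x (be n) - x = mult_be \<theta> z"
proof (induction n rule: int_induct[where k = 0])
  case base
  show ?case using mult_al_be(11) by (intro exI[of _ 0]) simp
next
  case (step1 i)
  then obtain z where "tmult (ew \<theta>) x (be i) - x = mult_be \<theta> z" by blast
  then have "tmult (ew \<theta>) x (be (i + 1)) - x = mult_be \<theta> (z + tmult (ew \<theta>) x (be i))"
    unfolding mult_al_be(3) by (simp add: mult_be_def al_be_assoc algebra_simps)
  then show ?case ..
next
  case (step2 i)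
  then obtain z where z: "tmult (ew \<theta>) x (be i) - x = mult_be \<theta> z" by blast
  have "tmult (ew \<theta>) x (be (i - 1)) - x = mult_be \<theta> (z + - tmult (ew \<theta>) x (be (i - 1)))"
    unfolding mult_al_be(3,4) z[symmetric] by (simp add: mult_be_def al_be_assoc algebra_simps)
  then show ?case ..
qed

lemma mult_al_power: "\<exists>z. tmult (ew \<theta>) x (al n) - x = mult_al \<theta> z"
proof (induction n rule: int_induct[where k = 0])
  case base
  show ?case using mult_al_be(10) by (intro exI[of _ 0]) simp
next
  case (step1 i)
  then obtain z where "tmult (ew \<theta>) x (al i) - x = mult_al \<theta> z" by blast
  then have "tmult (ew \<theta>) x (al (i + 1)) - x = mult_al \<theta> (z + tmult (ew \<theta>) x (al i))"
    unfolding mult_al_be(1) by (simp add: mult_al_def al_be_assoc algebra_simps)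
  then show ?case ..
next
  case (step2 i)
  then obtain z where z: "tmult (ew \<theta>) x (al i) - x = mult_al \<theta> z" by blast
  have "tmult (ew \<theta>) x (al (i - 1)) - x = mult_al \<theta> (z + - tmult (ew \<theta>) x (al (i - 1)))"
    unfolding mult_al_be(1,2) z[symmetric] by (simp add: mult_al_def al_be_assoc algebra_simps)
  then show ?case ..
qed

lemma retract_be_diff: "\<exists>z. x = mult_be \<theta> z + retract_be \<theta> x"
proof (induction x rule: free_induct)
  case (single g c)
  obtain z where "tmult (ew \<theta>) (Poly_Mapping.single g c) (be (snd (snd g))) - Poly_Mapping.single g c = mult_be \<theta> z"
    using mult_be_power by blast
  then have "Poly_Mapping.single g c = mult_be \<theta> (- z) + retract_be \<theta> (Poly_Mapping.single g c)"
    unfolding mult_al_be(4) retract_single by (metis add.commute add_diff_cancel diff_conv_add_uminus minus_diff_eq diff_add_cancel)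
  then show ?case ..
next
  case (add x y)
  then obtain z z' where "x = mult_be \<theta> z + retract_be \<theta> x" "y = mult_be \<theta> z' + retract_be \<theta> y" by blast
  then have "x + y = mult_be \<theta> (z + z') + retract_be \<theta> (x + y)"
    unfolding mult_al_be(3) retract_add by (metis add.assoc add.left_commute)
  then show ?case ..
next
  case zero
  show ?case using mult_al_be(11) by (intro exI[of _ 0]) (simp add: retract_add)
qed

lemma retract_al_diff: "\<exists>z. x = mult_al \<theta> z + retract_al \<theta> x"
proof (induction x rule: free_induct)
  case (single g c)
  obtain z where "tmult (ew \<theta>) (Poly_Mapping.single g c) (al (fst (snd g))) - Poly_Mapping.single g c = mult_al \<theta> z"
    using mult_al_power by blast
  then have "Poly_Mapping.single g c = mult_al \<theta> (- z) + retract_al \<theta> (Poly_Mapping.single g c)"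
    unfolding mult_al_be(2) retract_single by (metis add.commute add_diff_cancel diff_conv_add_uminus minus_diff_eq diff_add_cancel)
  then show ?case ..
next
  case (add x y)
  then obtain z z' where "x = mult_al \<theta> z + retract_al \<theta> x" "y = mult_al \<theta> z' + retract_al \<theta> y" by blast
  then have "x + y = mult_al \<theta> (z + z') + retract_al \<theta> (x + y)"
    unfolding mult_al_be(1) retract_add by (metis add.assoc add.left_commute)
  then show ?case ..
next
  case zero
  show ?case using mult_al_be(10) by (intro exI[of _ 0]) (simp add: retract_add)
qed

section \<open>The multiplication map of the torus and exactness of the Koszul complex\<close>

definition augment :: "real \<Rightarrow> env_elem \<Rightarrow> (int \<times> int \<Rightarrow>\<^sub>0 complex)" where
  "augment \<theta> = weighted_push (\<lambda>g. fst g + snd g) (\<lambda>g. tw \<theta> (fst g) (snd g))"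

lemma augment_simps:
  "augment \<theta> (Poly_Mapping.single (p, q) c) = Poly_Mapping.single (p + q) (tw \<theta> p q * c)"
  "augment \<theta> (x + y) = augment \<theta> x + augment \<theta> y"
  "augment \<theta> (x - y) = augment \<theta> x - augment \<theta> y"
  "augment \<theta> 0 = 0"
  "augment \<theta> (Poly_Mapping.map ((*) c) x) = Poly_Mapping.map ((*) c) (augment \<theta> x)"
  by (simp_all add: augment_def weighted_push_scale)

lemma augment_tens:
  "augment \<theta> (tmult (ew \<theta>) (tens \<theta> x y) z) = tmult (tw \<theta>) (tmult (tw \<theta>) x (augment \<theta> z)) y"
proof (induction z rule: free_induct)
  case (single g c)
  obtain p' q' where g: "g = (p', q')" by (cases g)
  show ?case unfolding g
  proof (induction x rule: free_induct)
    case (single p a)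
    show ?case
    proof (induction y rule: free_induct)
      case (single q b)
      show ?case
        by (simp add: augment_simps tens_simps env_weight_def torus.w_add_left torus.w_add_right mult_ac add_ac)
    qed (simp_all add: tens_simps tmult_add augment_simps)
  qed (simp_all add: tens_simps tmult_add augment_simps)
qed (simp_all add: tens_simps tmult_add augment_simps)

text \<open>Multiplying e_p \<otimes> e_q by e_r \<otimes> e_(-r) on the right inserts e_r e_(-r)
  between the legs, and this product is 1 when \<open>tw \<theta> r r = 1\<close>.\<close>

lemma augment_al_be:
  "augment \<theta> (tmult (ew \<theta>) x (al m)) = augment \<theta> x" "augment \<theta> (tmult (ew \<theta>) x (be n)) = augment \<theta> x"
proof -
  have "augment \<theta> (tmult (ew \<theta>) x (Poly_Mapping.single (r, - r) 1)) = augment \<theta> x" if "tw \<theta> r r = 1" for r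
  proof (induction x rule: free_induct)
    case (single g c)
    obtain p q where g: "g = (p, q)" by (cases g)
    have "p + r + (q - r) = p + q" by simp
    have e: "tw \<theta> p q * tw \<theta> r q * inverse (tw \<theta> p r) * (tw \<theta> p r * inverse (tw \<theta> r q) * c) = tw \<theta> p q * c"
      using torus.w_nonzero[of \<theta> p r] torus.w_nonzero[of \<theta> r q] by (simp add: field_simps)
    show ?case
      using that \<open>p + r + (q - r) = p + q\<close>
      by (simp add: e g augment_simps env_weight_def torus.w_add_left torus.w_add_right torus.w_minus
          diff_conv_add_uminus del: add_uminus_conv_diff)
  qed (simp_all add: tmult_add augment_simps)
  from this[of "(m, 0)"] this[of "(0, n)"]
  show "augment \<theta> (tmult (ew \<theta>) x (al m)) = augment \<theta> x" "augment \<theta> (tmult (ew \<theta>) x (be n)) = augment \<theta> x"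
    by (simp_all add: al_def be_def tw_eq)
qed

lemma augment_flip: "augment \<theta> (flip x) = flip (augment \<theta> x)"
proof (induction x rule: free_induct)
  case (single g c)
  obtain p q where g: "g = (p, q)" by (cases g)
  have "- p - q = - (p + q)" by simp
  then show ?case unfolding g push_forward_simps uminus_Pair augment_simps by simp
qed (simp_all add: augment_simps)

lemma augment_left_emb: "augment \<theta> (left_emb x) = x"
  by (induction x rule: free_induct) (simp_all add: augment_simps)

text \<open>The two retractions bring the second leg to degree 0 by factors that the multiplication
  map does not see, and x \<otimes> 1 is determined by its product x.\<close>

lemma retract_retract: "retract_al \<theta> (retract_be \<theta> x) = left_emb (augment \<theta> x)"
proof (induction x rule: free_induct)
  case (single g c)
  obtain p q where g: "g = (p, q)" by (cases g)
  let ?y = "retract_al \<theta> (retract_be \<theta> (Poly_Mapping.single g c))"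
  obtain p' c' where y: "?y = Poly_Mapping.single (p', 0) c'"
    by (cases q) (auto simp: g retract_be_def retract_al_def zero_prod_def)
  have "retract_be \<theta> (Poly_Mapping.single g c) = Poly_Mapping.single (g + ((0, snd q), (0, - snd q))) (ew \<theta> g ((0, snd q), (0, - snd q)) * c)"
    by (simp add: retract_be_def g)
  then obtain g' d where g': "retract_be \<theta> (Poly_Mapping.single g c) = Poly_Mapping.single g' d" by blast
  have "augment \<theta> ?y = augment \<theta> (Poly_Mapping.single g c)"
    by (metis g' retract_single augment_al_be)
  moreover have "?y = left_emb (augment \<theta> ?y)" unfolding y by (simp add: augment_simps)
  ultimately show ?case by simp
qed (simp_all add: retract_add augment_simps)

text \<open>An element differs from its retraction along \<open>be\<close> by an image of
  \<open>mult_be\<close>, and that from its retraction along \<open>al\<close> by an image of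
  \<open>mult_al\<close>. What remains after both is determined by the product.\<close>

lemma koszul_exact_0:
  "augment \<theta> x = 0 \<longleftrightarrow> (\<exists>a b. x = mult_al \<theta> a + mult_be \<theta> b)"
proof
  assume "augment \<theta> x = 0"
  then have "retract_al \<theta> (retract_be \<theta> x) = 0" by (simp add: retract_retract)
  moreover obtain b where "x = mult_be \<theta> b + retract_be \<theta> x" using retract_be_diff by blast
  moreover obtain a where "retract_be \<theta> x = mult_al \<theta> a + retract_al \<theta> (retract_be \<theta> x)" using retract_al_diff by blast
  ultimately have "x = mult_al \<theta> a + mult_be \<theta> b" by (metis add.commute add.right_neutral)
  then show "\<exists>a b. x = mult_al \<theta> a + mult_be \<theta> b" by blast
qed (auto simp: mult_al_def mult_be_def augment_simps augment_al_be)

text \<open>\<open>mult_al\<close> remains injective modulo the image of \<open>mult_be\<close>: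
  \<open>retract_be\<close> commutes with \<open>mult_al\<close> and kills the term in b, so it
  kills a. Afterwards \<open>mult_be\<close> is cancelled.\<close>

lemma koszul_exact_1:
  assumes "mult_al \<theta> a + mult_be \<theta> b = 0"
  shows "\<exists>z. a = mult_be \<theta> z \<and> b = - mult_al \<theta> z"
proof -
  have "retract_be \<theta> (mult_al \<theta> a + mult_be \<theta> b) = mult_al \<theta> (retract_be \<theta> a)"
    by (simp add: retract_add mult_al_def mult_be_def retract_be_al retract_be_be)
  then have "retract_be \<theta> a = 0"
    using assms mult_al_eq_0 by (simp add: retract_add)
  then obtain z where z: "a = mult_be \<theta> z" using retract_be_diff[of a \<theta>] by auto
  have "mult_be \<theta> (mult_al \<theta> z + b) = 0"
    using assms unfolding mult_al_be(3,9) z .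
  then have "mult_al \<theta> z + b = 0" by (rule mult_be_eq_0)
  then show ?thesis using z by (auto simp: add_eq_0_iff)
qed

section \<open>Equivariance and the resolution of the pillow\<close>

text \<open>With y the image of x under an involution, this projects onto the fixed points. The
  image is passed as an argument because the involution varies with the degree and the
  component.\<close>

definition half_sum :: "('g \<Rightarrow>\<^sub>0 complex) \<Rightarrow> ('g \<Rightarrow>\<^sub>0 complex) \<Rightarrow> ('g \<Rightarrow>\<^sub>0 complex)" where
  "half_sum x y = Poly_Mapping.map ((*) (1/2)) (x + y)"

lemma half_sum_self [simp]: "half_sum x x = x"
  unfolding half_sum_def by (rule scale_half_double)

lemma half_sum_eq: "half_sum x y = x \<longleftrightarrow> y = x"
proof
  assume "half_sum x y = x"
  moreover have "Poly_Mapping.lookup (half_sum x y) k = (Poly_Mapping.lookup x k + Poly_Mapping.lookup y k) / 2" for k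
    unfolding half_sum_def lookup_scale lookup_add by simp
  ultimately show "y = x"
    by (intro poly_mapping_eqI) (simp add: field_simps)
qed simp

lemma half_sum_add: "half_sum (x + x') (y + y') = half_sum x y + half_sum x' y'"
  by (simp add: half_sum_def add_ac)

lemma half_sum_tmult: "half_sum (tmult (ew \<theta>) z x) (tmult (ew \<theta>) z y) = tmult (ew \<theta>) z (half_sum x y)"
  unfolding half_sum_def env.scale_tmult tmult_add ..

text \<open>The differentials commute with the flip when it acts in homological degree one by
  \<open>x \<mapsto> - flip(x) al\<inverse>\<close>, \<open>y \<mapsto> - flip(y) be\<inverse>\<close>, and in degree two by \<open>z \<mapsto> flip(z) al\<inverse> be\<inverse>\<close>.\<close>

definition flip_al :: "real \<Rightarrow> env_elem \<Rightarrow> env_elem" where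
  "flip_al \<theta> x = - tmult (ew \<theta>) (flip x) (al (- 1))"

definition flip_be :: "real \<Rightarrow> env_elem \<Rightarrow> env_elem" where
  "flip_be \<theta> x = - tmult (ew \<theta>) (flip x) (be (- 1))"

definition flip_albe :: "real \<Rightarrow> env_elem \<Rightarrow> env_elem" where
  "flip_albe \<theta> x = tmult (ew \<theta>) (tmult (ew \<theta>) (flip x) (al (- 1))) (be (- 1))"

lemma flip_twisted_add:
  "flip_al \<theta> (x + y) = flip_al \<theta> x + flip_al \<theta> y"
  "flip_be \<theta> (x + y) = flip_be \<theta> x + flip_be \<theta> y"
  "flip_albe \<theta> (x + y) = flip_albe \<theta> x + flip_albe \<theta> y"
  by (simp_all add: flip_al_def flip_be_def flip_albe_def tmult_add)

lemma flip_twisted_scale: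
  "flip_al \<theta> (Poly_Mapping.map ((*) c) x) = Poly_Mapping.map ((*) c) (flip_al \<theta> x)"
  "flip_be \<theta> (Poly_Mapping.map ((*) c) x) = Poly_Mapping.map ((*) c) (flip_be \<theta> x)"
  "flip_albe \<theta> (Poly_Mapping.map ((*) c) x) = Poly_Mapping.map ((*) c) (flip_albe \<theta> x)"
proof -
  have m: "Poly_Mapping.map ((*) (c::complex)) (- z) = - Poly_Mapping.map ((*) c) z" for z :: env_elem
    using scale_diff[of c 0 z] by simp
  show "flip_al \<theta> (Poly_Mapping.map ((*) c) x) = Poly_Mapping.map ((*) c) (flip_al \<theta> x)"
    "flip_be \<theta> (Poly_Mapping.map ((*) c) x) = Poly_Mapping.map ((*) c) (flip_be \<theta> x)"
    "flip_albe \<theta> (Poly_Mapping.map ((*) c) x) = Poly_Mapping.map ((*) c) (flip_albe \<theta> x)"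
    by (simp_all add: flip_al_def flip_be_def flip_albe_def env.scale_tmult push_forward_scale m)
qed

text \<open>The flip inverts \<open>al\<close> and \<open>be\<close>, so the factors from two
  applications cancel.\<close>

lemma flip_twisted_involutive:
  "flip_al \<theta> (flip_al \<theta> x) = x" "flip_be \<theta> (flip_be \<theta> x) = x" "flip_albe \<theta> (flip_albe \<theta> x) = x"
  by (simp_all add: flip_al_def flip_be_def flip_albe_def env.flip_tmult al_be al_be_assoc flip_flip tmult_minus)

lemma flip_twisted_tmult:
  assumes "flip y = y"
  shows "flip (tmult (ew \<theta>) y x) = tmult (ew \<theta>) y (flip x)"
    "flip_al \<theta> (tmult (ew \<theta>) y x) = tmult (ew \<theta>) y (flip_al \<theta> x)"
    "flip_be \<theta> (tmult (ew \<theta>) y x) = tmult (ew \<theta>) y (flip_be \<theta> x)"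
    "flip_albe \<theta> (tmult (ew \<theta>) y x) = tmult (ew \<theta>) y (flip_albe \<theta> x)"
  using assms by (simp_all add: flip_al_def flip_be_def flip_albe_def env.flip_tmult env.tmult_assoc tmult_minus)

text \<open>With \<alpha> = \<open>al 1\<close>, flip(x (\<alpha> - 1)) = flip(x) (\<alpha>^-1 - 1)
  = -flip(x) \<alpha>^-1 (\<alpha> - 1). The sign and the factor in the twisted flips are read off
  from this identity.\<close>

lemma koszul_equivariant:
  "flip (mult_al \<theta> x) = mult_al \<theta> (flip_al \<theta> x)"
  "flip (mult_be \<theta> x) = mult_be \<theta> (flip_be \<theta> x)"
  "flip_al \<theta> (mult_be \<theta> x) = mult_be \<theta> (flip_albe \<theta> x)"
  "flip_be \<theta> (mult_al \<theta> x) = mult_al \<theta> (flip_albe \<theta> x)"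
  by (simp_all add: mult_al_def mult_be_def flip_al_def flip_be_def flip_albe_def env.flip_tmult al_be al_be_assoc
      tmult_distribs)

text \<open>One type of pairs carries all degrees: in degrees 0 and 2 the module E sits in the first
  component, and the projection also clears the second.\<close>

fun proj :: "real \<Rightarrow> nat \<Rightarrow> env_elem \<times> env_elem \<Rightarrow> env_elem \<times> env_elem" where
  "proj \<theta> 0 (x, y) = (half_sum x (flip x), 0)"
| "proj \<theta> (Suc 0) (x, y) = (half_sum x (flip_al \<theta> x), half_sum y (flip_be \<theta> y))"
| "proj \<theta> (Suc (Suc 0)) (x, y) = (half_sum x (flip_albe \<theta> x), 0)"
| "proj \<theta> (Suc (Suc (Suc _))) _ = (0, 0)"

text \<open>\<open>koszul \<theta> i\<close> goes from degree i + 1 to degree i. The sign in the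
  second map makes the composite vanish, since the two multiplications commute.\<close>

fun koszul :: "real \<Rightarrow> nat \<Rightarrow> env_elem \<times> env_elem \<Rightarrow> env_elem \<times> env_elem" where
  "koszul \<theta> 0 (x, y) = (mult_al \<theta> x + mult_be \<theta> y, 0)"
| "koszul \<theta> (Suc 0) (x, y) = (mult_be \<theta> x, - mult_al \<theta> x)"
| "koszul \<theta> (Suc (Suc _)) _ = (0, 0)"

lemma proj_fixed:
  "proj \<theta> 0 (x, y) = (x, y) \<longleftrightarrow> flip x = x \<and> y = 0"
  "proj \<theta> (Suc 0) (x, y) = (x, y) \<longleftrightarrow> flip_al \<theta> x = x \<and> flip_be \<theta> y = y"
  "proj \<theta> (Suc (Suc 0)) (x, y) = (x, y) \<longleftrightarrow> flip_albe \<theta> x = x \<and> y = 0"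
  "proj \<theta> (Suc (Suc (Suc i))) v = v \<longleftrightarrow> v = 0"
  by (auto simp: half_sum_eq zero_prod_def)

lemma half_sum_fixed:
  "flip (half_sum x (flip x)) = half_sum x (flip x)"
  "flip_al \<theta> (half_sum y (flip_al \<theta> y)) = half_sum y (flip_al \<theta> y)"
  "flip_be \<theta> (half_sum y (flip_be \<theta> y)) = half_sum y (flip_be \<theta> y)"
  "flip_albe \<theta> (half_sum y (flip_albe \<theta> y)) = half_sum y (flip_albe \<theta> y)"
  by (simp_all only: half_sum_def push_forward_scale push_forward_simps flip_flip flip_twisted_add
      flip_twisted_scale flip_twisted_involutive add.commute)

lemma proj_proj: "proj \<theta> i (proj \<theta> i v) = proj \<theta> i v"
  by (cases "(\<theta>, i, v)" rule: proj.cases) (simp_all add: half_sum_fixed push_forward_simps)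

definition env_act :: "real \<Rightarrow> (torus_elem \<times> torus_elem \<Rightarrow>\<^sub>0 complex) set \<Rightarrow> env_elem \<times> env_elem \<Rightarrow> env_elem \<times> env_elem" where
  "env_act \<theta> K v = (tmult (ew \<theta>) (env_model \<theta> K) (fst v), tmult (ew \<theta>) (env_model \<theta> K) (snd v))"

interpretation env_action: module_action "env_ring \<theta>" "env_act \<theta>" for \<theta>
proof -
  interpret T: complex_algebra "env_ring \<theta>"
    by (intro complex_algebra_tensor pillow.complex_algebra_axioms complex_algebra_opposite)
  show "module_action (env_ring \<theta>) (env_act \<theta>)"
    by unfold_locales
      (simp_all add: env_act_def env_model_simps env_model_one tmult_add env.tmult_assoc del: single_one)
qed

lemma flip_env_model: "K \<in> carrier (env_ring \<theta>) \<Longrightarrow> flip (env_model \<theta> K) = env_model \<theta> K"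
  by (simp add: env_model_simps(3,4) flip: flip1_flip2(1))

text \<open>The ring acts from the left through flip-invariant elements, while the twisted flips
  differ from the flip only by a sign and by factors on the right.\<close>

lemma equivariant_proj: "env_action.equivariant \<theta> (proj \<theta> i)"
  unfolding env_action.equivariant_def
proof (intro conjI allI ballI)
  fix v v'
  show "proj \<theta> i (v + v') = proj \<theta> i v + proj \<theta> i v'"
    by (cases "(\<theta>, i, v)" rule: proj.cases; cases v') (simp_all add: half_sum_add flip_twisted_add)
next
  fix K v assume K: "K \<in> carrier (env_ring \<theta>)"
  show "proj \<theta> i (env_act \<theta> K v) = env_act \<theta> K (proj \<theta> i v)"
    by (cases "(\<theta>, i, v)" rule: proj.cases)
      (simp_all add: env_act_def flip_twisted_tmult[OF flip_env_model[OF K]] half_sum_tmult)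
qed

lemma equivariant_koszul: "env_action.equivariant \<theta> (koszul \<theta> i)"
  unfolding env_action.equivariant_def
proof (intro conjI allI ballI)
  fix v v'
  show "koszul \<theta> i (v + v') = koszul \<theta> i v + koszul \<theta> i v'"
    by (cases "(\<theta>, i, v)" rule: koszul.cases; cases v') (simp_all add: mult_al_be)
next
  fix K v assume K: "K \<in> carrier (env_ring \<theta>)"
  show "koszul \<theta> i (env_act \<theta> K v) = env_act \<theta> K (koszul \<theta> i v)"
    by (cases "(\<theta>, i, v)" rule: koszul.cases) (simp_all add: env_act_def mult_al_be tmult_distribs)
qed

section \<open>E as a module over its doubly fixed part\<close>

definition trace1 :: "env_elem \<Rightarrow> env_elem" where "trace1 x = x + flip1 x"

definition trace2 :: "env_elem \<Rightarrow> env_elem" where "trace2 x = x + flip2 x"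

text \<open>The functionals of two successive Galois extensions: E over the part fixed by
  \<open>flip1\<close>, then over the part fixed by both flips. Multiplication is reversed in the
  second leg, so \<open>galois_u\<close> and \<open>galois_v\<close> exchange roles there.\<close>

definition coord_env :: "real \<Rightarrow> nat \<times> nat \<Rightarrow> env_elem \<Rightarrow> env_elem" where
  "coord_env \<theta> kl x = trace2 (tmult (ew \<theta>) (trace1 (tmult (ew \<theta>) x (left_emb (galois_v \<theta> (fst kl))))) (right_emb (galois_u (snd kl))))"

definition gen_env :: "real \<Rightarrow> nat \<times> nat \<Rightarrow> env_elem" where
  "gen_env \<theta> kl = tmult (ew \<theta>) (right_emb (galois_v \<theta> (snd kl))) (left_emb (galois_u (fst kl)))"

lemma coord_env_fixed: "flip1 (coord_env \<theta> kl x) = coord_env \<theta> kl x" "flip2 (coord_env \<theta> kl x) = coord_env \<theta> kl x"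
proof -
  have c: "flip1 (flip2 y) = flip2 (flip1 y)" for y :: env_elem by (simp add: flip1_flip2)
  show "flip2 (coord_env \<theta> kl x) = coord_env \<theta> kl x"
    by (simp add: coord_env_def trace2_def flip_flip add.commute)
  have t: "flip1 (trace1 y) = trace1 y" for y by (simp add: trace1_def flip_flip add.commute)
  show "flip1 (coord_env \<theta> kl x) = coord_env \<theta> kl x"
    by (simp add: coord_env_def trace2_def c flip1_mult t flip_emb)
qed

lemma coord_env_add: "coord_env \<theta> kl (x + y) = coord_env \<theta> kl x + coord_env \<theta> kl y"
  by (simp add: coord_env_def trace1_def trace2_def tmult_add add_ac)

lemma coord_env_tmult:
  assumes "flip1 y = y" "flip2 y = y"
  shows "coord_env \<theta> kl (tmult (ew \<theta>) y x) = tmult (ew \<theta>) y (coord_env \<theta> kl x)"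
proof -
  have "trace1 (tmult (ew \<theta>) y z) = tmult (ew \<theta>) y (trace1 z)" "trace2 (tmult (ew \<theta>) y z) = tmult (ew \<theta>) y (trace2 z)" for z
    by (simp_all add: trace1_def trace2_def flip1_mult flip2_mult assms tmult_add)
  then show ?thesis by (simp add: coord_env_def env.tmult_assoc)
qed

lemma coord_env_expansion:
  assumes "\<theta> \<notin> \<rat>"
  shows "(\<Sum>kl\<in>{..<4} \<times> {..<4}. tmult (ew \<theta>) (coord_env \<theta> kl x) (gen_env \<theta> kl)) = x"
proof -
  let ?v = "galois_v \<theta>" and ?m = "tmult (ew \<theta>)"
  have 1: "(\<Sum>k<4. ?m (trace1 (?m x (left_emb (?v k)))) (left_emb (galois_u k))) = x" for x
    unfolding trace1_def
  proof (rule env.trace_expansion[OF flip1_mult])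
    have "left_emb (Poly_Mapping.single 0 1) = Poly_Mapping.single (0 :: (int \<times> int) \<times> (int \<times> int)) (1::complex)"
      by (simp add: zero_prod_def del: single_one)
    then show "(\<Sum>k<4. ?m (left_emb (?v k)) (left_emb (galois_u k))) = Poly_Mapping.single 0 1"
      unfolding left_emb_mult[symmetric] push_forward_sum[symmetric] galois(1)[OF assms] .
    show "(\<Sum>k<4. ?m (flip1 (left_emb (?v k))) (left_emb (galois_u k))) = 0"
      unfolding flip_emb left_emb_mult[symmetric] push_forward_sum[symmetric] galois(2)[OF assms] by simp
  qed
  have 2: "(\<Sum>l<4. ?m (trace2 (?m x (right_emb (galois_u l)))) (right_emb (?v l))) = x" for x
    unfolding trace2_def
  proof (rule env.trace_expansion[OF flip2_mult])
    have "right_emb (Poly_Mapping.single 0 1) = Poly_Mapping.single (0 :: (int \<times> int) \<times> (int \<times> int)) (1::complex)"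
      by (simp add: zero_prod_def del: single_one)
    then show "(\<Sum>k<4. ?m (right_emb (galois_u k)) (right_emb (?v k))) = Poly_Mapping.single 0 1"
      unfolding right_emb_mult[symmetric] push_forward_sum[symmetric] galois(1)[OF assms] .
    \<comment> \<open>The reversed leg requires \<Sum> v_k flip(u_k) = 0, which is the flip of the
      second identity of \<open>galois\<close>.\<close>
    have "tmult (tw \<theta>) (?v k) (flip (galois_u k)) = flip (tmult (tw \<theta>) (flip (?v k)) (galois_u k))" for k
      by (simp add: torus.flip_tmult flip_flip)
    then show "(\<Sum>k<4. ?m (flip2 (right_emb (galois_u k))) (right_emb (?v k))) = 0"
      unfolding flip_emb right_emb_mult[symmetric] push_forward_sum[symmetric] by (simp add: galois(2)[OF assms] flip: push_forward_sum)
  qed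
  have "(\<Sum>kl\<in>{..<4} \<times> {..<4}. ?m (coord_env \<theta> kl x) (gen_env \<theta> kl)) =
      (\<Sum>k<4. \<Sum>l<4. ?m (?m (trace2 (?m (trace1 (?m x (left_emb (?v k)))) (right_emb (galois_u l)))) (right_emb (?v l))) (left_emb (galois_u k)))"
    by (simp add: sum.cartesian_product case_prod_beta coord_env_def gen_env_def env.tmult_assoc)
  also have "\<dots> = (\<Sum>k<4. ?m (trace1 (?m x (left_emb (?v k)))) (left_emb (galois_u k)))"
    unfolding tmult_sum(2)[symmetric] 2 ..
  finally show ?thesis unfolding 1 .
qed

text \<open>The boolean index selects a component of the pair, with the 16 generators of E repeated
  in each.\<close>

lemma env_dual_basis:
  assumes "\<theta> \<notin> \<rat>"
  shows "dual_basis (env_ring \<theta>) (env_act \<theta>) (({..<4} \<times> {..<4}) \<times> UNIV)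
    (\<lambda>(kl, b) v. of_env_model \<theta> (coord_env \<theta> kl (if b then fst v else snd v)))
    (\<lambda>(kl, b). if b then (gen_env \<theta> kl, 0) else (0, gen_env \<theta> kl))"
proof (unfold_locales, goal_cases)
  case 1
  show ?case by simp
next
  case (2 i x)
  show ?case by (simp add: of_env_model_closed case_prod_beta)
next
  case (3 i x y)
  show ?case by (simp add: coord_env_add of_env_model_add case_prod_beta)
next
  case (4 i K x)
  then show ?case
    by (simp add: case_prod_beta env_act_def coord_env_tmult env_model_simps of_env_model_mult coord_env_fixed)
next
  case (5 v)
  have split: "(\<Sum>i\<in>A \<times> (UNIV :: bool set). F i) = (\<Sum>kl\<in>A. F (kl, True) + F (kl, False))"
    for F :: "_ \<Rightarrow> env_elem \<times> env_elem" and A :: "(nat \<times> nat) set"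
  proof -
    have "(\<Sum>i\<in>A \<times> (UNIV :: bool set). F i) = (\<Sum>kl\<in>A. \<Sum>b\<in>UNIV. F (kl, b))"
      by (simp add: sum.cartesian_product)
    then show ?thesis by (simp add: UNIV_bool add.commute)
  qed
  have "(\<Sum>i\<in>({..<4} \<times> {..<4}) \<times> UNIV. env_act \<theta> ((\<lambda>(kl, b) v. of_env_model \<theta> (coord_env \<theta> kl (if b then fst v else snd v))) i v)
        ((\<lambda>(kl, b). if b then (gen_env \<theta> kl, 0) else (0, gen_env \<theta> kl)) i)) =
     (\<Sum>kl\<in>{..<4} \<times> {..<4}. (tmult (ew \<theta>) (coord_env \<theta> kl (fst v)) (gen_env \<theta> kl), tmult (ew \<theta>) (coord_env \<theta> kl (snd v)) (gen_env \<theta> kl)))"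
    unfolding split by (simp add: env_act_def env_model_of_env_model coord_env_fixed)
  also have "\<dots> = v"
    using coord_env_expansion[OF assms] by (simp add: sum_prod)
  finally show ?case .
qed

section \<open>Exactness on invariants and smoothness of the pillow\<close>

lemma augment_env_hom:
  assumes "f \<in> pairs \<theta>" "K \<in> carrier (nc_pillow \<theta>)" "augment \<theta> x = torus_model \<theta> K"
  shows "augment \<theta> (tmult (ew \<theta>) (env_hom \<theta> f) x) = torus_model \<theta> (sandwich (nc_pillow \<theta>) f K)"
proof -
  from assms(1) have "Poly_Mapping.keys f \<subseteq> carrier (nc_pillow \<theta>) \<times> carrier (nc_pillow \<theta>)" by simp
  then show ?thesis
  proof (induction f rule: poly_mapping_single_induct)
    case zero
    show ?case by (simp add: pillow.sandwich_zero torus_model_pillow augment_simps)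
  next
    case (single k c)
    then show ?case using assms(2,3)
      by (auto simp: pillow.sandwich_single torus_model_pillow env.scale_tmult augment_simps augment_tens)
  next
    case (add f g)
    then show ?case using assms(2)
      by (simp add: pillow.sandwich_add pillow.sandwich_closed torus_model_pillow augment_simps tmult_add)
  qed
qed

definition pillow_augment :: "real \<Rightarrow> env_elem \<times> env_elem \<Rightarrow> torus_elem" where
  "pillow_augment \<theta> v = of_model \<theta> (augment \<theta> (fst v))"

lemma pillow_augment_closed:
  assumes "flip (fst v) = fst v"
  shows "pillow_augment \<theta> v \<in> carrier (nc_pillow \<theta>)"
  by (simp add: pillow_augment_def pillow_simps augment_flip[symmetric] assms)

lemma pillow_augment_act:
  assumes "K \<in> carrier (env_ring \<theta>)" "flip (fst v) = fst v"
  shows "pillow_augment \<theta> (env_act \<theta> K v) = K \<odot>\<^bsub>diagonal_bimodule (nc_pillow \<theta>)\<^esub> pillow_augment \<theta> v"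
proof -
  obtain f where f: "f \<in> pairs \<theta>" "K = pillow.tensor_class \<theta> f"
    using assms(1) unfolding pillow.tensor_class_simps(1) by blast
  let ?y = "pillow_augment \<theta> v"
  have y: "?y \<in> carrier (nc_pillow \<theta>)" by (rule pillow_augment_closed[OF assms(2)])
  have s: "sandwich (nc_pillow \<theta>) f ?y \<in> carrier (nc_pillow \<theta>)"
    using f(1) y by (intro pillow.sandwich_closed) auto
  have "pillow_augment \<theta> (env_act \<theta> K v) = of_model \<theta> (torus_model \<theta> (sandwich (nc_pillow \<theta>) f ?y))"
    using augment_env_hom[OF f(1) y, of "fst v"]
    by (simp add: pillow_augment_def[of \<theta> "env_act \<theta> K v"] env_act_def f(2) env_model_class[OF f(1)])
       (simp add: pillow_augment_def)
  also have "\<dots> = sandwich (nc_pillow \<theta>) f ?y"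
    using s by (simp add: pillow_simps)
  also have "\<dots> = K \<odot>\<^bsub>diagonal_bimodule (nc_pillow \<theta>)\<^esub> ?y"
    unfolding f(2) by (rule pillow.diagonal_smult_class[symmetric]) (use f(1) y in auto)
  finally show ?thesis .
qed

lemma pillow_augment_eq_0: "pillow_augment \<theta> v = \<zero>\<^bsub>nc_pillow \<theta>\<^esub> \<longleftrightarrow> augment \<theta> (fst v) = 0"
  unfolding pillow_augment_def pillow_simps
  by (metis of_model_simps(3) torus_model_of_model)

lemma koszul_fixed_0:
  "koszul \<theta> 0 ` {v. proj \<theta> 1 v = v} = {v. proj \<theta> 0 v = v \<and> pillow_augment \<theta> v = \<zero>\<^bsub>nc_pillow \<theta>\<^esub>}"
proof (intro equalityI subsetI)
  fix v assume "v \<in> koszul \<theta> 0 ` {v. proj \<theta> 1 v = v}"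
  then obtain a b where "flip_al \<theta> a = a" "flip_be \<theta> b = b" "v = (mult_al \<theta> a + mult_be \<theta> b, 0)"
    by (auto simp: proj_fixed simp del: proj.simps)
  then show "v \<in> {v. proj \<theta> 0 v = v \<and> pillow_augment \<theta> v = \<zero>\<^bsub>nc_pillow \<theta>\<^esub>}"
    using koszul_exact_0 by (auto simp: proj_fixed koszul_equivariant pillow_augment_eq_0 simp del: proj.simps)
next
  fix v assume "v \<in> {v. proj \<theta> 0 v = v \<and> pillow_augment \<theta> v = \<zero>\<^bsub>nc_pillow \<theta>\<^esub>}"
  then obtain x where v: "v = (x, 0)" "flip x = x" "augment \<theta> x = 0"
    by (cases v) (auto simp: proj_fixed pillow_augment_eq_0 simp del: proj.simps)
  then obtain a b where x: "x = mult_al \<theta> a + mult_be \<theta> b" using koszul_exact_0 by blast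
  \<comment> \<open>Averaging an arbitrary preimage under the twisted flips makes it invariant and
    keeps its image, since \<open>x\<close> equals its own average.\<close>
  let ?w = "(half_sum a (flip_al \<theta> a), half_sum b (flip_be \<theta> b))"
  have "half_sum x (flip x) = mult_al \<theta> (half_sum a (flip_al \<theta> a)) + mult_be \<theta> (half_sum b (flip_be \<theta> b))"
    unfolding x by (simp add: half_sum_add koszul_equivariant) (simp only: half_sum_def mult_al_be)
  then have "koszul \<theta> 0 ?w = v" using v by simp
  moreover have "proj \<theta> 1 ?w = ?w"
    unfolding One_nat_def proj_fixed by (simp add: half_sum_fixed)
  ultimately show "v \<in> koszul \<theta> 0 ` {v. proj \<theta> 1 v = v}" by (metis (mono_tags) image_eqI mem_Collect_eq)
qed

lemma koszul_fixed:
  "koszul \<theta> (Suc i) ` {v. proj \<theta> (Suc (Suc i)) v = v} = {v. proj \<theta> (Suc i) v = v \<and> koszul \<theta> i v = 0}"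
proof -
  consider "i = 0" | "i = Suc 0" | j where "i = Suc (Suc j)" by (metis not0_implies_Suc)
  then show ?thesis
  proof cases
    case 1
    show ?thesis unfolding 1
    proof (intro equalityI subsetI)
      fix v assume "v \<in> koszul \<theta> (Suc 0) ` {v. proj \<theta> (Suc (Suc 0)) v = v}"
      then obtain z where z: "flip_albe \<theta> z = z" "v = (mult_be \<theta> z, - mult_al \<theta> z)"
        by (auto simp: proj_fixed simp del: proj.simps)
      have "flip_be \<theta> (- y) = - flip_be \<theta> y" for y by (simp add: flip_be_def tmult_minus)
      then show "v \<in> {v. proj \<theta> (Suc 0) v = v \<and> koszul \<theta> 0 v = 0}"
        using z by (simp add: proj_fixed koszul_equivariant mult_al_be zero_prod_def del: proj.simps)
    next
      fix v assume "v \<in> {v. proj \<theta> (Suc 0) v = v \<and> koszul \<theta> 0 v = 0}"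
      then obtain a b where v: "v = (a, b)" "flip_al \<theta> a = a" "mult_al \<theta> a + mult_be \<theta> b = 0"
        by (cases v) (auto simp: proj_fixed zero_prod_def simp del: proj.simps)
      then obtain z where z: "a = mult_be \<theta> z" "b = - mult_al \<theta> z" using koszul_exact_1 by blast
      \<comment> \<open>Here the preimage is invariant without averaging: \<open>mult_be\<close> is
        injective, so invariance of \<open>a\<close> passes to \<open>z\<close>.\<close>
      have "mult_be \<theta> (flip_albe \<theta> z + - z) = 0"
        using v(2) unfolding mult_al_be(3,4) z(1) koszul_equivariant by simp
      then have "flip_albe \<theta> z + - z = 0" by (rule mult_be_eq_0)
      then have "proj \<theta> (Suc (Suc 0)) (z, 0) = (z, 0)" unfolding proj_fixed by simp
      moreover have "koszul \<theta> (Suc 0) (z, 0) = v" using v(1) z by simp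
      ultimately show "v \<in> koszul \<theta> (Suc 0) ` {v. proj \<theta> (Suc (Suc 0)) v = v}"
        by (metis (mono_tags) image_eqI mem_Collect_eq)
    qed
  next
    case 2
    \<comment> \<open>Degree 3 is zero, so exactness in degree 2 means injectivity of the last
      differential.\<close>
    have "v = 0" if "proj \<theta> (Suc (Suc 0)) v = v" "koszul \<theta> (Suc 0) v = 0" for v
    proof -
      obtain x y where v: "v = (x, y)" by (cases v)
      have "y = 0" using that(1) unfolding v proj_fixed by simp
      moreover have "x = 0" using that(2) mult_be_eq_0[of \<theta> x] unfolding v by (simp add: zero_prod_def)
      ultimately show ?thesis by (simp add: v zero_prod_def)
    qed
    then have "{v. proj \<theta> (Suc (Suc 0)) v = v \<and> koszul \<theta> (Suc 0) v = 0} = {0}"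
      using env_action.equivariantD(3)[OF equivariant_proj] env_action.equivariantD(3)[OF equivariant_koszul] by blast
    then show ?thesis
      unfolding 2 proj_fixed using env_action.equivariantD(3)[OF equivariant_koszul] by simp
  next
    case 3
    have "koszul \<theta> (Suc (Suc j)) v = 0" for v by (cases v) (simp add: zero_prod_def)
    then show ?thesis
      unfolding 3 proj_fixed using env_action.equivariantD(3)[OF equivariant_koszul] by auto
  qed
qed

lemma homologically_smooth_pillow:
  assumes "\<theta> \<notin> \<rat>"
  shows "homologically_smooth (nc_pillow \<theta>)"
  unfolding homologically_smooth_def
proof
  show "complex_algebra (nc_pillow \<theta>)" by (rule pillow.complex_algebra_axioms)
  let ?D = "diagonal_bimodule (nc_pillow \<theta>)"
  interpret dual_basis "env_ring \<theta>" "env_act \<theta>" "({..<4} \<times> {..<4}) \<times> UNIV"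
    "\<lambda>(kl, b) v. of_env_model \<theta> (coord_env \<theta> kl (if b then fst v else snd v))"
    "\<lambda>(kl, b). if b then (gen_env \<theta> kl, 0) else (0, gen_env \<theta> kl)"
    by (rule env_dual_basis[OF assms])
  have D: "carrier ?D = carrier (nc_pillow \<theta>)" "\<zero>\<^bsub>?D\<^esub> = \<zero>\<^bsub>nc_pillow \<theta>\<^esub>" "add ?D = add (nc_pillow \<theta>)"
    by (simp_all add: diagonal_bimodule_def)
  have fx: "flip (fst v) = fst v" if "proj \<theta> 0 v = v" for v
    using that by (cases v) (simp add: proj_fixed del: proj.simps)
  show "has_finite_fgp_resolution (env_ring \<theta>) ?D"
  proof (rule has_finite_fgp_resolution[where p = "proj \<theta>" and \<delta> = "koszul \<theta>" and e = "pillow_augment \<theta>" and N = 2])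
    show "proj \<theta> i v = 0" if "i > 2" for i v
    proof -
      have "i = Suc (Suc (Suc (i - 3)))" using that by simp
      then have "proj \<theta> i v = (0, 0)" by (metis proj.simps(4))
      then show ?thesis by (simp add: zero_prod_def)
    qed
    show "pillow_augment \<theta> v \<in> carrier ?D" if "proj \<theta> 0 v = v" for v
      unfolding D by (rule pillow_augment_closed[OF fx[OF that]])
    show "pillow_augment \<theta> (v + v') = pillow_augment \<theta> v \<oplus>\<^bsub>?D\<^esub> pillow_augment \<theta> v'" for v v'
      by (simp add: D pillow_augment_def augment_simps of_model_simps pillow_simps)
    show "pillow_augment \<theta> (env_act \<theta> K v) = K \<odot>\<^bsub>?D\<^esub> pillow_augment \<theta> v"
      if "K \<in> carrier (env_ring \<theta>)" "proj \<theta> 0 v = v" for K v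
      by (rule pillow_augment_act[OF that(1) fx[OF that(2)]])
    show "\<exists>v. proj \<theta> 0 v = v \<and> pillow_augment \<theta> v = m" if "m \<in> carrier ?D" for m
    proof (intro exI conjI)
      have m: "m \<in> carrier (nc_pillow \<theta>)" using that by (simp add: D)
      \<comment> \<open>m \<otimes> 1 multiplies to m; it is averaged so that invariance holds by
        construction.\<close>
      let ?x = "left_emb (torus_model \<theta> m)"
      show "proj \<theta> 0 (half_sum ?x (flip ?x), 0) = (half_sum ?x (flip ?x), 0)"
        unfolding proj_fixed by (simp add: half_sum_fixed)
      have "augment \<theta> (half_sum ?x (flip ?x)) = half_sum (torus_model \<theta> m) (flip (torus_model \<theta> m))"
        by (simp only: half_sum_def augment_simps augment_flip augment_left_emb)
      then show "pillow_augment \<theta> (half_sum ?x (flip ?x), 0) = m"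
        using m by (simp add: pillow_augment_def pillow_simps)
    qed
    show "koszul \<theta> 0 ` {v. proj \<theta> 1 v = v} = {v. proj \<theta> 0 v = v \<and> pillow_augment \<theta> v = \<zero>\<^bsub>?D\<^esub>}"
      unfolding D by (rule koszul_fixed_0)
  qed (rule equivariant_proj proj_proj equivariant_koszul koszul_fixed)+
qed

theorem theorem1:
  fixes \<theta> :: real
  assumes "\<theta> \<notin> \<rat>"
  shows "strongly_graded_algebra (integer_mod_group 2) (nc_torus \<theta>) (torus_part \<theta>)
    \<and> homologically_smooth (nc_pillow \<theta>)"
  using strongly_graded_torus[OF assms] homologically_smooth_pillow[OF assms] by blast

end
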